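(* Let $M$ be a compact connected boundaryless smooth manifold with $\dim M\ge 1$. Let $\mathcal{C}$ denote either (i) the space $C^0(M)$ of all continuous maps from $M$ to itself, where $\dim M$ is arbitrary, or (ii) the space $\mathrm{Homeo}(M)$ of all homeomorphisms from $M$ to itself, where $\dim M\geq 2$. Then there is a residual set $\mathcal{R}\subset\mathcal{C}$ such that every $f\in\mathcal{R}$ is weird.
   Context: $C^0(M)$ and $\mathrm{Homeo}(M)$ carry the $C^0$ topology, induced by $d_{C^0}(f,g)=\sup_{x\in M}d(f(x),g(x))$, where $d$ is a fixed distance on $M$ inducing its topology. A subset of a topological space $X$ is residual if it contains the intersection of a countable family of open and dense subsets of $X$. A volume probability $m$ (Borel probability measure given by a smooth positive density) on $M$ is fixed and called Lebesgue measure. For continuous $f:M\to M$ and $x\in M$, the Birkhoff limit of $x$, when it exists, is the probability measure $\mu_x=\lim_{n\to\infty}\frac1n\sum_{j=1}^n\delta_{f^j(x)}$, the limit being taken in the weak* topology on Borel probability measures. For a Borel probability $\mu$ on $M$, its basin is $B(\mu)=\{x\in M:\mu_x \text{ is well defined and } \mu_x=\mu\}$; $\mu$ is a physical measure of $f$ if $m(B(\mu))>0$. The map $f$ is totally singular if there is a Borel set $\Lambda\subset M$ with $m(\Lambda)=1$ and $m(f^{-1}(\Lambda))=0$. $f$ is weird if $m$-almost every point $x$ has a well-defined Birkhoff limit $\mu_x$, and moreover $f$ is totally singular and admits no physical measure. *)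

theory Defs
  imports "HOL-Probability.Probability"
begin

(* The manifold M is the whole of a type 'm; its metric_space instance is the fixed distance d.
   The model space is a Euclidean space 'e, so that dim M = DIM('e), which is always >= 1. *)

(* C^k on an open set: all iterated directional derivatives up to order k exist as
   Frechet derivatives and those of order k are continuous. Only meaningful for open S. *)
primrec C_k_on :: "nat \<Rightarrow> ('a::real_normed_vector \<Rightarrow> 'b::real_normed_vector) \<Rightarrow> 'a set \<Rightarrow> bool" where
  "C_k_on 0 f S \<longleftrightarrow> continuous_on S f"
| "C_k_on (Suc k) f S \<longleftrightarrow>
     (\<forall>x\<in>S. f differentiable (at x)) \<and>
     (\<forall>v. C_k_on k (\<lambda>x. frechet_derivative f (at x) v) S)"

definition smooth_on :: "'a set \<Rightarrow> ('a::real_normed_vector \<Rightarrow> 'b::real_normed_vector) \<Rightarrow> bool" where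
  "smooth_on S f \<longleftrightarrow> (\<forall>k. C_k_on k f S)"

definition chart :: "'m::metric_space set \<times> ('m \<Rightarrow> 'e::euclidean_space) \<Rightarrow> bool" where
  "chart = (\<lambda>(U, \<phi>). open U \<and> open (\<phi> ` U) \<and> (\<exists>\<psi>. homeomorphism U (\<phi> ` U) \<phi> \<psi>))"

(* Charts take values in open subsets of the full Euclidean space: there is no boundary. *)
definition smooth_atlas :: "('m::metric_space set \<times> ('m \<Rightarrow> 'e::euclidean_space)) set \<Rightarrow> bool" where
  "smooth_atlas \<A> \<longleftrightarrow>
     (\<forall>c\<in>\<A>. chart c) \<and>
     (\<Union>(U, \<phi>)\<in>\<A>. U) = UNIV \<and>
     (\<forall>(U, \<phi>)\<in>\<A>. \<forall>(V, \<psi>)\<in>\<A>. smooth_on (\<phi> ` (U \<inter> V)) (\<psi> \<circ> inv_into U \<phi>))"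

(* In every chart (U, \<phi>) the image of m is \<rho> times Lebesgue measure with \<rho> smooth and positive. *)
definition volume_probability ::
    "('m::metric_space set \<times> ('m \<Rightarrow> 'e::euclidean_space)) set \<Rightarrow> 'm measure \<Rightarrow> bool" where
  "volume_probability \<A> m \<longleftrightarrow>
     prob_space m \<and> sets m = sets borel \<and>
     (\<forall>(U, \<phi>)\<in>\<A>. \<exists>\<rho> :: 'e \<Rightarrow> real.
        smooth_on (\<phi> ` U) \<rho> \<and> (\<forall>y\<in>\<phi> ` U. \<rho> y > 0) \<and>
        (\<forall>B\<in>sets borel. B \<subseteq> \<phi> ` U \<longrightarrow>
           emeasure m {x \<in> U. \<phi> x \<in> B} = (\<integral>\<^sup>+ y \<in> B. ennreal (\<rho> y) \<partial>lborel)))"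

definition residual_in :: "'a topology \<Rightarrow> 'a set \<Rightarrow> bool" where
  "residual_in X R \<longleftrightarrow>
     R \<subseteq> topspace X \<and>
     (\<exists>\<U>. countable \<U> \<and> (\<forall>U\<in>\<U>. openin X U \<and> X closure_of U = topspace X) \<and>
          topspace X \<inter> \<Inter>\<U> \<subseteq> R)"

(* For compact M every continuous map is bounded, so the library type of bounded continuous
   functions, whose distance is SUP x. dist (f x) (g x), is the space of all continuous self-maps. *)
definition C0_space :: "('m::metric_space \<Rightarrow>\<^sub>C 'm) topology" where
  "C0_space = euclidean"

definition Homeo_space :: "('m::metric_space \<Rightarrow>\<^sub>C 'm) topology" where
  "Homeo_space = top_of_set {f. \<exists>g. homeomorphism UNIV UNIV (apply_bcontfun f) g}"

definition borel_probs :: "'m::topological_space measure set" where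
  "borel_probs = {\<mu>. prob_space \<mu> \<and> sets \<mu> = sets borel}"

(* The coarsest topology making \<mu> \<mapsto> \<integral>g d\<mu> continuous for every continuous g.
   It is used for compact 'm only, where such g are bounded. *)
definition weak_star_topology :: "'m::topological_space measure topology" where
  "weak_star_topology = topology_generated_by
     {{\<mu> \<in> borel_probs. (\<integral>x. g x \<partial>\<mu>) \<in> V} | (g :: 'm \<Rightarrow> real) V. continuous_on UNIV g \<and> open V}"

(* The average of the Dirac measures at f^1(x), ..., f^n(x). *)
definition empirical_measure ::
    "('m::topological_space \<Rightarrow> 'm) \<Rightarrow> 'm \<Rightarrow> nat \<Rightarrow> 'm measure" where
  "empirical_measure f x n = measure_of UNIV (sets borel)
     (\<lambda>B. (\<Sum>j=1..n. emeasure (return borel ((f ^^ j) x)) B) / of_nat n)"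

(* The set function above is a measure, so measure_of does not collapse to the zero measure. *)
lemma emeasure_empirical_measure:
  assumes "B \<in> sets borel"
  shows "emeasure (empirical_measure f x n) B
           = (\<Sum>j=1..n. emeasure (return borel ((f ^^ j) x)) B) / of_nat n"
  unfolding empirical_measure_def
proof (rule emeasure_measure_of_sigma)
  show "sigma_algebra UNIV (sets borel)"
    using sets.sigma_algebra_axioms[of borel] by simp
  show "positive (sets borel) (\<lambda>B. (\<Sum>j=1..n. emeasure (return borel ((f ^^ j) x)) B) / of_nat n)"
    by (simp add: positive_def)
  show "countably_additive (sets borel) (\<lambda>B. (\<Sum>j=1..n. emeasure (return borel ((f ^^ j) x)) B) / of_nat n)"
  proof (rule countably_additiveI)
    fix A :: "nat \<Rightarrow> 'a set"
    assume A: "range A \<subseteq> sets borel" "disjoint_family A" "(\<Union>i. A i) \<in> sets borel"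
    have "(\<Sum>i. (\<Sum>j=1..n. emeasure (return borel ((f ^^ j) x)) (A i)) / of_nat n)
        = (\<Sum>j=1..n. \<Sum>i. emeasure (return borel ((f ^^ j) x)) (A i)) / of_nat n"
      by (simp add: divide_ennreal_def suminf_sum)
    also have "\<dots> = (\<Sum>j=1..n. emeasure (return borel ((f ^^ j) x)) (\<Union>i. A i)) / of_nat n"
      using A by (subst suminf_emeasure) auto
    finally show "(\<Sum>i. (\<Sum>j=1..n. emeasure (return borel ((f ^^ j) x)) (A i)) / of_nat n)
        = (\<Sum>j=1..n. emeasure (return borel ((f ^^ j) x)) (\<Union>i. A i)) / of_nat n" .
  qed
qed (fact assms)

definition has_birkhoff_limit ::
    "('m::topological_space \<Rightarrow> 'm) \<Rightarrow> 'm \<Rightarrow> 'm measure \<Rightarrow> bool" where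
  "has_birkhoff_limit f x \<mu> \<longleftrightarrow> limitin weak_star_topology (empirical_measure f x) \<mu> sequentially"

definition basin :: "('m::topological_space \<Rightarrow> 'm) \<Rightarrow> 'm measure \<Rightarrow> 'm set" where
  "basin f \<mu> = {x. has_birkhoff_limit f x \<mu>}"

definition physical_measure ::
    "'m::topological_space measure \<Rightarrow> ('m \<Rightarrow> 'm) \<Rightarrow> 'm measure \<Rightarrow> bool" where
  "physical_measure m f \<mu> \<longleftrightarrow> \<mu> \<in> borel_probs \<and> emeasure m (basin f \<mu>) > 0"

definition totally_singular :: "'m::topological_space measure \<Rightarrow> ('m \<Rightarrow> 'm) \<Rightarrow> bool" where
  "totally_singular m f \<longleftrightarrow>
     (\<exists>\<Lambda>\<in>sets borel. emeasure m \<Lambda> = 1 \<and> emeasure m (f -` \<Lambda>) = 0)"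

definition weird :: "'m::topological_space measure \<Rightarrow> ('m \<Rightarrow> 'm) \<Rightarrow> bool" where
  "weird m f \<longleftrightarrow>
     (AE x in m. \<exists>\<mu>. has_birkhoff_limit f x \<mu>) \<and>
     totally_singular m f \<and>
     \<not> (\<exists>\<mu>. physical_measure m f \<mu>)"

end

theory Submission
  imports Defs
begin

text \<open>Call a map \<open>e\<close>-trapping if, up to mass \<open>e\<close>, the manifold is covered by finitely many compact
  sets of mass less than \<open>e\<close>, each sent in one step into its own finite family of sets of diameter at
  most \<open>e\<close>, such that every member of a family is mapped into the interior of a member of the same
  family, different families are disjoint, and the image of the compact sets lies in an open set of mass
  less than \<open>e\<close>. This is an open condition. If it holds for \<open>e = 2^-n\<close> and all \<open>n\<close>, almost every
  orbit is, up to any error, asymptotically periodic, hence has a Birkhoff limit; disjointness of the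
  families shows that the basin of a single measure has mass at most \<open>2 * 2^-n\<close>; and
  Borel-Cantelli gives total singularity.

  Density for continuous maps: assign disjoint finite nets to the members of a fine Vitali family of
  disjoint chart balls, shrink these to avoid the nets, and make the map constant near each ball and each
  net point, with value in the corresponding net.

  Density for homeomorphisms \<open>f\<close> in dimension at least two, where the number of displaced points must be
  fixed before the size of the displacements: move the image of the center of the \<open>i\<close>-th ball to a
  generic nearby point \<open>z i\<close>, follow the \<open>f\<close>-orbit of \<open>z i\<close> until it nearly returns to itself, and close it
  there by a second small displacement. Precomposing with a homeomorphism that contracts almost all of
  each ball, except thin cones containing the finitely many orbit points, and contracts small balls
  around the orbit points makes the balls and the orbits trapping.\<close>

section \<open>Birkhoff limits\<close>

text \<open>For homeomorphisms the obstacle is a circular choice of constants. A composition of n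
  point moves of size \<open>\<epsilon>\<close> costs n * \<open>\<epsilon>\<close>; points are
  movable when they are closer than a Lebesgue number l belonging to \<open>\<epsilon>\<close>; and
  the length of an orbit segment with an l-close return depends on l. Displacing every point of a
  pseudo-orbit is therefore too expensive. A segment of a true orbit of f needs a displacement only
  where it is entered and where it is closed: two moves per ball, a number known before
  \<open>\<epsilon>\<close>. For continuous maps no such problem arises, since perturbations in
  disjoint cells do not add up.

  The contraction of a ball must leave a neighbourhood of each orbit point untouched, although
  orbits may visit the ball. A radial contraction preserves rays, so it suffices to switch it off on
  cones around finitely many rays, and these have small mass when lines are null, that is, in
  dimension at least two. The same bound on the dimension keeps a punctured ball connected, which is
  what moving one point while fixing finitely many others requires.\<close>

lemma empirical_measure_eq_distr:
  assumes "n \<ge> 1"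
  shows "empirical_measure f x n = distr (measure_pmf (pmf_of_set {1..n})) borel (\<lambda>j. (f ^^ j) x)"
proof (rule measure_eqI)
  have sets: "sets (empirical_measure f x n) = sets borel"
    using sets.sets_measure_of_eq[of borel] by (simp add: empirical_measure_def)
  then show "sets (empirical_measure f x n)
      = sets (distr (measure_pmf (pmf_of_set {1..n})) borel (\<lambda>j. (f ^^ j) x))"
    by simp
  fix B assume "B \<in> sets (empirical_measure f x n)"
  then have B: "B \<in> sets borel"
    using sets by simp
  let ?S = "{j \<in> {1..n}. (f ^^ j) x \<in> B}"
  have "emeasure (empirical_measure f x n) B = (\<Sum>j=1..n. indicator B ((f ^^ j) x)) / of_nat n"
    using B by (simp add: emeasure_empirical_measure)
  also have "(\<Sum>j=1..n. indicator B ((f ^^ j) x) :: ennreal) = (\<Sum>j\<in>{1..n}. if (f ^^ j) x \<in> B then 1 else 0)"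
    by (intro sum.cong) (auto simp: indicator_def)
  also have "\<dots> = of_nat (card ?S)"
    by (subst sum.inter_filter[symmetric]) auto
  also have "of_nat (card ?S) / of_nat n = ennreal (card ?S / n)"
    using assms by (subst divide_ennreal[symmetric]) (auto simp: ennreal_of_nat_eq_real_of_nat)
  also have "{1..n} \<inter> (\<lambda>j. (f ^^ j) x) -` B = ?S"
    by auto
  then have "ennreal (card ?S / n) = emeasure (distr (measure_pmf (pmf_of_set {1..n})) borel (\<lambda>j. (f ^^ j) x)) B"
    using B assms by (simp add: emeasure_distr emeasure_pmf_of_set)
  finally show "emeasure (empirical_measure f x n) B
    = emeasure (distr (measure_pmf (pmf_of_set {1..n})) borel (\<lambda>j. (f ^^ j) x)) B" .
qed

lemma empirical_measure_in_borel_probs: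
  "n \<ge> 1 \<Longrightarrow> empirical_measure f x n \<in> borel_probs"
  unfolding borel_probs_def
  by (simp add: empirical_measure_eq_distr prob_space.prob_space_distr[OF prob_space_measure_pmf])

lemma integral_empirical_measure:
  fixes g :: "'m::topological_space \<Rightarrow> real"
  assumes "n \<ge> 1" "continuous_on UNIV g"
  shows "(\<integral>y. g y \<partial>empirical_measure f x n) = (\<Sum>j=1..n. g ((f ^^ j) x)) / n"
  using assms
  by (simp add: empirical_measure_eq_distr integral_distr integral_pmf_of_set borel_measurable_continuous_onI)

text \<open>Eventual membership passes to finite intersections and to arbitrary unions, so a
  subbasis suffices.\<close>

lemma limitin_topology_generated_by:
  assumes "\<mu> \<in> \<Union>S" "\<And>U. U \<in> S \<Longrightarrow> \<mu> \<in> U \<Longrightarrow> eventually (\<lambda>n. E n \<in> U) F"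
  shows "limitin (topology_generated_by S) E \<mu> F"
  unfolding limitin_def
proof (intro conjI allI impI)
  show "\<mu> \<in> topspace (topology_generated_by S)"
    using assms(1) by (simp add: topology_generated_by_topspace)
  fix U assume "openin (topology_generated_by S) U \<and> \<mu> \<in> U"
  then have "generate_topology_on S U" "\<mu> \<in> U"
    by (auto simp: openin_topology_generated_by_iff)
  then show "eventually (\<lambda>n. E n \<in> U) F"
  proof (induction U rule: generate_topology_on.induct)
    case (Int a b)
    then show ?case by (auto simp: eventually_conj_iff)
  next
    case (UN K)
    then obtain k where "k \<in> K" "\<mu> \<in> k" "eventually (\<lambda>n. E n \<in> k) F"
      by auto
    then show ?case by (auto elim: eventually_mono)
  qed (use assms(2) in auto)
qed

text \<open>The only form in which the weak* topology is used later: limits and basins become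
  statements on real averages of continuous functions.\<close>

lemma has_birkhoff_limit_iff:
  fixes f :: "'m::topological_space \<Rightarrow> 'm"
  shows "has_birkhoff_limit f x \<mu> \<longleftrightarrow> \<mu> \<in> borel_probs \<and>
    (\<forall>g :: 'm \<Rightarrow> real. continuous_on UNIV g \<longrightarrow>
       (\<lambda>n. (\<Sum>j=1..n. g ((f ^^ j) x)) / n) \<longlonglongrightarrow> (\<integral>y. g y \<partial>\<mu>))"
proof -
  let ?S = "{{\<mu> \<in> borel_probs. (\<integral>x. g x \<partial>\<mu>) \<in> V} | (g :: 'm \<Rightarrow> real) V. continuous_on UNIV g \<and> open V}"
  have ev: "(\<lambda>n. (\<Sum>j=1..n. g ((f ^^ j) x)) / n) \<longlonglongrightarrow> (\<integral>y. g y \<partial>\<mu>)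
      \<longleftrightarrow> (\<lambda>n. \<integral>y. g y \<partial>empirical_measure f x n) \<longlonglongrightarrow> (\<integral>y. g y \<partial>\<mu>)"
    if "continuous_on UNIV g" for g :: "'m \<Rightarrow> real"
    \<comment> \<open>For n = 0 there is no uniform distribution on \<open>{1..n}\<close>, so the
      two sequences are compared from 1 on.\<close>
    using that by (intro filterlim_cong refl eventually_sequentiallyI[of 1])
      (simp add: integral_empirical_measure)
  show ?thesis
  proof (intro iffI conjI allI impI)
    assume lim: "has_birkhoff_limit f x \<mu>"
    then have "\<mu> \<in> \<Union>?S"
      by (auto simp: has_birkhoff_limit_def limitin_def weak_star_topology_def topology_generated_by_topspace)
    then show mu: "\<mu> \<in> borel_probs" by auto
    fix g :: "'m \<Rightarrow> real" assume g: "continuous_on UNIV g"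
    have "(\<lambda>n. \<integral>y. g y \<partial>empirical_measure f x n) \<longlonglongrightarrow> (\<integral>y. g y \<partial>\<mu>)"
    proof (rule topological_tendstoI)
      fix V :: "real set" assume V: "open V" "(\<integral>y. g y \<partial>\<mu>) \<in> V"
      have "openin weak_star_topology {\<mu> \<in> borel_probs. (\<integral>x. g x \<partial>\<mu>) \<in> V}"
        unfolding weak_star_topology_def by (rule topology_generated_by_Basis) (use g V in blast)
      with lim mu V have "eventually (\<lambda>n. empirical_measure f x n \<in> {\<mu> \<in> borel_probs. (\<integral>x. g x \<partial>\<mu>) \<in> V}) sequentially"
        unfolding has_birkhoff_limit_def limitin_def by blast
      then show "eventually (\<lambda>n. (\<integral>y. g y \<partial>empirical_measure f x n) \<in> V) sequentially"
        by (rule eventually_mono) auto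
    qed
    then show "(\<lambda>n. (\<Sum>j=1..n. g ((f ^^ j) x)) / n) \<longlonglongrightarrow> (\<integral>y. g y \<partial>\<mu>)"
      using ev g by blast
  next
    assume rhs: "\<mu> \<in> borel_probs \<and> (\<forall>g :: 'm \<Rightarrow> real. continuous_on UNIV g \<longrightarrow>
       (\<lambda>n. (\<Sum>j=1..n. g ((f ^^ j) x)) / n) \<longlonglongrightarrow> (\<integral>y. g y \<partial>\<mu>))"
    show "has_birkhoff_limit f x \<mu>"
      unfolding has_birkhoff_limit_def weak_star_topology_def
    proof (rule limitin_topology_generated_by)
      have "borel_probs = {\<mu> \<in> borel_probs. (\<integral>x. (\<lambda>_. 0) x \<partial>\<mu>) \<in> (UNIV :: real set)}"
        by simp
      then have "borel_probs \<in> ?S"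
        by (intro CollectI exI[of _ "\<lambda>_. 0"] exI[of _ UNIV]) auto
      then show "\<mu> \<in> \<Union>?S" using rhs by blast
      fix U assume "U \<in> ?S" "\<mu> \<in> U"
      from \<open>U \<in> ?S\<close> obtain g :: "'m \<Rightarrow> real" and V where
        gV: "U = {\<mu> \<in> borel_probs. (\<integral>x. g x \<partial>\<mu>) \<in> V} \<and> continuous_on UNIV g \<and> open V"
        by blast
      then have g: "continuous_on UNIV g" "open V" "U = {\<mu> \<in> borel_probs. (\<integral>x. g x \<partial>\<mu>) \<in> V}"
        by auto
      have "(\<integral>x. g x \<partial>\<mu>) \<in> V"
        using \<open>\<mu> \<in> U\<close> g(3) by simp
      moreover have "(\<lambda>n. \<integral>y. g y \<partial>empirical_measure f x n) \<longlonglongrightarrow> (\<integral>y. g y \<partial>\<mu>)"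
        using rhs ev g(1) by blast
      ultimately have "eventually (\<lambda>n. (\<integral>y. g y \<partial>empirical_measure f x n) \<in> V) sequentially"
        using g(2) topological_tendstoD by blast
      with eventually_ge_at_top[of 1]
      show "eventually (\<lambda>n. empirical_measure f x n \<in> U) sequentially"
        by eventually_elim (use g empirical_measure_in_borel_probs in auto)
    qed
  qed
qed

text \<open>With n = q * P + s, the q full blocks contribute exactly q times the sum over a period.
  The incomplete block and the fraction s / P of that sum are each at most P * C, whence the factor
  2.\<close>

lemma sum_periodic_le:
  fixes a :: "nat \<Rightarrow> real"
  assumes "P \<ge> 1" "\<And>r. r < P \<Longrightarrow> \<bar>a r\<bar> \<le> C"
  shows "\<bar>(\<Sum>j<n. a (j mod P)) - n * ((\<Sum>r<P. a r) / P)\<bar> \<le> 2 * P * C"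
proof -
  define q where "q = n div P"
  define s where "s = n mod P"
  have n: "n = q * P + s" "s < P" using assms(1) by (auto simp: q_def s_def)
  let ?A = "\<Sum>r<P. a r"
  have block: "(\<Sum>j<q * P. a (j mod P)) = q * ?A" for q
  proof (induction q)
    case (Suc q)
    have "(\<Sum>j<Suc q * P. a (j mod P)) = (\<Sum>j<q * P. a (j mod P)) + (\<Sum>j\<in>{q*P..<q*P+P}. a (j mod P))"
      using sum.atLeastLessThan_concat[of 0 "q*P" "q*P+P" "\<lambda>j. a (j mod P)"]
      by (simp add: lessThan_atLeast0 add.commute)
    also have "(\<Sum>j\<in>{q*P..<q*P+P}. a (j mod P)) = (\<Sum>j<P. a ((q*P + j) mod P))"
      by (rule sum.reindex_bij_witness[of _ "\<lambda>j. q*P + j" "\<lambda>j. j - q*P"]) auto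
    also have "\<dots> = ?A" by (intro sum.cong) auto
    finally show ?case using Suc by (simp add: algebra_simps)
  qed simp
  have "(\<Sum>j<n. a (j mod P)) = (\<Sum>j<q * P. a (j mod P)) + (\<Sum>j\<in>{q*P..<q*P+s}. a (j mod P))"
    unfolding n(1) using sum.atLeastLessThan_concat[of 0 "q*P" "q*P+s" "\<lambda>j. a (j mod P)"]
    by (simp add: lessThan_atLeast0)
  then have eq: "(\<Sum>j<n. a (j mod P)) = q * ?A + (\<Sum>j\<in>{q*P..<q*P+s}. a (j mod P))"
    by (simp add: block)
  have "0 < P" using assms(1) by simp
  from order_trans[OF abs_ge_zero assms(2)[OF this]] have C: "C \<ge> 0" .
  have "\<bar>\<Sum>j\<in>{q*P..<q*P+s}. a (j mod P)\<bar> \<le> (\<Sum>j\<in>{q*P..<q*P+s}. C)"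
    using \<open>0 < P\<close> by (intro order_trans[OF sum_abs] sum_mono assms(2) mod_less_divisor)
  also have "\<dots> \<le> P * C" using n(2) C by (simp add: mult_right_mono)
  finally have 1: "\<bar>\<Sum>j\<in>{q*P..<q*P+s}. a (j mod P)\<bar> \<le> P * C" .
  have "\<bar>?A\<bar> \<le> (\<Sum>r<P. C)"
    by (intro order_trans[OF sum_abs] sum_mono assms(2)) simp
  then have A: "\<bar>?A\<bar> \<le> P * C" by simp
  have "real n = real q * real P + real s"
    by (metis n(1) of_nat_add of_nat_mult)
  then have "n * (?A / P) - q * ?A = (s / P) * ?A"
    using assms(1) by (simp add: distrib_right add_divide_distrib)
  moreover have "\<bar>(s / P) * ?A\<bar> \<le> 1 * (P * C)"
    unfolding abs_mult using n(2) A by (intro mult_mono) auto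
  ultimately have "\<bar>n * (?A / P) - q * ?A\<bar> \<le> P * C" by simp
  moreover have "\<bar>S - T\<bar> \<le> B + B" if "S = Q + R" "\<bar>R\<bar> \<le> B" "\<bar>T - Q\<bar> \<le> B" for S T Q R B :: real
    using that by linarith
  ultimately have "\<bar>(\<Sum>j<n. a (j mod P)) - n * (?A / P)\<bar> \<le> P * C + P * C"
    using eq 1 by blast
  then show ?thesis by (simp add: ac_simps)
qed

section \<open>Equidistributed residues through digit reversal\<close>

lemma integral_floor:
  fixes F :: "nat \<Rightarrow> real"
  assumes "P \<ge> 1"
  shows "(LINT t|restrict_space lborel {0..<1}. F (nat \<lfloor>real P * t\<rfloor>)) = (\<Sum>s<P. F s) / P"
proof -
  have eq: "indicator {0..<1} t *\<^sub>R F (nat \<lfloor>real P * t\<rfloor>)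
      = (\<Sum>s<P. indicator {s / P..<(s + 1) / P} t *\<^sub>R F s)" for t :: real
  proof (cases "t \<in> {0..<1}")
    case True
    define k where "k = nat \<lfloor>real P * t\<rfloor>"
    have "0 \<le> real P * t" "real P * t < P" using True assms by auto
    then have "k < P" unfolding k_def by linarith
    have ind: "t \<in> {s / P..<(s + 1) / P} \<longleftrightarrow> s = k" for s :: nat
    proof -
      have "t \<in> {s / P..<(s + 1) / P} \<longleftrightarrow> real s \<le> real P * t \<and> real P * t < real s + 1"
        using assms by (auto simp: field_simps)
      also have "\<dots> \<longleftrightarrow> s = k"
        unfolding k_def using \<open>0 \<le> real P * t\<close> floor_eq_iff[of "real P * t" "int s"]
        by (auto simp: nat_eq_iff)
      finally show ?thesis .
    qed
    have "(\<Sum>s<P. indicator {s / P..<(s + 1) / P} t *\<^sub>R F s) = (\<Sum>s<P. if s = k then F s else 0)"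
      by (intro sum.cong refl) (simp only: indicator_def ind, simp)
    also have "\<dots> = F k" using \<open>k < P\<close> by simp
    finally show ?thesis using True by (simp add: k_def)
  next
    case False
    have "t \<notin> {s / P..<(s + 1) / P}" if "s < P" for s :: nat
    proof
      assume t: "t \<in> {s / P..<(s + 1) / P}"
      have "0 \<le> real s / P" "real (s + 1) / P \<le> 1" using that assms by (auto simp: field_simps)
      then show False using t False unfolding atLeastLessThan_iff of_nat_add of_nat_1 by linarith
    qed
    then show ?thesis using False by simp
  qed
  have "(LINT t|restrict_space lborel {0..<1}. F (nat \<lfloor>real P * t\<rfloor>))
      = (LINT t|lborel. indicator {0..<1} t *\<^sub>R F (nat \<lfloor>real P * t\<rfloor>))"
    by (subst integral_restrict_space) (auto)
  also have "\<dots> = (LINT t|lborel. (\<Sum>s<P. indicator {s / P..<(s + 1) / P} t *\<^sub>R F s))"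
    by (simp only: eq)
  also have "\<dots> = (\<Sum>s<P. (LINT t|lborel. indicator {s / P..<(s + 1) / P} t *\<^sub>R F s))"
    by (rule Bochner_Integration.integral_sum) (auto intro!: integrable_scaleR_left integrable_real_indicator simp: divide_right_mono)
  also have "\<dots> = (\<Sum>s<P. F s / P)"
    using assms by (intro sum.cong) (auto simp: field_simps)
  finally show ?thesis by (simp add: sum_divide_distrib)
qed

text \<open>Digit reversal in a mixed radix: the lowest digit \<open>s mod p k\<close> becomes the
  highest digit of the value. Finer partitions of the unit interval append low digits to the index
  of the interval containing t, whereas compatible residues must extend upwards; reversal reconciles
  the two.\<close>

primrec mixed_radix :: "(nat \<Rightarrow> nat) \<Rightarrow> nat \<Rightarrow> nat \<Rightarrow> nat" where
  "mixed_radix p 0 s = 0"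
| "mixed_radix p (Suc k) s = mixed_radix p k (s div p k) + (\<Prod>i<k. p i) * (s mod p k)"

text \<open>Quotient and remainder of the value by \<open>\<Prod>i<k. p i\<close> recover the last
  digit and, by induction, the others. An injective self-map of a finite set is onto.\<close>

lemma bij_betw_mixed_radix:
  assumes p: "\<And>i. p i \<ge> (1::nat)"
  shows "bij_betw (mixed_radix p k) {..<\<Prod>i<k. p i} {..<\<Prod>i<k. p i}"
proof (induction k)
  case (Suc k)
  let ?P = "\<Prod>i<k. p i"
  have P: "?P > 0" using p by (intro prod_pos) (auto simp: Suc_le_eq)
  have pk: "p k > 0" using p[of k] by simp
  have bound: "mixed_radix p k s < ?P" if "s < ?P" for s
    using Suc that by (auto simp: bij_betw_def)
  have divlt: "s div p k < ?P" if "s < ?P * p k" for s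
    using that by (rule less_mult_imp_div_less)
  have mod: "mixed_radix p (Suc k) s mod ?P = mixed_radix p k (s div p k)"
    and div: "mixed_radix p (Suc k) s div ?P = s mod p k" if "s < ?P * p k" for s
    using bound[OF divlt[OF that]] P by auto
  have "inj_on (mixed_radix p (Suc k)) {..<?P * p k}"
  proof (rule inj_onI)
    fix s t assume st: "s \<in> {..<?P * p k}" "t \<in> {..<?P * p k}"
      "mixed_radix p (Suc k) s = mixed_radix p (Suc k) t"
    then have "mixed_radix p k (s div p k) = mixed_radix p k (t div p k)" "s mod p k = t mod p k"
      using mod div by (metis lessThan_iff)+
    moreover have "s div p k = t div p k"
      using Suc calculation(1) divlt st by (auto simp: bij_betw_def dest!: inj_onD)
    ultimately show "s = t" by (metis mult_div_mod_eq)
  qed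
  moreover have "mixed_radix p (Suc k) ` {..<?P * p k} \<subseteq> {..<?P * p k}"
  proof clarify
    fix s assume "s < ?P * p k"
    then have "mixed_radix p (Suc k) s < ?P + ?P * (s mod p k)"
      using bound divlt by simp
    also have "\<dots> = ?P * Suc (s mod p k)" by simp
    also have "\<dots> \<le> ?P * p k"
      using pk by (intro mult_le_mono2) (simp add: Suc_le_eq)
    finally show "mixed_radix p (Suc k) s < ?P * p k" .
  qed
  ultimately have "bij_betw (mixed_radix p (Suc k)) {..<?P * p k} {..<?P * p k}"
    by (simp add: bij_betw_def endo_inj_surj del: mixed_radix.simps)
  then show ?case by (simp del: mixed_radix.simps)
qed (simp add: bij_betw_def lessThan_Suc)

text \<open>Refining a partition of the unit interval appends one lowest digit to the index of the
  interval containing t; the division removes it again.\<close>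

lemma nat_floor_mult_div:
  assumes "p \<ge> (1::nat)" "0 \<le> t"
  shows "nat \<lfloor>real (P * p) * t\<rfloor> div p = nat \<lfloor>real P * t\<rfloor>"
proof -
  have "\<lfloor>real (P * p) * t\<rfloor> div int p = \<lfloor>(real (P * p) * t) / of_int (int p)\<rfloor>"
    by (rule floor_divide_real_eq_div[symmetric]) simp
  also have "(real (P * p) * t) / of_int (int p) = real P * t"
    using assms by simp
  finally have "\<lfloor>real (P * p) * t\<rfloor> div int p = \<lfloor>real P * t\<rfloor>" .
  moreover have "0 \<le> \<lfloor>real (P * p) * t\<rfloor>"
    using assms(2) by (simp only: zero_le_floor) (intro mult_nonneg_nonneg of_nat_0_le_iff)
  then have "nat (\<lfloor>real (P * p) * t\<rfloor> div int p) = nat \<lfloor>real (P * p) * t\<rfloor> div p"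
    by (simp only: nat_div_distrib nat_int)
  ultimately show ?thesis by metis
qed

text \<open>The limit measure is the image of Lebesgue measure on the unit interval under
  \<open>t \<mapsto> lim x (J k t)\<close>, where the residues of \<open>J k t\<close> modulo the \<open>k\<close>-th period
  are equidistributed in \<open>t\<close> and compatible for different \<open>k\<close>.\<close>

lemma asymptotically_periodic_imp_limit_measure:
  fixes x :: "nat \<Rightarrow> 'm::metric_space"
  assumes comp: "compact (UNIV :: 'm set)"
    and ap: "\<And>e. e > 0 \<Longrightarrow> \<exists>p\<ge>1. \<exists>N. \<forall>i\<ge>N. \<forall>j\<ge>N. i mod p = j mod p \<longrightarrow> dist (x i) (x j) \<le> e"
  shows "\<exists>\<mu>\<in>borel_probs. \<forall>g :: 'm \<Rightarrow> real. continuous_on UNIV g \<longrightarrow>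
           (\<lambda>n. (\<Sum>j=1..n. g (x j)) / n) \<longlonglongrightarrow> (\<integral>y. g y \<partial>\<mu>)"
proof -
  have "\<forall>k. \<exists>p N. p \<ge> 1 \<and> (\<forall>i\<ge>N. \<forall>j\<ge>N. i mod p = j mod p \<longrightarrow> dist (x i) (x j) \<le> (1/2)^k)"
    using ap by (metis half_gt_zero_iff zero_less_one zero_less_power)
  then obtain p N0 where p: "\<And>k. p k \<ge> (1::nat)"
    and near0: "\<And>k i j. i \<ge> N0 k \<Longrightarrow> j \<ge> N0 k \<Longrightarrow> i mod p k = j mod p k \<Longrightarrow> dist (x i) (x j) \<le> (1/2)^k"
    by metis
  \<comment> \<open>Products and sums replace the given periods and thresholds: now each period
    divides the next and the thresholds increase, while the estimate survives because
    \<open>p k\<close> divides \<open>P k\<close>.\<close>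
  define P where "P k = (\<Prod>i<Suc k. p i)" for k
  define N where "N k = (\<Sum>i\<le>k. N0 i)" for k
  have P_pos: "P k \<ge> 1" for k
    unfolding P_def by (metis One_nat_def Suc_le_eq p prod_pos)
  have P_Suc: "P (Suc k) = P k * p (Suc k)" for k by (simp add: P_def)
  have P_dvd: "k \<le> l \<Longrightarrow> P k dvd P l" for k l
    by (induction l rule: dec_induct) (auto simp: P_Suc)
  have N_mono: "k \<le> l \<Longrightarrow> N k \<le> N l" for k l
    unfolding N_def by (intro sum_mono2) auto
  have near: "dist (x i) (x j) \<le> (1/2)^k" if "i \<ge> N k" "j \<ge> N k" "i mod P k = j mod P k" for i j k
  proof (rule near0)
    have "N0 k \<le> N k" unfolding N_def by (intro member_le_sum) auto
    then show "i \<ge> N0 k" "j \<ge> N0 k" using that by auto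
    have "p k dvd P k" by (simp add: P_def)
    then show "i mod p k = j mod p k" using that(3) by (metis mod_mod_cancel)
  qed
  define s where "s k t = nat \<lfloor>real (P k) * t\<rfloor>" for k and t :: real
  define \<rho> where "\<rho> k = mixed_radix p (Suc k)" for k
  \<comment> \<open>A multiple of \<open>P k\<close> is added to pass the threshold without changing
    the residue. The successor accounts for averages that start at time 1.\<close>
  define J where "J k t = Suc (\<rho> k (s k t) + P k * N k)" for k t
  have J_ge: "J k t \<ge> N k" for k t
    using P_pos[of k] by (simp add: J_def trans_le_add2 le_SucI)
  have J_mod: "J l t mod P k = Suc (\<rho> k (s k t)) mod P k" if "k \<le> l" "0 \<le> t" for k l t
  proof -
    have "\<rho> l (s l t) mod P k = \<rho> k (s k t) mod P k"
      using \<open>k \<le> l\<close>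
    proof (induction l rule: dec_induct)
      case (step l)
      have "s (Suc l) t div p (Suc l) = s l t"
        unfolding s_def P_Suc by (rule nat_floor_mult_div) (use p that in auto)
      then have "\<rho> (Suc l) (s (Suc l) t) = \<rho> l (s l t) + P l * (s (Suc l) t mod p (Suc l))"
        by (simp add: \<rho>_def P_def)
      also have "\<dots> mod P k = \<rho> l (s l t) mod P k"
        using P_dvd[OF step(1)] by (auto elim!: dvdE simp: mult.assoc)
      finally show ?case using step by simp
    qed simp
    then have "Suc (\<rho> l (s l t)) mod P k = Suc (\<rho> k (s k t)) mod P k"
      by (metis mod_Suc_eq)
    moreover have "J l t mod P k = Suc (\<rho> l (s l t)) mod P k"
      unfolding J_def using P_dvd[OF \<open>k \<le> l\<close>] by (auto elim!: dvdE simp: mult.assoc simp flip: add_Suc)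
    ultimately show ?thesis by simp
  qed
  have Y_near: "dist (x (J k t)) (x (J l t)) \<le> (1/2)^k" if "k \<le> l" "0 \<le> t" for k l t
  proof (rule near)
    show "N k \<le> J l t" using J_ge[of l t] N_mono[OF that(1)] by linarith
  qed (use J_ge J_mod that in auto)
  have "\<exists>y. (\<lambda>k. x (J k t)) \<longlonglongrightarrow> y" if "0 \<le> t" for t
  proof -
    have "Cauchy (\<lambda>k. x (J k t))"
    proof (rule metric_CauchyI)
      fix e :: real assume "e > 0"
      then obtain K where K: "(1/2)^K < e/2" using real_arch_pow_inv[of "e/2" "1/2"] by auto
      have "dist (x (J k t)) (x (J l t)) < e" if "k \<ge> K" "l \<ge> K" for k l
      proof -
        have "dist (x (J k t)) (x (J l t)) \<le> dist (x (J K t)) (x (J k t)) + dist (x (J K t)) (x (J l t))"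
          by (rule dist_triangle3)
        also have "\<dots> \<le> (1/2)^K + (1/2)^K"
          using Y_near[OF that(1)] Y_near[OF that(2)] \<open>0 \<le> t\<close> by (intro add_mono) auto
        finally show ?thesis using K by simp
      qed
      then show "\<exists>M. \<forall>m\<ge>M. \<forall>n\<ge>M. dist (x (J m t)) (x (J n t)) < e" by blast
    qed
    then show ?thesis using compact_imp_complete[OF comp] by (auto simp: complete_def)
  qed
  then obtain Y where Y: "\<And>t. 0 \<le> t \<Longrightarrow> (\<lambda>k. x (J k t)) \<longlonglongrightarrow> Y t" by metis
  define L where "L = restrict_space lborel {0..<1::real}"
  have space_L: "space L = {0..<1}" by (simp add: L_def space_restrict_space)
  interpret L: prob_space L
    by (rule prob_spaceI) (simp add: L_def space_restrict_space emeasure_restrict_space)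
  have s_meas [measurable]: "s k \<in> measurable L (count_space UNIV)" for k
    unfolding s_def L_def by (intro measurable_restrict_space1) measurable
  have xJ_meas: "(\<lambda>t. x (J k t)) \<in> borel_measurable L" for k
    unfolding J_def by (rule measurable_compose[OF s_meas]) simp
  have Y_meas: "Y \<in> borel_measurable L"
    by (rule borel_measurable_LIMSEQ_metric[OF xJ_meas]) (auto simp: space_L intro: Y)
  define \<mu> where "\<mu> = distr L borel Y"
  have "\<mu> \<in> borel_probs"
    unfolding borel_probs_def \<mu>_def using L.prob_space_distr[OF Y_meas] by simp
  moreover have "(\<lambda>n. (\<Sum>j=1..n. g (x j)) / n) \<longlonglongrightarrow> (\<integral>y. g y \<partial>\<mu>)"
    if g: "continuous_on UNIV g" for g :: "'m \<Rightarrow> real"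
  proof -
    have g_meas: "g \<in> borel_measurable borel" using g by (rule borel_measurable_continuous_onI)
    have "bounded (range g)" using compact_continuous_image[OF g comp] compact_imp_bounded by blast
    then obtain C where C: "\<And>y. \<bar>g y\<bar> \<le> C" by (auto simp: bounded_iff)
    have int_Y: "(\<integral>y. g y \<partial>\<mu>) = (\<integral>t. g (Y t) \<partial>L)"
      unfolding \<mu>_def by (rule integral_distr[OF Y_meas g_meas])
    define I where "I k = (\<Sum>r<P k. g (x (Suc (r + P k * N k)))) / P k" for k
    \<comment> \<open>As t varies, the floor is uniform on the residues and \<open>\<rho> k\<close>
      permutes them, so integration over \<open>L\<close> is an average over one period beyond the
      threshold.\<close>
    have I: "(\<integral>t. g (x (J k t)) \<partial>L) = I k" for k
    proof -
      have "(\<integral>t. g (x (J k t)) \<partial>L) = (\<Sum>r<P k. g (x (Suc (\<rho> k r + P k * N k)))) / P k"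
        unfolding J_def s_def L_def by (rule integral_floor[OF P_pos])
      also have "(\<Sum>r<P k. g (x (Suc (\<rho> k r + P k * N k)))) = (\<Sum>r<P k. g (x (Suc (r + P k * N k))))"
        using bij_betw_mixed_radix[OF p, where k = "Suc k"] unfolding \<rho>_def P_def
        by (rule sum.reindex_bij_betw)
      finally show ?thesis by (simp add: I_def)
    qed
    have "(\<lambda>k. \<integral>t. g (x (J k t)) \<partial>L) \<longlonglongrightarrow> (\<integral>t. g (Y t) \<partial>L)"
    proof (rule integral_dominated_convergence[where w = "\<lambda>_. C"])
      show "AE t in L. (\<lambda>k. g (x (J k t))) \<longlonglongrightarrow> g (Y t)"
      proof (rule AE_I2)
        fix t assume "t \<in> space L"
        then have "(\<lambda>k. x (J k t)) \<longlonglongrightarrow> Y t" using Y by (simp add: space_L)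
        then show "(\<lambda>k. g (x (J k t))) \<longlonglongrightarrow> g (Y t)"
          using g by (intro isCont_tendsto_compose[of _ g]) (auto simp: continuous_on_eq_continuous_at)
      qed
      show "integrable L (\<lambda>_. C)" by (rule L.integrable_const)
    qed (use C measurable_compose[OF xJ_meas g_meas] measurable_compose[OF Y_meas g_meas] in auto)
    then have I_lim: "I \<longlonglongrightarrow> (\<integral>y. g y \<partial>\<mu>)" by (simp add: I int_Y)
    have uc: "uniformly_continuous_on UNIV g" using compact_uniformly_continuous[OF g comp] .
    show ?thesis
    proof (rule LIMSEQ_I)
      fix r :: real assume "r > 0"
      \<comment> \<open>One third for the distance from \<open>I k\<close> to the integral, one for
        the variation of g over distances up to (1/2)^k, one for a bounded error divided by
        n.\<close>
      define e where "e = r / 3"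
      have "e > 0" using \<open>r > 0\<close> by (simp add: e_def)
      then obtain d where d: "d > 0" "\<And>y z. dist y z < d \<Longrightarrow> dist (g y) (g z) < e"
        using uc by (auto simp: uniformly_continuous_on_def)
      obtain K where K: "(1/2)^K < d" using real_arch_pow_inv[of d "1/2"] d by auto
      obtain K' where K': "\<And>k. k \<ge> K' \<Longrightarrow> \<bar>I k - (\<integral>y. g y \<partial>\<mu>)\<bar> < e"
        using LIMSEQ_D[OF I_lim \<open>e > 0\<close>] by auto
      define k where "k = max K K'"
      have "(1/2::real)^k \<le> (1/2)^K" unfolding k_def by (intro power_decreasing) auto
      then have k: "(1/2::real)^k < d" using K by linarith
      have Ik: "\<bar>I k - (\<integral>y. g y \<partial>\<mu>)\<bar> < e" using K' by (simp add: k_def)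
      define a where "a r = g (x (Suc (r + P k * N k)))" for r
      have tm: "\<bar>g (x (Suc j)) - a (j mod P k)\<bar> \<le> e + (if j < N k then 2 * C else 0)" for j
      proof (cases "j < N k")
        case True
        then show ?thesis using C[of "x (Suc j)"] C[of "x (Suc (j mod P k + P k * N k))"] \<open>e > 0\<close>
          by (simp add: a_def)
      next
        case False
        have "dist (x (Suc j)) (x (Suc (j mod P k + P k * N k))) \<le> (1/2)^k"
        proof (rule near)
          show "N k \<le> Suc (j mod P k + P k * N k)"
            using P_pos[of k] by (simp add: trans_le_add2 le_SucI)
          show "Suc j mod P k = Suc (j mod P k + P k * N k) mod P k"
            by (metis mod_Suc_eq mod_mod_trivial mod_mult_self2)
        qed (use False in simp)
        then have "dist (g (x (Suc j))) (a (j mod P k)) < e"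
          unfolding a_def by (intro d) (use k in simp)
        then show ?thesis using False by (simp add: dist_real_def)
      qed
      \<comment> \<open>The error that does not grow with n: \<open>2 * C\<close> for each term
        before the threshold, plus the bound of \<open>sum_periodic_le\<close>.\<close>
      define D where "D = 2 * C * N k + 2 * real (P k) * C"
      have main: "\<bar>(\<Sum>j<n. g (x (Suc j))) - n * I k\<bar> \<le> n * e + D" for n
      proof -
        have "\<bar>(\<Sum>j<n. g (x (Suc j))) - (\<Sum>j<n. a (j mod P k))\<bar>
            \<le> (\<Sum>j<n. e + (if j < N k then 2 * C else 0))"
          unfolding sum_subtractf[symmetric] by (intro order_trans[OF sum_abs] sum_mono tm)
        also have "\<dots> = n * e + (\<Sum>j\<in>{..<n} \<inter> {..<N k}. 2 * C)"
          by (subst sum.inter_restrict) (auto simp: sum.distrib)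
        also have "(\<Sum>j\<in>{..<n} \<inter> {..<N k}. 2 * C) \<le> (\<Sum>j\<in>{..<N k}. 2 * C)"
          using C[of undefined] by (intro sum_mono2) auto
        finally have 1: "\<bar>(\<Sum>j<n. g (x (Suc j))) - (\<Sum>j<n. a (j mod P k))\<bar> \<le> n * e + 2 * C * N k"
          by (simp add: mult.commute)
        have "\<bar>(\<Sum>j<n. a (j mod P k)) - n * ((\<Sum>r<P k. a r) / P k)\<bar> \<le> 2 * real (P k) * C"
          by (rule sum_periodic_le) (use P_pos C in \<open>auto simp: a_def\<close>)
        then have "\<bar>(\<Sum>j<n. a (j mod P k)) - n * I k\<bar> \<le> 2 * real (P k) * C"
          by (simp add: I_def a_def)
        with 1 show ?thesis unfolding D_def by linarith
      qed
      obtain M :: nat where M: "D / e < M" using reals_Archimedean2 by blast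
      have "norm ((\<Sum>j=1..n. g (x j)) / n - (\<integral>y. g y \<partial>\<mu>)) < r" if "n \<ge> max 1 M" for n
      proof -
        have n: "n > 0" "D < e * n"
        proof -
          show "n > 0" using that by simp
          have "D / e < n" using M that by simp
          then show "D < e * n" using \<open>e > 0\<close> by (simp add: field_simps)
        qed
        have "(\<Sum>j=1..n. g (x j)) = (\<Sum>j<n. g (x (Suc j)))"
          by (rule sum.reindex_bij_witness[of _ Suc "\<lambda>j. j - 1"]) auto
        moreover have "S / n - I k = (S - n * I k) / n" for S
          using n by (simp add: diff_divide_distrib)
        ultimately have "\<bar>(\<Sum>j=1..n. g (x j)) / n - I k\<bar> = \<bar>(\<Sum>j<n. g (x (Suc j))) - n * I k\<bar> / n"
          by (simp only: abs_divide abs_of_nat)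
        also have "\<dots> \<le> (n * e + D) / n"
          using main by (rule divide_right_mono) simp
        also have "\<dots> < (n * e + e * n) / n"
          using n by (intro divide_strict_right_mono) auto
        also have "\<dots> = 2 * e" using n by (simp add: add_divide_distrib)
        finally show ?thesis using Ik unfolding e_def real_norm_def by linarith
      qed
      then show "\<exists>no. \<forall>n\<ge>no. norm ((\<Sum>j=1..n. g (x j)) / n - (\<integral>y. g y \<partial>\<mu>)) < r"
        by blast
    qed
  qed
  ultimately show ?thesis by blast
qed

section \<open>Trapping maps\<close>

text \<open>Pigeonhole: equal iterates at times a < b make b - a a period from time a on. Residues
  are used because the criterion for limit measures is phrased with them.\<close>

lemma orbit_step_eventually_periodic:
  assumes "finite S" "\<tau> ` S \<subseteq> S" "s \<in> S"
  shows "\<exists>p\<ge>1. \<exists>N. \<forall>i\<ge>N. \<forall>j\<ge>N. i mod p = j mod p \<longrightarrow> (\<tau> ^^ i) s = (\<tau> ^^ j) s"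
proof -
  have in_S: "(\<tau> ^^ i) s \<in> S" for i
    by (induction i) (use assms in auto)
  have "\<not> inj (\<lambda>i. (\<tau> ^^ i) s)"
  proof
    assume "inj (\<lambda>i. (\<tau> ^^ i) s)"
    then have "infinite (range (\<lambda>i. (\<tau> ^^ i) s))" by (simp add: range_inj_infinite)
    moreover have "range (\<lambda>i. (\<tau> ^^ i) s) \<subseteq> S" using in_S by auto
    ultimately show False using assms(1) finite_subset by blast
  qed
  then obtain a b where ab: "a < b" "(\<tau> ^^ a) s = (\<tau> ^^ b) s"
    unfolding inj_def by (metis linorder_neqE_nat)
  define p where "p = b - a"
  have per: "(\<tau> ^^ (i + p)) s = (\<tau> ^^ i) s" if "i \<ge> a" for i
  proof -
    have "(\<tau> ^^ (i + p)) s = (\<tau> ^^ (i - a)) ((\<tau> ^^ b) s)"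
      unfolding funpow_add[symmetric, THEN fun_cong, unfolded o_def]
      using that ab(1) by (simp add: p_def)
    also have "\<dots> = (\<tau> ^^ i) s"
      unfolding ab(2)[symmetric] funpow_add[symmetric, THEN fun_cong, unfolded o_def]
      using that by simp
    finally show ?thesis .
  qed
  have per': "(\<tau> ^^ (i + k * p)) s = (\<tau> ^^ i) s" if "i \<ge> a" for i k
  proof (induction k)
    case (Suc k)
    have "(\<tau> ^^ (i + Suc k * p)) s = (\<tau> ^^ ((i + k * p) + p)) s"
      by (simp add: ac_simps)
    also have "\<dots> = (\<tau> ^^ i) s" using per[of "i + k * p"] that Suc by simp
    finally show ?case .
  qed simp
  have *: "(\<tau> ^^ i) s = (\<tau> ^^ j) s" if "i \<ge> a" "i \<le> j" "i mod p = j mod p" for i j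
  proof -
    have "p dvd j - i" using that by (metis mod_eq_dvd_iff_nat)
    then obtain k where "j - i = p * k" by (elim dvdE)
    then have "j = i + k * p" using that(2) by (simp add: mult.commute)
    then show ?thesis using per'[OF that(1)] by simp
  qed
  have "(\<tau> ^^ i) s = (\<tau> ^^ j) s" if "i \<ge> a" "j \<ge> a" "i mod p = j mod p" for i j
    using *[OF that(1) _ that(3)] *[OF that(2) _ that(3)[symmetric]] by (metis nle_le)
  moreover have "p \<ge> 1" using ab by (simp add: p_def)
  ultimately show ?thesis by (intro exI[of _ p] conjI exI[of _ a] allI impI)
qed

text \<open>The families \<open>T b\<close> separate the limit measures of points of different \<open>K b\<close>; the set
  \<open>W\<close> serves for total singularity.\<close>

definition trap_data ::
  "'m::metric_space measure \<Rightarrow> real \<Rightarrow> nat set \<Rightarrow> (nat \<Rightarrow> 'm set) \<Rightarrow> (nat \<Rightarrow> 'm set set) \<Rightarrow> 'm set \<Rightarrow> bool"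
where
  "trap_data m e I K T W \<longleftrightarrow> finite I \<and>
     (\<forall>b\<in>I. compact (K b) \<and> measure m (K b) < e \<and> finite (T b) \<and>
        (\<forall>C\<in>T b. compact C \<and> (\<forall>x\<in>C. \<forall>y\<in>C. dist x y \<le> e))) \<and>
     (\<forall>b\<in>I. \<forall>c\<in>I. b \<noteq> c \<longrightarrow> \<Union>(T b) \<inter> \<Union>(T c) = {}) \<and>
     measure m (\<Union>b\<in>I. K b) > 1 - e \<and> open W \<and> measure m W < e"

text \<open>The data are separated from the conditions on f. For fixed data these are finitely many
  conditions that a compact set be mapped into an open one, so the trapping maps form a union of
  open sets.\<close>

definition trapping ::
  "'m::metric_space measure \<Rightarrow> real \<Rightarrow> ('m \<Rightarrow> 'm) \<Rightarrow> bool"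
where
  "trapping m e f \<longleftrightarrow> (\<exists>I K T W. trap_data m e I K T W \<and>
     (\<forall>b\<in>I. (\<exists>C\<in>T b. f ` K b \<subseteq> W \<inter> interior C) \<and> (\<forall>C\<in>T b. \<exists>C'\<in>T b. f ` C \<subseteq> interior C')))"

text \<open>The image of a compact set inside V has a uniform neighbourhood in V, whose radius
  bounds the admissible perturbations.\<close>

lemma open_image_subset:
  fixes K :: "'m::metric_space set"
  assumes "compact K" "open V"
  shows "open {f :: 'm \<Rightarrow>\<^sub>C 'm. apply_bcontfun f ` K \<subseteq> V}"
  unfolding open_contains_ball
proof (rule ballI)
  fix f :: "'m \<Rightarrow>\<^sub>C 'm" assume "f \<in> {f. apply_bcontfun f ` K \<subseteq> V}"
  then have sub: "apply_bcontfun f ` K \<subseteq> V" by simp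
  have "compact (apply_bcontfun f ` K)"
    by (intro compact_continuous_image assms continuous_on_subset[OF continuous_on_apply_bcontfun]) auto
  then obtain e where e: "e > 0" "\<And>x. x \<in> apply_bcontfun f ` K \<Longrightarrow> ball x e \<subseteq> V"
    using Heine_Borel_lemma[of "apply_bcontfun f ` K" "{V}"] sub assms(2) by auto
  have "g \<in> {f. apply_bcontfun f ` K \<subseteq> V}" if "g \<in> ball f e" for g
  proof -
    have "apply_bcontfun g x \<in> V" if "x \<in> K" for x
    proof -
      have "dist (apply_bcontfun f x) (apply_bcontfun g x) < e"
        using \<open>g \<in> ball f e\<close> dist_bounded[of f x g] by simp
      then show ?thesis using e(2)[of "apply_bcontfun f x"] that by auto
    qed
    then show ?thesis by auto
  qed
  then show "\<exists>e>0. ball f e \<subseteq> {f. apply_bcontfun f ` K \<subseteq> V}"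
    using e(1) by blast
qed

lemma open_trapping: "open {f :: 'm::metric_space \<Rightarrow>\<^sub>C 'm. trapping m e (apply_bcontfun f)}"
proof -
  have "open {f :: 'm \<Rightarrow>\<^sub>C 'm. \<forall>b\<in>I. (\<exists>C\<in>T b. apply_bcontfun f ` K b \<subseteq> W \<inter> interior C) \<and>
      (\<forall>C\<in>T b. \<exists>C'\<in>T b. apply_bcontfun f ` C \<subseteq> interior C')}" if D: "trap_data m e I K T W" for I K T W
  proof -
    let ?A = "\<lambda>K C. {f :: 'm \<Rightarrow>\<^sub>C 'm. apply_bcontfun f ` K \<subseteq> C}"
    have "open (\<Inter>b\<in>I. (\<Union>C\<in>T b. ?A (K b) (W \<inter> interior C)) \<inter> (\<Inter>C\<in>T b. \<Union>C'\<in>T b. ?A C (interior C')))"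
      using D unfolding trap_data_def
      by (intro open_INT ballI open_Int open_UN open_image_subset) auto
    also have "(\<Inter>b\<in>I. (\<Union>C\<in>T b. ?A (K b) (W \<inter> interior C)) \<inter> (\<Inter>C\<in>T b. \<Union>C'\<in>T b. ?A C (interior C')))
      = {f :: 'm \<Rightarrow>\<^sub>C 'm. \<forall>b\<in>I. (\<exists>C\<in>T b. apply_bcontfun f ` K b \<subseteq> W \<inter> interior C) \<and>
      (\<forall>C\<in>T b. \<exists>C'\<in>T b. apply_bcontfun f ` C \<subseteq> interior C')}"
      by (rule set_eqI) (simp only: INT_iff UN_iff Int_iff mem_Collect_eq)
    finally show ?thesis .
  qed
  then show ?thesis
    unfolding trapping_def by (intro open_Collect_ex) (rename_tac I K T W, case_tac "trap_data m e I K T W", auto)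
qed

section \<open>Maps trapping at all scales are weird\<close>

context
  fixes m :: "'m::metric_space measure"
  assumes comp: "compact (UNIV :: 'm set)" and prob: "prob_space m" and sets_m: "sets m = sets borel"
begin

interpretation prob_space m by (rule prob)

lemma space_m: "space m = UNIV"
  using sets_eq_imp_space_eq[OF sets_m] by simp

lemma compact_in_sets: "compact S \<Longrightarrow> S \<in> sets m"
  unfolding sets_m by (intro borel_closed compact_imp_closed)

text \<open>By Borel-Cantelli both the limsup of the \<open>V n\<close> and that of the complements
  of the \<open>Q n\<close> are null. A point mapped outside the first limsup leaves
  \<open>Q n\<close> for all large n, so it lies in the second one; the complement of the first is
  therefore the set required.\<close>

lemma totally_singularI:
  fixes f :: "'m \<Rightarrow> 'm"
  assumes f: "continuous_on UNIV f"
    and Q: "\<And>n::nat. \<exists>Q V. compact Q \<and> open V \<and> f ` Q \<subseteq> V \<and> measure m V < (1/2)^n \<and> measure m Q > 1 - (1/2)^n"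
  shows "totally_singular m f"
proof -
  obtain Q V where QV: "\<And>n. compact (Q n)" "\<And>n. open (V n)" "\<And>n. f ` Q n \<subseteq> V n"
    "\<And>n. measure m (V n) < (1/2)^n" "\<And>n. measure m (Q n) > 1 - (1/2)^n"
    using Q by metis
  have [measurable]: "V n \<in> sets m" "Q n \<in> sets m" for n
    unfolding sets_m using QV(1,2)[of n] borel_open borel_closed compact_imp_closed by blast+
  have f_meas [measurable]: "f \<in> borel_measurable m"
    using borel_measurable_continuous_onI[OF f] measurable_cong_sets[OF sets_m refl] by blast
  define \<Lambda> where "\<Lambda> = - limsup V"
  have sum: "summable (\<lambda>n. (1/2)^n :: real)" by (rule summable_geometric) simp
  have V0: "limsup V \<in> null_sets m"
  proof (rule borel_cantelli_limsup1)
    show "summable (\<lambda>n. measure m (V n))"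
      by (rule summable_comparison_test'[OF sum]) (use QV(4) in \<open>auto intro: less_imp_le\<close>)
  qed (auto simp: less_top[symmetric])
  have Qc [measurable]: "- Q n \<in> sets m" for n
    using sets.compl_sets[of "Q n" m] by (simp add: space_m Compl_eq_Diff_UNIV)
  have Q0: "limsup (\<lambda>n. - Q n) \<in> null_sets m"
  proof (rule borel_cantelli_limsup1)
    have "measure m (- Q n) \<le> (1/2)^n" for n
      using prob_compl[of "Q n"] QV(5)[of n] by (simp add: space_m Compl_eq_Diff_UNIV)
    then show "summable (\<lambda>n. measure m (- Q n))"
      by (intro summable_comparison_test'[OF sum]) auto
  qed (auto simp: less_top[symmetric])
  have "limsup V \<in> sets m" using V0 by blast
  then have \<Lambda>: "\<Lambda> \<in> sets m"
    unfolding \<Lambda>_def Compl_eq_Diff_UNIV space_m[symmetric] by (rule sets.compl_sets)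
  have "measure m \<Lambda> = 1"
    using prob_compl[OF \<open>limsup V \<in> sets m\<close>] measure_eq_0_null_sets[OF V0]
    unfolding \<Lambda>_def space_m Compl_eq_Diff_UNIV by simp
  then have "emeasure m \<Lambda> = 1"
    by (simp add: emeasure_eq_measure)
  moreover have "f -` \<Lambda> \<subseteq> limsup (\<lambda>n. - Q n)"
  proof
    fix x assume "x \<in> f -` \<Lambda>"
    then obtain N where "\<forall>n\<ge>N. f x \<notin> V n" by (auto simp: \<Lambda>_def limsup_INF_SUP)
    then have "\<forall>n\<ge>N. x \<notin> Q n" using QV(3) by blast
    then have "\<exists>m\<ge>n. x \<notin> Q m" for n by (intro exI[of _ "max n N"]) auto
    then show "x \<in> limsup (\<lambda>n. - Q n)" by (auto simp: limsup_INF_SUP)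
  qed
  then have "emeasure m (f -` \<Lambda>) = 0"
    using null_sets_subset[OF Q0] measurable_sets[OF f_meas, of \<Lambda>] \<Lambda>
    by (simp add: sets_m space_m null_setsD1)
  ultimately show ?thesis unfolding totally_singular_def using \<Lambda> sets_m by blast
qed

text \<open>A choice of one successor for every member turns the family into a finite dynamical
  system that shadows the orbit. The shift by one reflects that x itself may lie outside the
  family.\<close>

lemma trapping_orbit:
  assumes "\<forall>C\<in>T. \<exists>C'\<in>T. f ` C \<subseteq> interior C'" "C \<in> T" "f x \<in> interior C"
  obtains \<tau> where "\<tau> ` T \<subseteq> T" "\<And>j. (f ^^ Suc j) x \<in> (\<tau> ^^ j) C"
proof -
  obtain \<tau> where \<tau>: "\<And>C. C \<in> T \<Longrightarrow> \<tau> C \<in> T \<and> f ` C \<subseteq> interior (\<tau> C)"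
    using assms(1) by metis
  have "(f ^^ Suc j) x \<in> (\<tau> ^^ j) C \<and> (\<tau> ^^ j) C \<in> T" for j
  proof (induction j)
    case 0
    then show ?case using assms interior_subset by auto
  next
    case (Suc j)
    then show ?case using \<tau>[of "(\<tau> ^^ j) C"] interior_subset by fastforce
  qed
  then show thesis using \<tau> that by blast
qed

lemma weird_if_trapping:
  fixes f :: "'m \<Rightarrow> 'm"
  assumes f: "continuous_on UNIV f" and tr: "\<And>n::nat. trapping m ((1/2)^n) f"
  shows "weird m f"
proof -
  obtain I K T W where D: "\<And>n::nat. trap_data m ((1/2)^n) (I n) (K n) (T n) (W n)"
    and KW: "\<And>n b. b \<in> I n \<Longrightarrow> \<exists>C\<in>T n b. f ` K n b \<subseteq> W n \<inter> interior C"
    and TT: "\<And>n b. b \<in> I n \<Longrightarrow> \<forall>C\<in>T n b. \<exists>C'\<in>T n b. f ` C \<subseteq> interior C'"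
    using tr unfolding trapping_def by metis
  define Q where "Q n = (\<Union>b\<in>I n. K n b)" for n
  have Q: "compact (Q n)" "measure m (Q n) > 1 - (1/2)^n" for n
    using D[of n] unfolding trap_data_def Q_def by auto
  have f_Q: "f ` Q n \<subseteq> W n" for n
    using KW unfolding Q_def by fast
  have orbit: "\<exists>\<tau> C. C \<in> T n b \<and> \<tau> ` T n b \<subseteq> T n b \<and> (\<forall>j. (f ^^ Suc j) x \<in> (\<tau> ^^ j) C)"
    if b: "b \<in> I n" and x: "x \<in> K n b" for n b x
  proof -
    obtain C where C: "C \<in> T n b" "f x \<in> interior C" using KW[OF b] x by blast
    then show ?thesis using trapping_orbit[OF TT[OF b]] by metis
  qed
  have in_T: "(f ^^ j) x \<in> \<Union>(T n b)" if b: "b \<in> I n" and x: "x \<in> K n b" and j: "j \<ge> 1" for n b x j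
  proof -
    obtain \<tau> C where \<tau>: "C \<in> T n b" "\<tau> ` T n b \<subseteq> T n b" "\<forall>j. (f ^^ Suc j) x \<in> (\<tau> ^^ j) C"
      using orbit[OF b x] by blast
    have "(\<tau> ^^ i) C \<in> T n b" for i by (induction i) (use \<tau> in auto)
    then have "(f ^^ Suc i) x \<in> \<Union>(T n b)" for i using \<tau>(3) by (intro UnionI) auto
    moreover obtain i where "j = Suc i" using j by (cases j) auto
    ultimately show ?thesis by blast
  qed
  have "totally_singular m f"
  proof (rule totally_singularI[OF f])
    fix n
    have "open (W n)" "measure m (W n) < (1/2)^n" using D[of n] unfolding trap_data_def by blast+
    then show "\<exists>Q V. compact Q \<and> open V \<and> f ` Q \<subseteq> V \<and> measure m V < (1/2)^n \<and> measure m Q > 1 - (1/2)^n"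
      using Q[of n] f_Q[of n] by (intro exI[of _ "Q n"] exI[of _ "W n"] conjI)
  qed
  moreover have "AE x in m. \<exists>\<mu>. has_birkhoff_limit f x \<mu>"
  proof -
    have Q_sets: "Q n \<in> sets m" for n by (rule compact_in_sets[OF Q(1)])
    have Qc: "- Q n \<in> sets m" for n
      using sets.compl_sets[OF Q_sets] by (simp add: space_m Compl_eq_Diff_UNIV)
    \<comment> \<open>Almost every point lies in \<open>Q n\<close> for all large n, so arbitrarily
      small scales are available along its orbit.\<close>
    have "AE x in m. eventually (\<lambda>n. x \<in> space m - - Q n) sequentially"
    proof (rule borel_cantelli_AE1[OF Qc])
      have "measure m (- Q n) \<le> (1/2)^n" for n
        using prob_compl[OF Q_sets[of n]] Q(2)[of n] by (simp add: space_m Compl_eq_Diff_UNIV)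
      then show "summable (\<lambda>n. measure m (- Q n))"
        by (intro summable_comparison_test'[OF summable_geometric[of "1/2"]]) auto
    qed (auto simp: less_top[symmetric])
    then show ?thesis
    proof (rule AE_mp, intro AE_I2 impI)
      fix x assume "eventually (\<lambda>n. x \<in> space m - - Q n) sequentially"
      then obtain n0 where n0: "\<And>n. n \<ge> n0 \<Longrightarrow> x \<in> Q n" by (auto simp: eventually_sequentially)
      have "\<exists>p\<ge>1. \<exists>N. \<forall>i\<ge>N. \<forall>j\<ge>N. i mod p = j mod p \<longrightarrow> dist ((f ^^ i) x) ((f ^^ j) x) \<le> e" if "e > 0" for e
      proof -
        obtain n1 where n1: "(1/2)^n1 < e" using real_arch_pow_inv[of e "1/2"] \<open>e > 0\<close> by auto
        define n where "n = max n0 n1"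
        have "(1/2::real)^n \<le> (1/2)^n1" unfolding n_def by (intro power_decreasing) auto
        then have n: "(1/2)^n < e" using n1 by linarith
        have "x \<in> Q n" using n0 by (simp add: n_def)
        then obtain b where b: "b \<in> I n" "x \<in> K n b" by (auto simp: Q_def)
        then obtain \<tau> C where \<tau>: "C \<in> T n b" "\<tau> ` T n b \<subseteq> T n b" "\<forall>j. (f ^^ Suc j) x \<in> (\<tau> ^^ j) C"
          using orbit by blast
        have fin: "finite (T n b)" using D[of n] b(1) by (auto simp: trap_data_def)
        obtain p N where p: "p \<ge> 1" and N: "\<forall>i\<ge>N. \<forall>j\<ge>N. i mod p = j mod p \<longrightarrow> (\<tau> ^^ i) C = (\<tau> ^^ j) C"
          using orbit_step_eventually_periodic[OF fin \<tau>(2,1)] by blast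
        have in_T': "(\<tau> ^^ i) C \<in> T n b" for i by (induction i) (use \<tau> in auto)
        have "dist ((f ^^ i) x) ((f ^^ j) x) \<le> e" if ij: "i \<ge> Suc N" "j \<ge> Suc N" "i mod p = j mod p" for i j
        proof -
          obtain i' j' where eq: "i = Suc i'" "j = Suc j'" "i' \<ge> N" "j' \<ge> N"
            using ij(1,2) by (metis Suc_le_D Suc_le_mono)
          have "i' mod p = j' mod p"
            using ij(3) unfolding eq(1,2)
            by (metis diff_Suc_Suc mod_eq_dvd_iff_nat nle_le Suc_le_mono)
          then have "(\<tau> ^^ i') C = (\<tau> ^^ j') C" using N eq by blast
          then have "(f ^^ i) x \<in> (\<tau> ^^ i') C" "(f ^^ j) x \<in> (\<tau> ^^ i') C"
            using \<tau>(3) eq by auto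
          then have "dist ((f ^^ i) x) ((f ^^ j) x) \<le> (1/2)^n"
            using D[of n] b(1) in_T'[of i'] unfolding trap_data_def by blast
          then show ?thesis using n by linarith
        qed
        then show ?thesis using p by (intro exI[of _ p] conjI exI[of _ "Suc N"]) auto
      qed
      then show "\<exists>\<mu>. has_birkhoff_limit f x \<mu>"
        using asymptotically_periodic_imp_limit_measure[OF comp, of "\<lambda>j. (f ^^ j) x"]
        unfolding has_birkhoff_limit_iff by blast
    qed
  qed
  moreover have "\<not> physical_measure m f \<mu>" for \<mu>
  proof
    assume "physical_measure m f \<mu>"
    then have pos: "emeasure m (basin f \<mu>) > 0" by (simp add: physical_measure_def)
    \<comment> \<open>\<open>emeasure\<close> vanishes on nonmeasurable sets, so a basin of positive
      measure is measurable.\<close>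
    then have meas: "basin f \<mu> \<in> sets m" using emeasure_notin_sets by fastforce
    have same: "b = c" if bc: "b \<in> I n" "c \<in> I n" "x \<in> K n b" "y \<in> K n c" and xy: "x \<in> basin f \<mu>" "y \<in> basin f \<mu>"
      for n b c x y
    proof (rule ccontr)
      assume "b \<noteq> c"
      let ?B = "\<Union>(T n b)" and ?C = "\<Union>(T n c)"
      have cpt: "compact ?B" "compact ?C" using D[of n] bc unfolding trap_data_def by auto
      have disj: "?B \<inter> ?C = {}" using D[of n] bc \<open>b \<noteq> c\<close> unfolding trap_data_def by blast
      have ne: "?B \<noteq> {}" "?C \<noteq> {}" using in_T[OF bc(1,3), of 1] in_T[OF bc(2,4), of 1] by auto
      define g where "g z = infdist z ?B" for z
      have g: "continuous_on UNIV g" unfolding g_def by (intro continuous_intros)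
      obtain z where z: "z \<in> ?C" "\<And>w. w \<in> ?C \<Longrightarrow> g z \<le> g w"
        using continuous_attains_inf[OF cpt(2) ne(2) continuous_on_subset[OF g]] by auto
      have "z \<notin> ?B" using z disj by blast
      then have "g z > 0"
        unfolding g_def using infdist_pos_not_in_closed[OF compact_imp_closed[OF cpt(1)] ne(1)] by blast
      have lim: "(\<lambda>n. (\<Sum>j=1..n. g ((f ^^ j) w)) / n) \<longlonglongrightarrow> (\<integral>y. g y \<partial>\<mu>)" if "w \<in> basin f \<mu>" for w
        using that g unfolding basin_def has_birkhoff_limit_iff by blast
      have "(\<Sum>j=1..k. g ((f ^^ j) x)) = 0" for k
        using in_T[OF bc(1,3)] by (intro sum.neutral) (simp add: g_def)
      then have "(\<lambda>_. 0) \<longlonglongrightarrow> (\<integral>y. g y \<partial>\<mu>)" using lim[OF xy(1)] by simp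
      then have int0: "(\<integral>y. g y \<partial>\<mu>) = 0" by (simp add: LIMSEQ_const_iff)
      have "g z \<le> (\<integral>y. g y \<partial>\<mu>)"
      proof (rule LIMSEQ_le_const[OF lim[OF xy(2)]], intro exI allI impI)
        fix k :: nat assume "k \<ge> 1"
        have "real k * g z = (\<Sum>j=1..k. g z)" by simp
        also have "\<dots> \<le> (\<Sum>j=1..k. g ((f ^^ j) y))"
          using in_T[OF bc(2,4)] by (intro sum_mono z) auto
        finally show "g z \<le> (\<Sum>j=1..k. g ((f ^^ j) y)) / k"
          using \<open>k \<ge> 1\<close> by (simp add: field_simps)
      qed
      then show False using int0 \<open>g z > 0\<close> by simp
    qed
    \<comment> \<open>By \<open>same\<close> the basin meets \<open>K n b\<close> for at most one b,
      and the rest of it lies outside \<open>Q n\<close>; each of the two parts has measure at most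
      (1/2)^n.\<close>
    have "measure m (basin f \<mu>) \<le> 2 * (1/2)^n" for n
    proof -
      have Q_sets: "Q n \<in> sets m" by (rule compact_in_sets[OF Q(1)])
      have K_sets: "K n b \<in> sets m" if "b \<in> I n" for b
        by (rule compact_in_sets) (use D[of n] that in \<open>simp add: trap_data_def\<close>)
      have Qc: "measure m (- Q n) \<le> (1/2)^n"
        using prob_compl[OF Q_sets] Q(2)[of n] by (simp add: space_m Compl_eq_Diff_UNIV)
      have Qc_sets: "- Q n \<in> sets m"
        using sets.compl_sets[OF Q_sets] by (simp add: space_m Compl_eq_Diff_UNIV)
      show ?thesis
      proof (cases "basin f \<mu> \<inter> Q n = {}")
        case True
        then have "measure m (basin f \<mu>) \<le> measure m (- Q n)"
          by (intro finite_measure_mono Qc_sets) auto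
        also have "\<dots> \<le> 2 * (1/2)^n" using Qc by (rule order_trans) simp
        finally show ?thesis .
      next
        case False
        then obtain x b where xb: "b \<in> I n" "x \<in> K n b" "x \<in> basin f \<mu>" by (auto simp: Q_def)
        have "basin f \<mu> \<subseteq> - Q n \<union> K n b"
          using same[OF xb(1) _ xb(2) _ xb(3)] by (auto simp: Q_def)
        then have "measure m (basin f \<mu>) \<le> measure m (- Q n \<union> K n b)"
          using Qc_sets K_sets[OF xb(1)] by (intro finite_measure_mono) auto
        also have "\<dots> \<le> measure m (- Q n) + measure m (K n b)"
          by (rule measure_Un_le[OF Qc_sets K_sets[OF xb(1)]])
        also have "measure m (K n b) \<le> (1/2)^n" using D[of n] xb(1) by (auto simp: trap_data_def intro: less_imp_le)
        finally show ?thesis using Qc by simp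
      qed
    qed
    moreover have "(\<lambda>n. 2 * (1/2::real)^n) \<longlonglongrightarrow> 2 * 0"
      by (intro tendsto_mult tendsto_const LIMSEQ_realpow_zero) auto
    ultimately have "measure m (basin f \<mu>) \<le> 0"
      by (intro LIMSEQ_le_const[where X = "\<lambda>n. 2 * (1/2::real)^n"]) auto
    then show False using pos by (simp add: emeasure_eq_measure measure_le_0_iff)
  qed
  ultimately show ?thesis unfolding weird_def by blast
qed

end

section \<open>Chart balls\<close>

text \<open>Balls are carried as descriptors of chart, center and radius instead of as sets, because
  later constructions work in the coordinates. Center and radius refer to the model space, not to
  the distance on the manifold.\<close>

definition chart_cball :: "('m set \<times> ('m \<Rightarrow> 'e::euclidean_space)) \<times> 'e \<times> real \<Rightarrow> 'm set" where
  "chart_cball = (\<lambda>((U, \<phi>), a, r). {x \<in> U. \<phi> x \<in> cball a r})"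

definition chart_ball :: "('m set \<times> ('m \<Rightarrow> 'e::euclidean_space)) \<times> 'e \<times> real \<Rightarrow> 'm set" where
  "chart_ball = (\<lambda>((U, \<phi>), a, r). {x \<in> U. \<phi> x \<in> ball a r})"

definition chart_center :: "('m set \<times> ('m \<Rightarrow> 'e::euclidean_space)) \<times> 'e \<times> real \<Rightarrow> 'm" where
  "chart_center = (\<lambda>((U, \<phi>), a, r). inv_into U \<phi> a)"

text \<open>Continuity of the inverse is left out so that compositions and gluings stay simple; on a
  compact space it is automatic, see \<open>homeo_imp_homeomorphism\<close>.\<close>

definition homeo :: "('m::topological_space \<Rightarrow> 'm) \<Rightarrow> bool" where
  "homeo h \<longleftrightarrow> continuous_on UNIV h \<and> bij h"

lemma homeo_id: "homeo (\<lambda>x. x)"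
  by (simp add: homeo_def bij_def inj_def)

lemma homeo_comp: "homeo f \<Longrightarrow> homeo g \<Longrightarrow> homeo (\<lambda>x. f (g x))"
  unfolding homeo_def
  using bij_comp[of g f] continuous_on_compose2[of UNIV f UNIV g] by (auto simp: o_def)

lemma homeo_inj: "homeo h \<Longrightarrow> h x = h y \<longleftrightarrow> x = y"
  unfolding homeo_def bij_def inj_def by blast

text \<open>If \<open>h x\<close> were outside B, it would be fixed, and injectivity would give
  \<open>h x = x\<close>, which lies in B.\<close>

lemma homeo_maps_support:
  assumes "homeo h" "\<And>x. x \<notin> B \<Longrightarrow> h x = x" "x \<in> B"
  shows "h x \<in> B"
  using assms homeo_inj by metis

lemma homeo_imp_homeomorphism:
  fixes h :: "'m::metric_space \<Rightarrow> 'm"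
  assumes "compact (UNIV :: 'm set)" "homeo h"
  shows "\<exists>g. homeomorphism UNIV UNIV h g"
  using homeomorphism_compact[OF assms(1), of h UNIV] assms(2) by (auto simp: homeo_def bij_def)

text \<open>Homeomorphisms supported in pairwise disjoint sets can be performed simultaneously.\<close>

lemma homeo_combine:
  assumes "finite I" "\<And>i j. i \<in> I \<Longrightarrow> j \<in> I \<Longrightarrow> i \<noteq> j \<Longrightarrow> B i \<inter> B j = {}"
    and "\<And>i. i \<in> I \<Longrightarrow> homeo (h i)" "\<And>i x. i \<in> I \<Longrightarrow> x \<notin> B i \<Longrightarrow> h i x = x"
  shows "\<exists>k. homeo k \<and> (\<forall>i\<in>I. \<forall>x\<in>B i. k x = h i x) \<and> (\<forall>x. x \<notin> (\<Union>i\<in>I. B i) \<longrightarrow> k x = x)"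
  using assms
proof (induction I rule: finite_induct)
  case empty
  then show ?case using homeo_id by auto
next
  case (insert i I)
  then obtain k where k: "homeo k" "\<forall>j\<in>I. \<forall>x\<in>B j. k x = h j x" "\<forall>x. x \<notin> (\<Union>j\<in>I. B j) \<longrightarrow> k x = x"
    by auto
  have hi: "homeo (h i)" "\<And>x. x \<notin> B i \<Longrightarrow> h i x = x" using insert.prems by auto
  have disj: "x \<notin> B j" if "x \<in> B i" "j \<in> I" for x j
    using insert.prems(1)[of i j] insert.hyps that by blast
  show ?case
  proof (intro exI[of _ "\<lambda>x. k (h i x)"] conjI ballI allI impI)
    show "homeo (\<lambda>x. k (h i x))" using k(1) hi(1) by (rule homeo_comp)
    fix j x assume j: "j \<in> insert i I" and x: "x \<in> B j"
    show "k (h i x) = h j x"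
    proof (cases "j = i")
      case True
      then have "h i x \<in> B i" using homeo_maps_support hi x by blast
      then show ?thesis using k(3) disj True by blast
    next
      case False
      then show ?thesis using hi(2) disj j x k(2) by (metis insertE)
    qed
  qed (use k(3) hi(2) in auto)
qed

lemma chart_homeomorphism:
  assumes "chart (U, \<phi>)"
  shows "homeomorphism U (\<phi> ` U) \<phi> (inv_into U \<phi>)"
proof -
  obtain \<psi> where \<psi>: "homeomorphism U (\<phi> ` U) \<phi> \<psi>" using assms by (auto simp: chart_def)
  have "inv_into U \<phi> y = \<psi> y" if "y \<in> \<phi> ` U" for y
  proof -
    have "inj_on \<phi> U" by (rule inj_on_inverseI[where g = \<psi>]) (rule homeomorphism_apply1[OF \<psi>])
    then show ?thesis using \<psi> that by (auto simp: homeomorphism_def)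
  qed
  then show ?thesis using \<psi> by (rule_tac homeomorphism_cong[OF \<psi>]) auto
qed

locale charted =
  fixes \<A> :: "('m::metric_space set \<times> ('m \<Rightarrow> 'e::euclidean_space)) set"
  assumes comp: "compact (UNIV :: 'm set)"
    and charts: "\<And>c. c \<in> \<A> \<Longrightarrow> chart c"
    and cover: "\<And>x. \<exists>(U, \<phi>)\<in>\<A>. x \<in> U"
begin

text \<open>Requiring the closed ball to lie in the image of the chart makes
  \<open>chart_cball\<close> compact and allows maps that fix its bounding sphere to be extended by
  the identity.\<close>

definition valid :: "('m set \<times> ('m \<Rightarrow> 'e)) \<times> 'e \<times> real \<Rightarrow> bool" where
  "valid = (\<lambda>((U, \<phi>), a, r). (U, \<phi>) \<in> \<A> \<and> 0 < r \<and> cball a r \<subseteq> \<phi> ` U)"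

context
  fixes U :: "'m set" and \<phi> :: "'m \<Rightarrow> 'e"
  assumes UA: "(U, \<phi>) \<in> \<A>"
begin

lemma open_chart: "open U" "open (\<phi> ` U)"
  using charts[OF UA] by (auto simp: chart_def)

lemma cont_chart: "continuous_on U \<phi>" "continuous_on (\<phi> ` U) (inv_into U \<phi>)"
  using chart_homeomorphism[OF charts[OF UA]] by (auto simp: homeomorphism_def)

lemma inj_chart: "inj_on \<phi> U"
  by (rule inj_on_inverseI[where g = "inv_into U \<phi>"])
    (rule homeomorphism_apply1[OF chart_homeomorphism[OF charts[OF UA]]])

lemma open_chart_preimage: "open S \<Longrightarrow> open {x \<in> U. \<phi> x \<in> S}"
  using continuous_open_preimage[OF cont_chart(1) open_chart(1)] by (simp add: vimage_def Int_def)

lemma chart_preimage_eq: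
  assumes "S \<subseteq> \<phi> ` U"
  shows "{x \<in> U. \<phi> x \<in> S} = inv_into U \<phi> ` S"
proof (intro set_eqI iffI)
  fix x assume "x \<in> {x \<in> U. \<phi> x \<in> S}"
  then show "x \<in> inv_into U \<phi> ` S"
    using inv_into_f_f[OF inj_chart, of x] by (metis (mono_tags) imageI mem_Collect_eq)
next
  fix x assume "x \<in> inv_into U \<phi> ` S"
  then show "x \<in> {x \<in> U. \<phi> x \<in> S}"
    using assms by (auto simp: inv_into_into f_inv_into_f subset_iff)
qed

lemma compact_chart_preimage:
  assumes "compact S" "S \<subseteq> \<phi> ` U"
  shows "compact {x \<in> U. \<phi> x \<in> S}"
  unfolding chart_preimage_eq[OF assms(2)]
  by (rule compact_continuous_image[OF continuous_on_subset[OF cont_chart(2) assms(2)] assms(1)])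

lemma small_chart_cball:
  assumes "x \<in> U" "open V" "x \<in> V"
  shows "\<exists>r>0. cball (\<phi> x) r \<subseteq> \<phi> ` U \<and> {y \<in> U. \<phi> y \<in> cball (\<phi> x) r} \<subseteq> V"
proof -
  have "open (\<phi> ` U \<inter> inv_into U \<phi> -` V)"
    using continuous_open_preimage[OF cont_chart(2) open_chart(2) assms(2)] .
  moreover have "\<phi> x \<in> \<phi> ` U \<inter> inv_into U \<phi> -` V"
    using assms inj_chart by simp
  ultimately obtain r where r: "r > 0" "cball (\<phi> x) r \<subseteq> \<phi> ` U \<inter> inv_into U \<phi> -` V"
    using open_contains_cball by metis
  have "y \<in> V" if "y \<in> U" "\<phi> y \<in> cball (\<phi> x) r" for y
  proof -
    have "inv_into U \<phi> (\<phi> y) \<in> V" using r(2) that(2) by auto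
    then show ?thesis using inv_into_f_f[OF inj_chart that(1)] by simp
  qed
  then show ?thesis using r by (intro exI[of _ r]) auto
qed

end

lemma small_valid:
  assumes "open V" "x \<in> V"
  obtains d where "valid d" "chart_center d = x" "chart_cball d \<subseteq> V"
proof -
  obtain U \<phi> where U: "(U, \<phi>) \<in> \<A>" "x \<in> U" using cover[of x] by auto
  obtain r where r: "r > 0" "cball (\<phi> x) r \<subseteq> \<phi> ` U" "{y \<in> U. \<phi> y \<in> cball (\<phi> x) r} \<subseteq> V"
    using small_chart_cball[OF U assms] by blast
  show thesis
    by (rule that[of "((U, \<phi>), \<phi> x, r)"])
      (use U r inj_chart[OF U(1)] in \<open>auto simp: valid_def chart_center_def chart_cball_def\<close>)
qed

lemma valid_facts:
  assumes "valid d"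
  shows "open (chart_ball d)" "compact (chart_cball d)" "chart_ball d \<subseteq> chart_cball d"
    "chart_center d \<in> chart_ball d"
proof -
  obtain U \<phi> a r where d: "d = ((U, \<phi>), a, r)" by (metis prod.exhaust)
  have v: "(U, \<phi>) \<in> \<A>" "0 < r" "cball a r \<subseteq> \<phi> ` U" using assms by (auto simp: d valid_def)
  show "open (chart_ball d)" "compact (chart_cball d)" "chart_ball d \<subseteq> chart_cball d"
    unfolding d chart_ball_def chart_cball_def
    using open_chart_preimage[OF v(1) open_ball] compact_chart_preimage[OF v(1) compact_cball v(3)]
    by auto
  have "a \<in> \<phi> ` U" using v by auto
  then show "chart_center d \<in> chart_ball d"
    using v(2) by (auto simp: d chart_ball_def chart_center_def f_inv_into_f inv_into_into)
qed

text \<open>Every nonempty open set contains a coordinate ball, and the model space has positive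
  dimension. This is the source of generic points that avoid countably many orbit points.\<close>

lemma uncountable_open:
  fixes V :: "'m set"
  assumes "open V" "V \<noteq> {}"
  shows "uncountable V"
proof
  assume V: "countable V"
  obtain x where "x \<in> V" using assms by auto
  then obtain d where d: "valid d" "chart_cball d \<subseteq> V" using small_valid assms(1) by metis
  obtain U \<phi> a r where d': "d = ((U, \<phi>), a, r)" by (metis prod.exhaust)
  have v: "(U, \<phi>) \<in> \<A>" "0 < r" "cball a r \<subseteq> \<phi> ` U" using d(1) by (auto simp: d' valid_def)
  have "cball a r \<subseteq> \<phi> ` V"
    using v(3) d(2) by (force simp: d' chart_cball_def)
  then have "countable (cball a r)" by (rule countable_subset[OF _ countable_image[OF V]])
  then show False using uncountable_cball[OF v(2)] by blast
qed

lemma generic_point: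
  fixes V :: "'m set"
  assumes "open V" "V \<noteq> {}" "countable X"
  obtains x where "x \<in> V" "x \<notin> X"
proof -
  have "\<not> V \<subseteq> X" using uncountable_open[OF assms(1,2)] countable_subset[OF _ assms(3)] by blast
  then show thesis using that by blast
qed

text \<open>Translates distances on the manifold into coordinates: points closer than l share a
  chart ball of diameter at most e, so a modification inside this ball displaces nothing by e or
  more.\<close>

lemma lebesgue_number:
  assumes "e > 0"
  obtains l where "l > 0"
    "\<And>x. \<exists>d. valid d \<and> ball x l \<subseteq> chart_ball d \<and> (\<forall>y\<in>chart_cball d. \<forall>z\<in>chart_cball d. dist y z < e)"
proof -
  let ?G = "{chart_ball d | d. valid d \<and> (\<forall>y\<in>chart_cball d. \<forall>z\<in>chart_cball d. dist y z < e)}"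
  have "x \<in> \<Union>?G" for x
  proof -
    obtain d where d: "valid d" "chart_center d = x" "chart_cball d \<subseteq> ball x (e/2)"
      using small_valid[of "ball x (e/2)" x] assms by (metis centre_in_ball half_gt_zero open_ball)
    have "dist y z < e" if "y \<in> chart_cball d" "z \<in> chart_cball d" for y z
    proof -
      have "dist x y < e/2" "dist x z < e/2" using d(3) that unfolding subset_iff mem_ball by blast+
      then show ?thesis using dist_triangle3[of y z x] by linarith
    qed
    then show ?thesis using d valid_facts(4)[OF d(1)] by blast
  qed
  then have sub: "UNIV \<subseteq> \<Union>?G" by (intro subsetI)
  have op: "open G" if "G \<in> ?G" for G
    using that by (elim CollectE exE conjE) (simp add: valid_facts(1))
  show thesis
  proof (rule Heine_Borel_lemma[OF comp sub op])
    fix l :: real assume "l > 0" and l: "\<And>x. x \<in> UNIV \<Longrightarrow> \<exists>G\<in>?G. ball x l \<subseteq> G"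
    show thesis
    proof (rule that[OF \<open>l > 0\<close>])
      fix x
      show "\<exists>d. valid d \<and> ball x l \<subseteq> chart_ball d \<and> (\<forall>y\<in>chart_cball d. \<forall>z\<in>chart_cball d. dist y z < e)"
        using l[of x] by blast
    qed
  qed
qed

text \<open>The lifted map on the closed ball and the identity on the complement of the open ball
  are defined on closed sets that overlap in the sphere, where they agree.\<close>

lemma chart_lift:
  assumes v: "valid ((U, \<phi>), a, r)"
    and H: "continuous_on (cball a r) H" "bij_betw H (cball a r) (cball a r)" "\<And>y. y \<in> sphere a r \<Longrightarrow> H y = y"
  shows "\<exists>h. homeo h \<and> (\<forall>x. x \<notin> chart_cball ((U, \<phi>), a, r) \<longrightarrow> h x = x) \<and>
           (\<forall>x\<in>chart_cball ((U, \<phi>), a, r). h x \<in> U \<and> \<phi> (h x) = H (\<phi> x))"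
proof -
  let ?B = "chart_cball ((U, \<phi>), a, r)" and ?O = "chart_ball ((U, \<phi>), a, r)"
  have UA: "(U, \<phi>) \<in> \<A>" and cb: "cball a r \<subseteq> \<phi> ` U" using v by (auto simp: valid_def)
  define \<psi> where "\<psi> = inv_into U \<phi>"
  have \<psi>: "\<psi> y \<in> U" "\<phi> (\<psi> y) = y" if "y \<in> cball a r" for y
    using cb that by (auto simp: \<psi>_def inv_into_into f_inv_into_f)
  have \<psi>': "\<psi> (\<phi> x) = x" if "x \<in> U" for x
    using inj_chart[OF UA] that by (simp add: \<psi>_def)
  have B: "x \<in> ?B \<longleftrightarrow> x \<in> U \<and> \<phi> x \<in> cball a r" for x by (auto simp: chart_cball_def)
  have HB: "H y \<in> cball a r" if "y \<in> cball a r" for y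
    using H(2) that by (auto simp: bij_betw_def)
  define h where "h x = (if x \<in> ?B then \<psi> (H (\<phi> x)) else x)" for x
  have "continuous_on (?B \<union> - ?O) (\<lambda>x. if x \<in> ?B then \<psi> (H (\<phi> x)) else x)"
  proof (rule continuous_on_cases)
    show "closed ?B" using valid_facts(2)[OF v] by (rule compact_imp_closed)
    show "closed (- ?O)" using valid_facts(1)[OF v] by (simp add: closed_Compl)
    have "continuous_on ?B \<phi>" by (rule continuous_on_subset[OF cont_chart(1)[OF UA]]) (auto simp: B)
    moreover have "continuous_on (\<phi> ` ?B) H" by (rule continuous_on_subset[OF H(1)]) (auto simp: B)
    moreover have "continuous_on (H ` \<phi> ` ?B) \<psi>"
      unfolding \<psi>_def by (rule continuous_on_subset[OF cont_chart(2)[OF UA]]) (use B HB cb in blast)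
    ultimately show "continuous_on ?B (\<lambda>x. \<psi> (H (\<phi> x)))"
      using continuous_on_compose[of ?B \<phi> H] continuous_on_compose[of ?B "H \<circ> \<phi>" \<psi>]
      by (simp add: o_def image_image)
    show "\<forall>x. x \<in> ?B \<and> x \<notin> ?B \<or> x \<in> - ?O \<and> x \<in> ?B \<longrightarrow> \<psi> (H (\<phi> x)) = x"
      using H(3) \<psi>' by (auto simp: chart_cball_def chart_ball_def)
  qed (rule continuous_on_id)
  moreover have "?B \<union> - ?O = UNIV" using valid_facts(3)[OF v] by blast
  ultimately have "continuous_on UNIV h" by (simp add: h_def[abs_def])
  moreover have "bij h"
  proof -
    have "bij_betw h ?B ?B"
    proof (rule bij_betwI')
      fix x y assume xy: "x \<in> ?B" "y \<in> ?B"
      have "h x = h y \<longleftrightarrow> H (\<phi> x) = H (\<phi> y)"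
        using xy \<psi>(2) HB B unfolding h_def by metis
      also have "\<dots> \<longleftrightarrow> \<phi> x = \<phi> y"
        using H(2) xy B by (auto simp: bij_betw_def inj_on_def)
      also have "\<dots> \<longleftrightarrow> x = y" using inj_chart[OF UA] xy B by (auto simp: inj_on_def)
      finally show "h x = h y \<longleftrightarrow> x = y" .
    next
      fix x assume "x \<in> ?B"
      then show "h x \<in> ?B" using \<psi> HB B by (simp add: h_def)
    next
      fix y assume y: "y \<in> ?B"
      then obtain z where z: "z \<in> cball a r" "H z = \<phi> y"
        using H(2) B unfolding bij_betw_def by (metis imageE)
      have "\<psi> z \<in> ?B" using \<psi>[OF z(1)] z B by simp
      moreover have "h (\<psi> z) = y"
        using calculation \<psi>(2)[OF z(1)] z(2) \<psi>' y B by (simp add: h_def)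
      ultimately show "\<exists>x\<in>?B. y = h x" by blast
    qed
    moreover have "bij_betw h (- ?B) (- ?B)"
      by (rule bij_betwI'[of "- ?B" h]) (auto simp: h_def)
    ultimately have "bij_betw h (?B \<union> - ?B) (?B \<union> - ?B)" by (rule bij_betw_combine) auto
    then show ?thesis by simp
  qed
  ultimately have "homeo h" by (simp add: homeo_def)
  moreover have "\<forall>x. x \<notin> ?B \<longrightarrow> h x = x" by (simp add: h_def)
  moreover have "\<forall>x\<in>?B. h x \<in> U \<and> \<phi> (h x) = H (\<phi> x)"
    using \<psi> HB B by (simp add: h_def)
  ultimately show ?thesis by blast
qed

end

section \<open>Vitali families of chart balls\<close>

text \<open>The measure is controlled through absolute continuity in charts, which turns null sets
  of the model space (Vitali remainders, spheres, lines) into null sets of the manifold.\<close>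

locale charted_measure = charted \<A> for \<A> :: "('m::metric_space set \<times> ('m \<Rightarrow> 'e::euclidean_space)) set" +
  fixes m :: "'m measure"
  assumes prob: "prob_space m" and sets_m: "sets m = sets borel"
    and null_chart: "\<And>U \<phi> N. (U, \<phi>) \<in> \<A> \<Longrightarrow> N \<in> null_sets lborel \<Longrightarrow> N \<subseteq> \<phi> ` U \<Longrightarrow>
      emeasure m {x \<in> U. \<phi> x \<in> N} = 0"
begin

sublocale prob_space m by (rule prob)

lemma sets_mI: "open S \<Longrightarrow> S \<in> sets m" "closed S \<Longrightarrow> S \<in> sets m" "compact S \<Longrightarrow> S \<in> sets m"
  unfolding sets_m by (auto intro: borel_closed compact_imp_closed)

lemma space_m': "space m = UNIV"
  using sets_eq_imp_space_eq[OF sets_m] by simp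

lemma null_setsI_chart:
  assumes U: "(U, \<phi>) \<in> \<A>" and N: "negligible N" "N \<in> sets borel" "N \<subseteq> \<phi> ` U"
  shows "{x \<in> U. \<phi> x \<in> N} \<in> null_sets m"
proof -
  have "N \<in> null_sets lborel"
    using N(1,2) by (simp add: negligible_iff_null_sets null_sets_completion_iff)
  moreover have "{x \<in> U. \<phi> x \<in> N} \<in> sets m"
  proof -
    have "\<phi> \<in> borel_measurable (restrict_space borel U)"
      by (rule borel_measurable_continuous_on_restrict[OF cont_chart(1)[OF U]])
    then have "\<phi> -` N \<inter> space (restrict_space borel U) \<in> sets (restrict_space borel U)"
      using N(2) by (rule measurable_sets)
    moreover have "\<phi> -` N \<inter> space (restrict_space borel U) = {x \<in> U. \<phi> x \<in> N}"
      by (auto simp: space_restrict_space)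
    moreover have "U \<in> sets borel" using open_chart(1)[OF U] by simp
    ultimately show ?thesis
      by (simp add: sets_restrict_space_iff sets_m)
  qed
  ultimately show ?thesis using null_chart[OF U _ N(3)] by (intro null_setsI)
qed

lemma measure_point: "measure m {x} = 0"
proof -
  obtain U \<phi> where U: "(U, \<phi>) \<in> \<A>" "x \<in> U" using cover[of x] by auto
  have "{y \<in> U. \<phi> y \<in> {\<phi> x}} \<in> null_sets m"
    by (rule null_setsI_chart[OF U(1)]) (use U in auto)
  moreover have "{y \<in> U. \<phi> y \<in> {\<phi> x}} = {x}"
    using inj_chart[OF U(1)] U(2) by (auto simp: inj_on_def)
  ultimately show ?thesis by (metis measure_eq_0_null_sets)
qed

lemma small_measure_ball:
  assumes "e > 0"
  shows "\<exists>r>0. measure m (ball x r) < e"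
proof -
  define A where "A n = ball x (1 / Suc n)" for n
  have dec: "decseq A"
    unfolding A_def by (intro decseq_SucI subset_ball divide_left_mono) auto
  have "(\<Inter>n. A n) = {x}"
  proof (intro set_eqI iffI)
    fix y assume y: "y \<in> (\<Inter>n. A n)"
    show "y \<in> {x}"
    proof (rule ccontr)
      assume "y \<notin> {x}"
      then obtain n where "inverse (real (Suc n)) < dist x y"
        using reals_Archimedean[of "dist x y"] by auto
      moreover have "dist x y < 1 / Suc n" using y by (auto simp: A_def)
      ultimately show False by (simp add: inverse_eq_divide)
    qed
  qed (auto simp: A_def)
  moreover have "(\<lambda>n. measure m (A n)) \<longlonglongrightarrow> measure m (\<Inter>n. A n)"
    by (rule finite_Lim_measure_decseq[OF _ dec]) (auto simp: A_def intro: sets_mI)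
  ultimately have "(\<lambda>n. measure m (A n)) \<longlonglongrightarrow> 0" by (simp add: measure_point)
  then obtain n where "measure m (A n) < e"
    using order_tendstoD(2)[OF _ assms] by (metis (no_types, lifting) eventually_sequentially order_refl)
  then show ?thesis by (intro exI[of _ "1 / Suc n"]) (auto simp: A_def)
qed

lemma small_measure_balls:
  assumes "finite X" "e > 0"
  shows "\<exists>r>0. measure m (\<Union>x\<in>X. ball x r) < e"
  using assms
proof (induction X arbitrary: e rule: finite_induct)
  case (insert x X)
  obtain r where r: "r > 0" "measure m (\<Union>x\<in>X. ball x r) < e/2" using insert.IH[of "e/2"] insert.prems by auto
  obtain s where s: "s > 0" "measure m (ball x s) < e/2" using small_measure_ball[of "e/2" x] insert.prems by auto
  have op: "open (\<Union>x\<in>X. ball x r)" "open (ball x s)" by auto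
  have "measure m (\<Union>x\<in>insert x X. ball x (min r s)) \<le> measure m ((\<Union>x\<in>X. ball x r) \<union> ball x s)"
    by (rule finite_measure_mono) (use op in \<open>auto intro: sets_mI\<close>)
  also have "\<dots> \<le> measure m (\<Union>x\<in>X. ball x r) + measure m (ball x s)"
    by (rule measure_Un_le) (use op in \<open>auto intro: sets_mI\<close>)
  also have "\<dots> < e" using r(2) s(2) by simp
  finally show ?case using r(1) s(1) by (intro exI[of _ "min r s"]) auto
qed auto

text \<open>\<open>S\<close> is a smallness property inherited by subsets, so all sufficiently small
  coordinate balls about points of A qualify. They form a Vitali cover of the image of A, and the
  uncovered null set pulls back to a null set.\<close>

lemma vitali_chart:
  assumes U: "(U, \<phi>) \<in> \<A>" and A: "open A" "A \<subseteq> U"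
    and small: "\<And>x. x \<in> A \<Longrightarrow> \<exists>V. open V \<and> x \<in> V \<and> S V" and her: "\<And>V B. S V \<Longrightarrow> B \<subseteq> V \<Longrightarrow> S B"
  shows "\<exists>C. countable C \<and> (\<forall>d\<in>C. valid d \<and> S (chart_cball d) \<and> chart_cball d \<subseteq> A) \<and>
     pairwise (\<lambda>d d'. disjnt (chart_cball d) (chart_cball d')) C \<and> A - (\<Union>d\<in>C. chart_cball d) \<in> null_sets m"
proof -
  define pre where "pre i = {x \<in> U. \<phi> x \<in> cball (fst i) (snd i)}" for i
  define K where "K = {i. 0 < snd i \<and> cball (fst i) (snd i) \<subseteq> \<phi> ` U \<and> pre i \<subseteq> A \<and> S (pre i)}"
  have Vit: "\<exists>i. i \<in> K \<and> y \<in> cball (fst i) (snd i) \<and> snd i < d" if y: "y \<in> \<phi> ` A" and "d > 0" for y and d :: real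
  proof -
    obtain x where x: "x \<in> A" "y = \<phi> x" using y by blast
    obtain V where V: "open V" "x \<in> V" "S V" using small[OF x(1)] by blast
    obtain r where r: "r > 0" "cball (\<phi> x) r \<subseteq> \<phi> ` U" "{y \<in> U. \<phi> y \<in> cball (\<phi> x) r} \<subseteq> V \<inter> A"
      using small_chart_cball[OF U, of x "V \<inter> A"] x A V by blast
    define s where "s = min r (d/2)"
    have s: "s > 0" "s \<le> r" "s < d" using r(1) \<open>d > 0\<close> by (auto simp: s_def)
    have sub: "cball (\<phi> x) s \<subseteq> cball (\<phi> x) r" using s by (simp add: subset_cball)
    have p: "pre (y, s) \<subseteq> V \<inter> A"
      unfolding pre_def x(2) fst_conv snd_conv using r(3) sub by blast
    then have "S (pre (y, s))" using her[OF V(3)] by blast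
    moreover have "cball y s \<subseteq> \<phi> ` U" using sub r(2) x(2) by blast
    ultimately have "(y, s) \<in> K" using s(1) p by (simp add: K_def)
    then show ?thesis using s by (intro exI[of _ "(y, s)"]) simp
  qed
  obtain C where C: "countable C" "C \<subseteq> K"
     "pairwise (\<lambda>i j. disjnt (cball (fst i) (snd i)) (cball (fst j) (snd j))) C"
     "negligible (\<phi> ` A - (\<Union>i\<in>C. cball (fst i) (snd i)))"
    using Vitali_covering_theorem_cballs[of K snd "\<phi> ` A" fst, OF _ Vit] K_def by blast
  define D where "D = (\<lambda>i. ((U, \<phi>), i)) ` C"
  have cb: "chart_cball ((U, \<phi>), i) = pre i" for i
    by (cases i) (simp add: chart_cball_def pre_def)
  have "open (\<phi> ` A)"
  proof -
    have "\<phi> ` A = \<phi> ` U \<inter> inv_into U \<phi> -` A"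
      using A(2) inj_chart[OF U] by (auto simp: inv_into_f_f f_inv_into_f image_iff subset_iff)
    then show ?thesis using continuous_open_preimage[OF cont_chart(2)[OF U] open_chart(2)[OF U] A(1)] by simp
  qed
  then have "\<phi> ` A - (\<Union>i\<in>C. cball (fst i) (snd i)) \<in> sets borel"
    using C(1) by (intro sets.Diff sets.countable_UN') auto
  from null_setsI_chart[OF U C(4) this]
  have "{x \<in> U. \<phi> x \<in> \<phi> ` A - (\<Union>i\<in>C. cball (fst i) (snd i))} \<in> null_sets m" using A(2) by auto
  moreover have "{x \<in> U. \<phi> x \<in> \<phi> ` A - (\<Union>i\<in>C. cball (fst i) (snd i))} = A - (\<Union>d\<in>D. chart_cball d)"
  proof -
    have "\<phi> x \<in> \<phi> ` A \<longleftrightarrow> x \<in> A" if "x \<in> U" for x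
      by (rule inj_on_image_mem_iff[OF inj_chart[OF U] that A(2)])
    moreover have "(\<Union>d\<in>D. chart_cball d) = (\<Union>i\<in>C. pre i)" by (simp add: D_def cb)
    ultimately show ?thesis using A(2) by (auto simp: pre_def subset_iff)
  qed
  moreover have "countable D" unfolding D_def using C(1) by simp
  moreover have "valid d \<and> S (chart_cball d) \<and> chart_cball d \<subseteq> A" if "d \<in> D" for d
  proof -
    obtain i where i: "i \<in> K" "d = ((U, \<phi>), i)" using \<open>d \<in> D\<close> C(2) unfolding D_def by blast
    have "valid d" unfolding i(2) using i(1) U by (cases i) (simp add: K_def valid_def)
    then show ?thesis using i(1) unfolding i(2) cb by (simp add: K_def)
  qed
  moreover have "pairwise (\<lambda>d d'. disjnt (chart_cball d) (chart_cball d')) D"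
  proof (rule pairwiseI)
    fix d d' assume dd: "d \<in> D" "d' \<in> D" "d \<noteq> d'"
    then obtain i j where ij: "i \<in> C" "j \<in> C" "d = ((U, \<phi>), i)" "d' = ((U, \<phi>), j)"
      unfolding D_def by blast
    then have "i \<noteq> j" using dd(3) by blast
    then have "disjnt (cball (fst i) (snd i)) (cball (fst j) (snd j))" using C(3) ij(1,2) by (simp add: pairwise_def)
    then show "disjnt (chart_cball d) (chart_cball d')" unfolding ij(3,4) cb by (auto simp: disjnt_def pre_def)
  qed
  ultimately show ?thesis by (intro exI[of _ D]) auto
qed

text \<open>For a further chart ball, the covering is carried out in what remains after removing the
  closed balls of \<open>D\<close>; the new balls are then disjoint from the old ones. What escapes
  is contained in two Vitali remainders and in the bounding spheres, all null.\<close>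

lemma vitali_finite_cover:
  assumes "finite D" "\<And>d. d \<in> D \<Longrightarrow> valid d"
    and small: "\<And>x. \<exists>V. open V \<and> x \<in> V \<and> S V" and her: "\<And>V B. S V \<Longrightarrow> B \<subseteq> V \<Longrightarrow> S B"
  shows "\<exists>C. countable C \<and> (\<forall>d\<in>C. valid d \<and> S (chart_cball d) \<and> chart_cball d \<subseteq> (\<Union>d\<in>D. chart_ball d)) \<and>
     pairwise (\<lambda>d d'. disjnt (chart_cball d) (chart_cball d')) C \<and>
     (\<Union>d\<in>D. chart_ball d) - (\<Union>d\<in>C. chart_cball d) \<in> null_sets m"
  using assms(1,2)
proof (induction D rule: finite_induct)
  case empty
  then show ?case by (intro exI[of _ "{}"]) auto
next
  case (insert d D)
  have vD: "valid d'" if "d' \<in> D" for d' using insert.prems that by blast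
  obtain C where "countable C \<and>
      (\<forall>d\<in>C. valid d \<and> S (chart_cball d) \<and> chart_cball d \<subseteq> (\<Union>d\<in>D. chart_ball d)) \<and>
      pairwise (\<lambda>d d'. disjnt (chart_cball d) (chart_cball d')) C \<and>
      (\<Union>d\<in>D. chart_ball d) - (\<Union>d\<in>C. chart_cball d) \<in> null_sets m"
    by (rule exE[OF insert.IH[OF vD]])
  then have C: "countable C"
    "\<And>d. d \<in> C \<Longrightarrow> valid d \<and> S (chart_cball d) \<and> chart_cball d \<subseteq> (\<Union>d\<in>D. chart_ball d)"
    "pairwise (\<lambda>d d'. disjnt (chart_cball d) (chart_cball d')) C"
    "(\<Union>d\<in>D. chart_ball d) - (\<Union>d\<in>C. chart_cball d) \<in> null_sets m"
    by simp_all
  obtain U \<phi> a r where d: "d = ((U, \<phi>), a, r)" by (metis prod.exhaust)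
  have vd: "valid d" using insert.prems by auto
  then have v: "(U, \<phi>) \<in> \<A>" "0 < r" "cball a r \<subseteq> \<phi> ` U" by (auto simp: d valid_def)
  define A where "A = chart_ball d - (\<Union>d\<in>D. chart_cball d)"
  have "compact (\<Union>d\<in>D. chart_cball d)" using insert.hyps(1) vD valid_facts(2) by (intro compact_UN) auto
  then have "open A" unfolding A_def using valid_facts(1)[OF vd] by (intro open_Diff compact_imp_closed)
  moreover have "A \<subseteq> U" by (auto simp: A_def d chart_ball_def)
  ultimately obtain C' where C': "countable C'"
    "\<And>d. d \<in> C' \<Longrightarrow> valid d \<and> S (chart_cball d) \<and> chart_cball d \<subseteq> A"
    "pairwise (\<lambda>d d'. disjnt (chart_cball d) (chart_cball d')) C'"
    "A - (\<Union>d\<in>C'. chart_cball d) \<in> null_sets m"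
    using vitali_chart[OF v(1), of A S] small her by metis
  have sphere: "chart_cball d' - chart_ball d' \<in> null_sets m" if "valid d'" for d'
  proof -
    obtain U \<phi> a r where d: "d' = ((U, \<phi>), a, r)" by (metis prod.exhaust)
    have v: "(U, \<phi>) \<in> \<A>" "cball a r \<subseteq> \<phi> ` U" using that by (auto simp: d valid_def)
    have "{x \<in> U. \<phi> x \<in> sphere a r} \<in> null_sets m"
      by (rule null_setsI_chart[OF v(1)]) (use v(2) in \<open>auto simp: negligible_sphere\<close>)
    moreover have "{x \<in> U. \<phi> x \<in> sphere a r} = chart_cball d' - chart_ball d'"
      by (auto simp: d chart_cball_def chart_ball_def)
    ultimately show ?thesis by simp
  qed
  let ?N = "((\<Union>d\<in>D. chart_ball d) - (\<Union>d\<in>C. chart_cball d)) \<union> (A - (\<Union>d\<in>C'. chart_cball d))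
      \<union> (\<Union>d\<in>D. chart_cball d - chart_ball d)"
  have N: "?N \<in> null_sets m"
    using C(4) C'(4) sphere vD insert.hyps(1)
    by (intro null_sets.Un null_sets_UN') (auto simp: countable_finite)
  have bD: "chart_ball d' \<subseteq> chart_cball d'" if "d' \<in> D" for d' using valid_facts(3) vD that by blast
  show ?case
  proof (intro exI[of _ "C \<union> C'"] conjI ballI)
    show "countable (C \<union> C')" using C(1) C'(1) by simp
    show "valid d'" "S (chart_cball d')" if "d' \<in> C \<union> C'" for d'
      using C(2)[of d'] C'(2)[of d'] that by blast+
    show "chart_cball d' \<subseteq> (\<Union>d\<in>insert d D. chart_ball d)" if "d' \<in> C \<union> C'" for d'
      using C(2)[of d'] C'(2)[of d'] that unfolding A_def by blast
    have CC': "disjnt (chart_cball d1) (chart_cball d2)" if "d1 \<in> C" "d2 \<in> C'" for d1 d2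
      using C(2)[OF that(1)] C'(2)[OF that(2)] bD unfolding A_def disjnt_def by blast
    show "pairwise (\<lambda>d d'. disjnt (chart_cball d) (chart_cball d')) (C \<union> C')"
      using C(3) C'(3) CC' disjnt_sym unfolding pairwise_def by blast
    have "(\<Union>d\<in>insert d D. chart_ball d) - (\<Union>d\<in>C \<union> C'. chart_cball d) \<subseteq> ?N"
      unfolding A_def by blast
    moreover have "(\<Union>d\<in>insert d D. chart_ball d) - (\<Union>d\<in>C \<union> C'. chart_cball d) \<in> sets m"
      using C(1,2) C'(1,2) vd vD valid_facts(1,2) insert.hyps(1)
      by (intro sets.Diff sets.countable_UN' sets.finite_UN) (auto intro: sets_mI)
    ultimately show "(\<Union>d\<in>insert d D. chart_ball d) - (\<Union>d\<in>C \<union> C'. chart_cball d) \<in> null_sets m"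
      using null_sets_subset[OF N] by blast
  qed
qed

lemma finite_subfamily:
  assumes "countable C" "\<And>d. d \<in> C \<Longrightarrow> B d \<in> sets m" "measure m (\<Union>d\<in>C. B d) > c"
  shows "\<exists>F. finite F \<and> F \<subseteq> C \<and> measure m (\<Union>d\<in>F. B d) > c"
proof (cases "C = {}")
  case True
  then show ?thesis using assms(3) by auto
next
  case False
  define s where "s = from_nat_into C"
  have s: "range s = C" unfolding s_def using False assms(1) by (simp add: range_from_nat_into)
  define A where "A n = (\<Union>i\<le>n. B (s i))" for n
  have A_sets: "A n \<in> sets m" for n
    unfolding A_def using assms(2) s by (intro sets.finite_UN) auto
  have "incseq A" unfolding A_def by (intro incseq_SucI) fastforce
  then have "(\<lambda>n. measure m (A n)) \<longlonglongrightarrow> measure m (\<Union>n. A n)"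
    using A_sets by (intro finite_Lim_measure_incseq) auto
  moreover have "(\<Union>n. A n) = (\<Union>d\<in>C. B d)"
    unfolding A_def s[symmetric] by auto
  ultimately have "eventually (\<lambda>n. measure m (A n) > c) sequentially"
    using order_tendstoD(1) assms(3) by metis
  then obtain n where "measure m (A n) > c" by (auto simp: eventually_sequentially)
  then show ?thesis
    unfolding A_def using s by (intro exI[of _ "s ` {..n}"]) auto
qed

text \<open>Compactness reduces to finitely many chart balls, and continuity of the measure from
  below replaces the countable family by a finite one at the price of mass less than e.\<close>

proposition vitali_manifold:
  assumes small: "\<And>x. \<exists>V. open V \<and> x \<in> V \<and> S V" and her: "\<And>V B. S V \<Longrightarrow> B \<subseteq> V \<Longrightarrow> S B" and "e > 0"
  obtains N :: nat and d where "\<And>i. i < N \<Longrightarrow> valid (d i) \<and> S (chart_cball (d i))"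
    "\<And>i j. i < N \<Longrightarrow> j < N \<Longrightarrow> i \<noteq> j \<Longrightarrow> chart_cball (d i) \<inter> chart_cball (d j) = {}"
    "measure m (\<Union>i<N. chart_cball (d i)) > 1 - e"
proof -
  have "\<exists>d. valid d \<and> chart_center d = x" for x
    by (metis small_valid UNIV_I open_UNIV)
  then obtain dd where dd: "\<And>x. valid (dd x)" "\<And>x. chart_center (dd x) = x" by metis
  have "UNIV \<subseteq> (\<Union>x\<in>UNIV. chart_ball (dd x))" using dd valid_facts(4) by (metis UNIV_I UN_I subsetI)
  then obtain X where X: "finite X" "UNIV \<subseteq> (\<Union>x\<in>X. chart_ball (dd x))"
    using compactE_image[OF comp, of UNIV "\<lambda>x. chart_ball (dd x)"] valid_facts(1)[OF dd(1)] by auto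
  have "finite (dd ` X)" "\<And>d. d \<in> dd ` X \<Longrightarrow> valid d" using X(1) dd(1) by blast+
  note cover = vitali_finite_cover[where S = S, OF this small her]
  obtain C where CC: "countable C \<and> (\<forall>d\<in>C. valid d \<and> S (chart_cball d) \<and> chart_cball d \<subseteq> (\<Union>d\<in>dd ` X. chart_ball d)) \<and>
     pairwise (\<lambda>d d'. disjnt (chart_cball d) (chart_cball d')) C \<and>
     (\<Union>d\<in>dd ` X. chart_ball d) - (\<Union>d\<in>C. chart_cball d) \<in> null_sets m"
    by (rule exE[OF cover]) (assumption | rule her | rule that)+
  then have C: "countable C" "\<And>d. d \<in> C \<Longrightarrow> valid d \<and> S (chart_cball d)"
    "pairwise (\<lambda>d d'. disjnt (chart_cball d) (chart_cball d')) C"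
    "(\<Union>d\<in>dd ` X. chart_ball d) - (\<Union>d\<in>C. chart_cball d) \<in> null_sets m"
    by (elim conjE; simp)+
  have cb_sets: "chart_cball d \<in> sets m" if "d \<in> C" for d
    using C(2)[OF that] valid_facts(2) sets_mI by blast
  have U_sets: "(\<Union>d\<in>C. chart_cball d) \<in> sets m"
    using C(1) cb_sets by (intro sets.countable_UN') auto
  have "(\<Union>d\<in>dd ` X. chart_ball d) = UNIV" using X(2) by auto
  then have "measure m (space m - (\<Union>d\<in>C. chart_cball d)) = 0"
    using C(4) by (simp add: space_m' measure_eq_0_null_sets)
  then have "measure m (\<Union>d\<in>C. chart_cball d) > 1 - e"
    using prob_compl[OF U_sets] \<open>e > 0\<close> by simp
  from finite_subfamily[where B = chart_cball, OF C(1) cb_sets this]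
  obtain F where F: "finite F" "F \<subseteq> C" "measure m (\<Union>d\<in>F. chart_cball d) > 1 - e"
    by auto
  obtain g where g: "bij_betw g {..<card F} F"
    using ex_bij_betw_nat_finite[OF F(1)] by (auto simp: atLeast0LessThan)
  show thesis
  proof (rule that[of "card F" g])
    show "valid (g i) \<and> S (chart_cball (g i))" if "i < card F" for i
      using C(2) F(2) bij_betwE[OF g] that by blast
    show "chart_cball (g i) \<inter> chart_cball (g j) = {}" if "i < card F" "j < card F" "i \<noteq> j" for i j
    proof -
      have "g i \<in> C" "g j \<in> C" "g i \<noteq> g j"
        using F(2) g that unfolding bij_betw_def inj_on_def by auto
      then show ?thesis using C(3) by (auto simp: pairwise_def disjnt_def)
    qed
    have "(\<Union>i<card F. chart_cball (g i)) = (\<Union>d\<in>F. chart_cball d)"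
      using arg_cong[OF bij_betw_imp_surj_on[OF g], of "\<lambda>F. \<Union>(chart_cball ` F)"]
      by (simp only: image_image)
    then show "measure m (\<Union>i<card F. chart_cball (g i)) > 1 - e" using F(3) by simp
  qed
qed

end

section \<open>Density for continuous maps\<close>

lemma compact_infdist_nbhd:
  fixes C :: "'m::metric_space set"
  assumes "compact C" "C \<noteq> {}" "open V" "C \<subseteq> V"
  obtains r where "r > 0" "\<And>x. infdist x C \<le> r \<Longrightarrow> x \<in> V"
proof (rule Heine_Borel_lemma[OF assms(1), of "{V}"])
  fix e :: real assume e: "0 < e" "\<And>x. x \<in> C \<Longrightarrow> \<exists>G\<in>{V}. ball x e \<subseteq> G"
  show thesis
  proof (rule that[of "e/2"])
    fix x assume "infdist x C \<le> e/2"
    moreover have "continuous_on C (dist x)" by (intro continuous_intros)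
    with continuous_attains_inf[OF assms(1,2), of "dist x"]
    obtain c where c: "c \<in> C" "\<And>y. y \<in> C \<Longrightarrow> dist x c \<le> dist x y"
      by blast
    then have "dist x c \<le> infdist x C"
      unfolding infdist_notempty[OF assms(2)] by (intro cINF_greatest assms(2))
    ultimately have "x \<in> ball c e" using e(1) by (simp add: dist_commute)
    then show "x \<in> V" using e(2)[OF c(1)] by blast
  qed (use e in simp)
qed (use assms in auto)

lemma finite_separated:
  fixes X :: "'m::metric_space set"
  assumes "finite X"
  shows "\<exists>s>0. \<forall>x\<in>X. \<forall>y\<in>X. x \<noteq> y \<longrightarrow> s \<le> dist x y"
  using assms
proof (induction X rule: finite_induct)
  case empty
  then show ?case by (intro exI[of _ 1]) auto
next
  case (insert x X)
  obtain s where s: "s > 0" "\<forall>x\<in>X. \<forall>y\<in>X. x \<noteq> y \<longrightarrow> s \<le> dist x y" using insert.IH by blast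
  obtain t where t: "t > 0" "\<forall>y\<in>X. y \<noteq> x \<longrightarrow> t \<le> dist x y"
    using finite_set_avoid[OF insert.hyps(1), of x] by blast
  show ?case
    using s t by (intro exI[of _ "min s t"]) (auto simp: dist_commute min_le_iff_disj)
qed

text \<open>The neighbourhoods are open Voronoi cells: the points strictly closer to one set than to
  all the others.\<close>

lemma disjoint_open_nbhds:
  fixes C :: "'i \<Rightarrow> 'm::metric_space set"
  assumes "finite I" "\<And>i. i \<in> I \<Longrightarrow> compact (C i) \<and> C i \<noteq> {}"
    and disj: "\<And>i j. i \<in> I \<Longrightarrow> j \<in> I \<Longrightarrow> i \<noteq> j \<Longrightarrow> C i \<inter> C j = {}"
  obtains V where "\<And>i. i \<in> I \<Longrightarrow> open (V i) \<and> C i \<subseteq> V i"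
    "\<And>i j. i \<in> I \<Longrightarrow> j \<in> I \<Longrightarrow> i \<noteq> j \<Longrightarrow> V i \<inter> V j = {}"
proof -
  define V where "V i = (\<Inter>j\<in>I - {i}. {x. infdist x (C i) < infdist x (C j)})" for i
  show thesis
  proof (rule that[of V])
    fix i assume i: "i \<in> I"
    have "open (V i)"
      unfolding V_def using assms(1)
      by (intro open_INT ballI open_Collect_less continuous_intros) auto
    moreover have "x \<in> V i" if x: "x \<in> C i" for x
    proof -
      have "infdist x (C i) < infdist x (C j)" if j: "j \<in> I - {i}" for j
      proof -
        have "x \<notin> C j" using disj[of i j] i j x by blast
        then have "infdist x (C j) > 0"
          using assms(2)[of j] j compact_imp_closed infdist_pos_not_in_closed by blast
        then show ?thesis using x by simp
      qed
      then show ?thesis by (simp add: V_def)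
    qed
    ultimately show "open (V i) \<and> C i \<subseteq> V i" by blast
  next
    fix i j assume ij: "i \<in> I" "j \<in> I" "i \<noteq> j"
    show "V i \<inter> V j = {}"
    proof (rule equals0I)
      fix x assume "x \<in> V i \<inter> V j"
      then have "infdist x (C i) < infdist x (C j)" "infdist x (C j) < infdist x (C i)"
        using ij unfolding V_def by blast+
      then show False by simp
    qed
  qed
qed

section \<open>Perturbations constant on cells, and disjoint nets\<close>

context charted
begin

text \<open>In the coordinates of a chart ball containing t and f(C), f is interpolated linearly
  with the constant t. The cutoff \<open>u\<close> is 1 on C and 0 from distance
  \<open>\<rho>\<close> on; convexity keeps the interpolation inside the ball, whose size bounds the
  error. The map \<open>g\<close> carries the changes already made elsewhere.\<close>

lemma constant_on_cell:
  fixes f g :: "'m \<Rightarrow> 'm"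
  assumes e: "\<And>x. \<exists>d. valid d \<and> ball x l \<subseteq> chart_ball d \<and> (\<forall>y\<in>chart_cball d. \<forall>z\<in>chart_cball d. dist y z < e)"
    and f: "continuous_on UNIV f" and g: "continuous_on UNIV g" "\<And>x. x \<in> V \<Longrightarrow> g x = f x"
    and C: "compact C" "C \<noteq> {}" "C \<subseteq> V" "open V" and t: "\<And>x. x \<in> C \<Longrightarrow> dist t (f x) < l" and l: "l > 0"
    and near: "\<And>x. dist (g x) (f x) < e"
  shows "\<exists>g'. continuous_on UNIV g' \<and> (\<forall>x\<in>C. g' x = t) \<and> (\<forall>x. x \<notin> V \<longrightarrow> g' x = g x) \<and>
     (\<forall>x. dist (g' x) (f x) < e)"
proof -
  obtain d where d: "valid d" "ball t l \<subseteq> chart_ball d"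
    "\<And>y z. y \<in> chart_cball d \<Longrightarrow> z \<in> chart_cball d \<Longrightarrow> dist y z < e" using e by blast
  obtain U \<phi> a r where dd: "d = ((U, \<phi>), a, r)" by (metis prod.exhaust)
  have v: "(U, \<phi>) \<in> \<A>" "0 < r" "cball a r \<subseteq> \<phi> ` U" using d(1) by (auto simp: dd valid_def)
  have cb: "y \<in> chart_ball d \<longleftrightarrow> y \<in> U \<and> \<phi> y \<in> ball a r" for y by (simp add: dd chart_ball_def)
  define \<psi> where "\<psi> = inv_into U \<phi>"
  have \<psi>: "\<psi> y \<in> U" "\<phi> (\<psi> y) = y" if "y \<in> ball a r" for y
    using v(3) ball_subset_cball[of a r] that by (auto simp: \<psi>_def inv_into_into f_inv_into_f subset_iff)
  have \<psi>': "\<psi> (\<phi> x) = x" if "x \<in> U" for x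
    using inj_chart[OF v(1)] that by (simp add: \<psi>_def)
  have tb: "t \<in> chart_ball d" using d(2) l by auto
  have "open (V \<inter> f -` chart_ball d)"
    using C(4) f valid_facts(1)[OF d(1)] by (intro open_Int open_vimage)
  moreover have "C \<subseteq> V \<inter> f -` chart_ball d"
  proof
    fix x assume x: "x \<in> C"
    then have "f x \<in> ball t l" using t by simp
    then show "x \<in> V \<inter> f -` chart_ball d" using x C(3) d(2) by blast
  qed
  ultimately obtain \<rho> where \<rho>: "\<rho> > 0" "\<And>x. infdist x C \<le> \<rho> \<Longrightarrow> x \<in> V \<inter> f -` chart_ball d"
    using compact_infdist_nbhd[OF C(1,2)] by metis
  define u where "u x = max 0 (1 - infdist x C / \<rho>)" for x
  have u: "continuous_on S u" for S
    unfolding u_def using \<rho>(1) by (intro continuous_intros) auto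
  have u01: "0 \<le> u x" "u x \<le> 1" for x
    using \<rho>(1) infdist_nonneg[of x C] by (auto simp: u_def)
  define p where "p x = (1 - u x) *\<^sub>R \<phi> (f x) + u x *\<^sub>R \<phi> t" for x
  let ?A = "{x. infdist x C \<le> \<rho>}" and ?B = "{x. infdist x C \<ge> \<rho>}"
  have fA: "f x \<in> U" "\<phi> (f x) \<in> ball a r" if "x \<in> ?A" for x
    using \<rho>(2)[of x] that cb by auto
  have pA: "p x \<in> ball a r" if "x \<in> ?A" for x
    unfolding p_def using fA(2)[OF that] tb cb u01[of x] by (intro convexD[OF convex_ball]) auto
  define g' where "g' x = (if x \<in> ?A then \<psi> (p x) else g x)" for x
  have "continuous_on (?A \<union> ?B) (\<lambda>x. if x \<in> ?A then \<psi> (p x) else g x)"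
  proof (rule continuous_on_cases)
    show "closed ?A" "closed ?B" by (intro closed_Collect_le continuous_intros)+
    have "continuous_on ?A (\<lambda>x. \<phi> (f x))"
      by (rule continuous_on_compose2[OF cont_chart(1)[OF v(1)]]) (use f fA in \<open>auto intro: continuous_on_subset\<close>)
    then have "continuous_on ?A p" unfolding p_def by (intro continuous_intros u)
    moreover have "p ` ?A \<subseteq> \<phi> ` U"
      using pA v(3) ball_subset_cball[of a r] by blast
    ultimately show "continuous_on ?A (\<lambda>x. \<psi> (p x))"
      unfolding \<psi>_def by (rule continuous_on_compose2[OF cont_chart(2)[OF v(1)]])
    show "continuous_on ?B g" using g(1) by (rule continuous_on_subset) simp
    show "\<forall>x. x \<in> ?A \<and> x \<notin> ?A \<or> x \<in> ?B \<and> x \<in> ?A \<longrightarrow> \<psi> (p x) = g x"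
    proof (intro allI impI)
      fix x assume "x \<in> ?A \<and> x \<notin> ?A \<or> x \<in> ?B \<and> x \<in> ?A"
      then have x: "x \<in> ?A" "infdist x C = \<rho>" by auto
      then have "p x = \<phi> (f x)" using \<rho>(1) by (simp add: p_def u_def)
      then show "\<psi> (p x) = g x" using \<psi>' fA(1)[OF x(1)] g(2) \<rho>(2)[of x] x by simp
    qed
  qed
  moreover have "?A \<union> ?B = UNIV" by auto
  ultimately have "continuous_on UNIV g'" by (simp only: g'_def[abs_def])
  moreover have "g' x = t" if "x \<in> C" for x
  proof -
    have "infdist x C = 0" using that by simp
    then have "x \<in> ?A" "p x = \<phi> t" using \<rho>(1) by (auto simp: p_def u_def)
    then show ?thesis using \<psi>' tb cb by (simp add: g'_def)
  qed
  moreover have "g' x = g x" if "x \<notin> V" for x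
    using \<rho>(2)[of x] that by (auto simp: g'_def)
  moreover have "dist (g' x) (f x) < e" for x
  proof (cases "x \<in> ?A")
    case True
    then have "g' x \<in> chart_ball d" "f x \<in> chart_ball d"
      using \<psi>[OF pA[OF True]] pA[OF True] fA[OF True] cb by (auto simp: g'_def)
    then show ?thesis using d(3) valid_facts(3)[OF d(1)] by blast
  qed (use near g'_def in auto)
  ultimately show ?thesis by blast
qed

text \<open>The changes take place in disjoint neighbourhoods, so each point is affected at most
  once and the error e is independent of the number of cells.\<close>

lemma constant_on_cells:
  fixes f :: "'m \<Rightarrow> 'm" and C :: "'i \<Rightarrow> 'm set"
  assumes e: "\<And>x. \<exists>d. valid d \<and> ball x l \<subseteq> chart_ball d \<and> (\<forall>y\<in>chart_cball d. \<forall>z\<in>chart_cball d. dist y z < e)"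
    and l: "l > 0" and "e > 0" and f: "continuous_on UNIV f" and I: "finite I"
    and C: "\<And>i. i \<in> I \<Longrightarrow> compact (C i)"
    and disj: "\<And>i j. i \<in> I \<Longrightarrow> j \<in> I \<Longrightarrow> i \<noteq> j \<Longrightarrow> C i \<inter> C j = {}"
    and t: "\<And>i x. i \<in> I \<Longrightarrow> x \<in> C i \<Longrightarrow> dist (t i) (f x) < l"
  shows "\<exists>g. continuous_on UNIV g \<and> (\<forall>i\<in>I. \<forall>x\<in>C i. g x = t i) \<and> (\<forall>x. dist (g x) (f x) < e)"
proof -
  \<comment> \<open>Empty cells impose no condition and must be set aside, because
    \<open>infdist\<close> to the empty set is 0 and would spoil the Voronoi cells.\<close>
  let ?I = "{i \<in> I. C i \<noteq> {}}"
  obtain V where V: "\<And>i. i \<in> ?I \<Longrightarrow> open (V i) \<and> C i \<subseteq> V i"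
    "\<And>i j. i \<in> ?I \<Longrightarrow> j \<in> ?I \<Longrightarrow> i \<noteq> j \<Longrightarrow> V i \<inter> V j = {}"
  proof (rule disjoint_open_nbhds[of ?I C])
    show "finite ?I" using I by simp
  qed (use C disj in auto)
  have "J \<subseteq> ?I \<Longrightarrow> \<exists>g. continuous_on UNIV g \<and> (\<forall>i\<in>J. \<forall>x\<in>C i. g x = t i) \<and> (\<forall>x. dist (g x) (f x) < e) \<and>
      (\<forall>x. x \<notin> (\<Union>i\<in>J. V i) \<longrightarrow> g x = f x)" if "finite J" for J
    using that
  proof (induction J rule: finite_induct)
    case empty
    show ?case using f \<open>e > 0\<close> by (intro exI[of _ f]) auto
  next
    case (insert i J)
    have i: "i \<in> I" "C i \<noteq> {}" "i \<in> ?I" using insert.prems by auto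
    obtain g where g: "continuous_on UNIV g" "\<And>j x. j \<in> J \<Longrightarrow> x \<in> C j \<Longrightarrow> g x = t j"
      "\<And>x. dist (g x) (f x) < e" "\<And>x. x \<notin> (\<Union>i\<in>J. V i) \<Longrightarrow> g x = f x"
      using insert.IH insert.prems by blast
    have disjV: "V j \<inter> V i = {}" if "j \<in> J" for j
      using V(2)[of j i] that i(3) insert.prems insert.hyps by blast
    have gV: "g x = f x" if "x \<in> V i" for x
      using g(4)[of x] disjV that by blast
    have "C i \<subseteq> V i" "open (V i)" using V(1)[OF i(3)] by simp_all
    from constant_on_cell[OF e f g(1) gV C[OF i(1)] i(2) this t[OF i(1)] l g(3)]
    obtain g' where g': "continuous_on UNIV g'" "\<forall>x\<in>C i. g' x = t i" "\<forall>x. x \<notin> V i \<longrightarrow> g' x = g x"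
      "\<forall>x. dist (g' x) (f x) < e"
      by blast
    show ?case
    proof (intro exI[of _ g'] conjI ballI allI impI)
      fix j x assume j: "j \<in> insert i J" and x: "x \<in> C j"
      show "g' x = t j"
      proof (cases "j = i")
        case False
        then have "j \<in> J" using j by blast
        then have "x \<notin> V i" using disjV V(1)[of j] x insert.prems by blast
        then show ?thesis using g'(3) g(2)[OF \<open>j \<in> J\<close> x] by simp
      qed (use g'(2) x in blast)
    next
      fix x assume "x \<notin> (\<Union>i\<in>insert i J. V i)"
      then show "g' x = f x" using g'(3) g(4)[of x] by auto
    qed (use g' in auto)
  qed
  from this[of ?I] obtain g where "continuous_on UNIV g" "\<forall>i\<in>?I. \<forall>x\<in>C i. g x = t i" "\<forall>x. dist (g x) (f x) < e"
    using I by auto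
  then show ?thesis by (intro exI[of _ g]) auto
qed

text \<open>An e/2-net whose points are moved by less than e/2 to generic positions off F.\<close>

lemma finite_net_avoiding:
  assumes "finite F" "e > 0"
  shows "\<exists>Z::'m set. finite Z \<and> Z \<inter> F = {} \<and> (\<forall>y. \<exists>z\<in>Z. dist z y < e)"
proof -
  have "(UNIV :: 'm set) \<subseteq> (\<Union>x\<in>UNIV. ball x (e/2))" using assms(2) by auto
  from compactE_image[OF comp _ this]
  obtain X :: "'m set" where X: "finite X" "UNIV \<subseteq> (\<Union>x\<in>X. ball x (e/2))" by auto
  have "\<exists>z. z \<in> ball x (e/2) \<and> z \<notin> F" for x
  proof (rule generic_point[of "ball x (e/2)" F])
    show "ball x (e/2) \<noteq> {}" using assms(2) by simp
  qed (use assms(1) countable_finite in auto)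
  then obtain z where z: "\<And>x. z x \<in> ball x (e/2)" "\<And>x. z x \<notin> F" by metis
  have net: "\<exists>w\<in>z ` X. dist w y < e" for y
  proof -
    have "y \<in> (\<Union>x\<in>X. ball x (e/2))" using X(2) by blast
    then obtain x where x: "x \<in> X" "dist x y < e/2" by auto
    have "dist x (z x) < e/2" using z(1)[of x] by simp
    then have "dist (z x) y < e" using x(2) dist_triangle3[of "z x" y x] by linarith
    then show ?thesis using x(1) by blast
  qed
  show ?thesis
  proof (intro exI[of _ "z ` X"] conjI allI)
    show "finite (z ` X)" using X(1) by simp
    show "z ` X \<inter> F = {}" using z(2) by blast
  qed (rule net)
qed

lemma disjoint_finite_nets:
  assumes "e > 0"
  shows "\<exists>Z::nat \<Rightarrow> 'm set. \<forall>i<N. finite (Z i) \<and> (\<forall>j<i. Z i \<inter> Z j = {}) \<and> (\<forall>y. \<exists>z\<in>Z i. dist z y < e)"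
proof (induction N)
  case (Suc N)
  then obtain Z :: "nat \<Rightarrow> 'm set" where Z: "\<forall>i<N. finite (Z i) \<and> (\<forall>j<i. Z i \<inter> Z j = {}) \<and> (\<forall>y. \<exists>z\<in>Z i. dist z y < e)"
    by blast
  have fin: "finite (\<Union>i<N. Z i)" using Z by auto
  then obtain Y :: "'m set" where Y: "finite Y" "Y \<inter> (\<Union>i<N. Z i) = {}" "\<forall>y. \<exists>z\<in>Y. dist z y < e"
    using finite_net_avoiding[OF fin assms] by blast
  show ?case
  proof (intro exI[of _ "Z(N := Y)"] allI impI)
    fix i assume "i < Suc N"
    then consider "i = N" | "i < N" by linarith
    then show "finite ((Z(N := Y)) i) \<and> (\<forall>j<i. (Z(N := Y)) i \<inter> (Z(N := Y)) j = {}) \<and>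
        (\<forall>y. \<exists>z\<in>(Z(N := Y)) i. dist z y < e)"
    proof cases
      case 1
      have "\<forall>j<N. Y \<inter> Z j = {}" using Y(2) by blast
      then show ?thesis using Y(1,3) unfolding 1 by (simp del: ex_simps)
    next
      case 2
      then show ?thesis using Z by simp
    qed
  qed
qed auto

end

section \<open>Small Vitali balls and trapping perturbations of continuous maps\<close>

context charted_measure
begin

lemma small_sets_vitali:
  assumes "\<eta> > 0" "e > 0" "e' > 0"
  obtains N :: nat and d where "\<And>i. i < N \<Longrightarrow> valid (d i)"
    "\<And>i x y. i < N \<Longrightarrow> x \<in> chart_cball (d i) \<Longrightarrow> y \<in> chart_cball (d i) \<Longrightarrow> dist x y < \<eta>"
    "\<And>i. i < N \<Longrightarrow> measure m (chart_cball (d i)) < e"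
    "\<And>i j. i < N \<Longrightarrow> j < N \<Longrightarrow> i \<noteq> j \<Longrightarrow> chart_cball (d i) \<inter> chart_cball (d j) = {}"
    "measure m (\<Union>i<N. chart_cball (d i)) > 1 - e'"
proof -
  \<comment> \<open>Phrasing smallness through an enclosing metric ball makes it pass to arbitrary
    subsets, measurable or not.\<close>
  define S where "S V \<longleftrightarrow> (\<exists>x r. V \<subseteq> ball x r \<and> r \<le> \<eta>/2 \<and> measure m (ball x r) < e)" for V
  have small: "\<exists>V. open V \<and> x \<in> V \<and> S V" for x
  proof -
    obtain r where r: "r > 0" "measure m (ball x r) < e" using small_measure_ball assms(2) by blast
    have "measure m (ball x (min r (\<eta>/2))) \<le> measure m (ball x r)"
      by (rule finite_measure_mono) (auto intro: sets_mI)
    then have "S (ball x (min r (\<eta>/2)))" unfolding S_def using r(2)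
      by (intro exI[of _ x] exI[of _ "min r (\<eta>/2)"]) auto
    then show ?thesis using r(1) assms(1) by (intro exI[of _ "ball x (min r (\<eta>/2))"]) auto
  qed
  have her: "S V \<Longrightarrow> B \<subseteq> V \<Longrightarrow> S B" for V B unfolding S_def by blast
  show thesis
  proof (rule vitali_manifold[of S e', OF small her \<open>e' > 0\<close>])
    fix N :: nat and d
    assume d: "\<And>i. i < N \<Longrightarrow> valid (d i) \<and> S (chart_cball (d i))"
      "\<And>i j. i < N \<Longrightarrow> j < N \<Longrightarrow> i \<noteq> j \<Longrightarrow> chart_cball (d i) \<inter> chart_cball (d j) = {}"
      "measure m (\<Union>i<N. chart_cball (d i)) > 1 - e'"
    have S: "dist x y < \<eta>" "measure m B < e" if SB: "S B" and "x \<in> B" "y \<in> B" for B x y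
    proof -
      obtain z r where z: "B \<subseteq> ball z r" "r \<le> \<eta>/2" "measure m (ball z r) < e" using SB S_def by blast
      have "dist z x < r" "dist z y < r" using z(1) that unfolding subset_iff mem_ball by blast+
      then show "dist x y < \<eta>" using z(2) dist_triangle3[of x y z] by linarith
      have "measure m B \<le> measure m (ball z r)"
        by (rule finite_measure_mono[OF z(1)]) (auto intro: sets_mI)
      then show "measure m B < e" using z(3) by simp
    qed
    show thesis
    proof (rule that[of N d])
      fix i assume i: "i < N"
      then have v: "valid (d i)" "S (chart_cball (d i))" using d(1) by auto
      then have "chart_center (d i) \<in> chart_cball (d i)" using valid_facts(3,4) by blast
      then show "measure m (chart_cball (d i)) < e" using S(2)[OF v(2)] by blast
      show "valid (d i)" by (rule v)
      show "\<And>x y. x \<in> chart_cball (d i) \<Longrightarrow> y \<in> chart_cball (d i) \<Longrightarrow> dist x y < \<eta>"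
        using S(1)[OF v(2)] by blast
    qed (use d in blast)+
  qed (assumption | rule her)+
qed

text \<open>Interface shared by both density proofs: the families are indexed by finite sets of
  points, the net points in one case and the orbit points in the other, with \<open>V z\<close> a
  small trap at z.\<close>

lemma trappingI:
  fixes B K :: "nat \<Rightarrow> 'm set"
  assumes K: "\<And>i. i < N \<Longrightarrow> compact (K i) \<and> K i \<subseteq> B i \<and> compact (B i) \<and> measure m (B i) < e"
    and large: "measure m (\<Union>i<N. K i) > 1 - e"
    and Z: "\<And>i. i < N \<Longrightarrow> finite (Z i)"
    and V: "\<And>z. z \<in> (\<Union>i<N. Z i) \<Longrightarrow> compact (V z) \<and> (\<forall>x\<in>V z. \<forall>y\<in>V z. dist x y \<le> e)"
    and disj: "\<And>i j z w. i < N \<Longrightarrow> j < N \<Longrightarrow> i \<noteq> j \<Longrightarrow> z \<in> Z i \<Longrightarrow> w \<in> Z j \<Longrightarrow> V z \<inter> V w = {}"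
    and W: "open W" "measure m W < e"
    and gK: "\<And>i. i < N \<Longrightarrow> \<exists>z\<in>Z i. g ` K i \<subseteq> W \<inter> interior (V z)"
    and gV: "\<And>i z. i < N \<Longrightarrow> z \<in> Z i \<Longrightarrow> \<exists>w\<in>Z i. g ` V z \<subseteq> interior (V w)"
  shows "trapping m e g"
  unfolding trapping_def
proof (intro exI[of _ "{..<N}"] exI[of _ K] exI[of _ "\<lambda>i. V ` Z i"] exI[of _ W] conjI ballI)
  show "trap_data m e {..<N} K (\<lambda>i. V ` Z i) W"
    unfolding trap_data_def
  proof (intro conjI ballI impI)
    fix b assume b: "b \<in> {..<N}"
    have "measure m (K b) \<le> measure m (B b)"
      by (rule finite_measure_mono) (use K[of b] b sets_mI in auto)
    then show "measure m (K b) < e" using K[of b] b by auto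
    show "compact (K b)" "finite (V ` Z b)" using K[of b] Z[of b] b by auto
    show "compact C" "\<And>x y. x \<in> C \<Longrightarrow> y \<in> C \<Longrightarrow> dist x y \<le> e" if "C \<in> V ` Z b" for C
      using V b that by blast+
  next
    fix b c assume "b \<in> {..<N}" "c \<in> {..<N}" "b \<noteq> c"
    then show "\<Union>(V ` Z b) \<inter> \<Union>(V ` Z c) = {}" using disj[of b c] by blast
  qed (use large W in auto)
next
  fix b assume "b \<in> {..<N}"
  then show "\<exists>C\<in>V ` Z b. g ` K b \<subseteq> W \<inter> interior C" using gK[of b] by blast
next
  fix b C assume "b \<in> {..<N}" "C \<in> V ` Z b"
  then show "\<exists>C'\<in>V ` Z b. g ` C \<subseteq> interior C'" using gV[of b] by blast
qed

proposition trapping_dense_C0: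
  assumes f: "continuous_on UNIV f" and \<delta>: "\<delta> > 0" and e: "e > 0"
  shows "\<exists>g. continuous_on UNIV g \<and> (\<forall>x. dist (g x) (f x) < \<delta>) \<and> trapping m e g"
proof -
  obtain l where l: "l > 0"
    "\<And>x. \<exists>d. valid d \<and> ball x l \<subseteq> chart_ball d \<and> (\<forall>y\<in>chart_cball d. \<forall>z\<in>chart_cball d. dist y z < \<delta>)"
    using lebesgue_number[OF \<delta>] by metis
  have "uniformly_continuous_on UNIV f" using compact_uniformly_continuous[OF f comp] .
  \<comment> \<open>The variation of f over a cell and the mesh of the nets are each below l/2, so
    some net point is within l of the whole image of the cell.\<close>
  then obtain \<eta> where \<eta>: "\<eta> > 0" "\<And>x y. dist x y < \<eta> \<Longrightarrow> dist (f x) (f y) < l/2"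
    using l(1) unfolding uniformly_continuous_on_def by (metis UNIV_I dist_commute half_gt_zero)
  have e2: "e/2 > 0" using e by simp
  obtain N :: nat and d where v: "\<And>i. i < N \<Longrightarrow> valid (d i)"
    and diam: "\<And>i x y. i < N \<Longrightarrow> x \<in> chart_cball (d i) \<Longrightarrow> y \<in> chart_cball (d i) \<Longrightarrow> dist x y < \<eta>"
    and mB: "\<And>i. i < N \<Longrightarrow> measure m (chart_cball (d i)) < e"
    and Bdisj: "\<And>i j. i < N \<Longrightarrow> j < N \<Longrightarrow> i \<noteq> j \<Longrightarrow> chart_cball (d i) \<inter> chart_cball (d j) = {}"
    and Bbig: "measure m (\<Union>i<N. chart_cball (d i)) > 1 - e/2"
    by (rule small_sets_vitali[OF \<eta>(1) e e2]) blast
  define B where "B i = chart_cball (d i)" for i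
  have Bc: "compact (B i)" if "i < N" for i using valid_facts(2) v that by (simp add: B_def)
  obtain Z :: "nat \<Rightarrow> 'm set" where Z: "\<forall>i<N. finite (Z i) \<and> (\<forall>j<i. Z i \<inter> Z j = {}) \<and> (\<forall>y. \<exists>z\<in>Z i. dist z y < l/2)"
    using disjoint_finite_nets[of "l/2" N] l(1) by auto
  have Zfin: "finite (Z i)" and Znet: "\<exists>z\<in>Z i. dist z y < l/2" if "i < N" for i y
    using Z that by blast+
  have Zdisj: "Z i \<inter> Z j = {}" if "i < N" "j < N" "i \<noteq> j" for i j
    using Z that by (metis inf_commute linorder_neqE_nat)
  define ZZ where "ZZ = (\<Union>i<N. Z i)"
  have ZZ: "finite ZZ" unfolding ZZ_def using Zfin by auto
  obtain s where s: "s > 0" "\<forall>x\<in>ZZ. \<forall>y\<in>ZZ. x \<noteq> y \<longrightarrow> s \<le> dist x y" using finite_separated[OF ZZ] by blast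
  obtain r where r: "r > 0" "measure m (\<Union>z\<in>ZZ. ball z r) < e/2" using small_measure_balls[OF ZZ e2] by blast
  \<comment> \<open>r controls the mass of \<open>O2\<close>, s the disjointness of the balls,
    \<open>\<eta>\<close> the variation of f on them, and e their diameters.\<close>
  define \<rho> where "\<rho> = min (min (r/2) (s/3)) (min (\<eta>/2) (e/2))"
  have \<rho>: "\<rho> > 0" "2 * \<rho> \<le> r" "2 * \<rho> < s" "\<rho> < \<eta>" "2 * \<rho> \<le> e"
    using r(1) s(1) \<eta>(1) e unfolding \<rho>_def by auto
  \<comment> \<open>The doubled radius separates the sets \<open>K i\<close> from the closed balls
    of radius \<open>\<rho>\<close>. The same set serves as W, since g takes values in the nets on
    all \<open>K i\<close>.\<close>
  define O2 where "O2 = (\<Union>z\<in>ZZ. ball z (2 * \<rho>))"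
  define K where "K i = B i - O2" for i
  have O2: "open O2" "measure m O2 < e/2"
  proof -
    show "open O2" unfolding O2_def by auto
    have "O2 \<subseteq> (\<Union>z\<in>ZZ. ball z r)" unfolding O2_def using \<rho>(2) by fastforce
    then have "measure m O2 \<le> measure m (\<Union>z\<in>ZZ. ball z r)"
      by (rule finite_measure_mono) (auto intro: sets_mI)
    then show "measure m O2 < e/2" using r(2) by simp
  qed
  have Kc: "compact (K i)" if "i < N" for i
    unfolding K_def using Bc[OF that] O2(1) by (intro compact_diff)
  have Kbig: "measure m (\<Union>i<N. K i) > 1 - e"
  proof -
    have BU: "compact (\<Union>i<N. B i)" and KU: "compact (\<Union>i<N. K i)" using Bc Kc by auto
    have "measure m (\<Union>i<N. B i) \<le> measure m ((\<Union>i<N. K i) \<union> O2)"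
    proof (rule finite_measure_mono)
      show "(\<Union>i<N. K i) \<union> O2 \<in> sets m"
        using sets_mI(3)[OF KU] sets_mI(1)[OF O2(1)] by (rule sets.Un)
    qed (auto simp: K_def)
    also have "\<dots> \<le> measure m (\<Union>i<N. K i) + measure m O2"
      using sets_mI(3)[OF KU] sets_mI(1)[OF O2(1)] by (rule measure_Un_le)
    finally show ?thesis using Bbig O2(2) by (simp add: B_def)
  qed
  have VV: "cball z \<rho> \<inter> cball w \<rho> = {}" if "z \<in> ZZ" "w \<in> ZZ" "z \<noteq> w" for z w
  proof (rule equals0I)
    fix x assume "x \<in> cball z \<rho> \<inter> cball w \<rho>"
    then have "dist z w \<le> 2 * \<rho>" using dist_triangle2[of z w x] by auto
    then show False using s(2) that \<rho>(3) by force
  qed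
  have KV: "K i \<inter> cball z \<rho> = {}" if "z \<in> ZZ" for i z
  proof -
    have "cball z \<rho> \<subseteq> ball z (2 * \<rho>)" using \<rho>(1) by auto
    then show ?thesis using that unfolding K_def O2_def by blast
  qed
  \<comment> \<open>Two kinds of cells: trimmed Vitali balls and balls about net points.
    \<open>L\<close> names the net into which a cell must be sent; for a net point it is the unique
    net containing it.\<close>
  define I where "I = Inl ` {..<N} \<union> Inr ` ZZ"
  define C where "C = case_sum K (\<lambda>z. cball z \<rho>)"
  define lab where "lab z = (THE i. i < N \<and> z \<in> Z i)" for z
  have lab: "lab z = i" if "i < N" "z \<in> Z i" for i z
    unfolding lab_def by (rule the_equality) (use that Zdisj in blast)+
  define L where "L = case_sum (\<lambda>i. i) lab"
  have LN: "L c < N" if "c \<in> I" for c using that lab by (auto simp: I_def L_def ZZ_def)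
  \<comment> \<open>Reference points at which the target is chosen. The center of a Vitali ball may
    have been cut out of \<open>K i\<close>, but it still lies within \<open>\<eta>\<close> of the
    cell.\<close>
  define y where "y = case_sum (\<lambda>i. chart_center (d i)) (\<lambda>z. z)"
  have y: "dist x (y c) < \<eta>" if "c \<in> I" "x \<in> C c" for c x
  proof (cases c)
    case (Inl i)
    then have i: "i < N" "x \<in> chart_cball (d i)" using that by (auto simp: I_def C_def K_def B_def)
    then have "chart_center (d i) \<in> chart_cball (d i)" using valid_facts(3,4)[OF v] by blast
    then show ?thesis using diam i Inl by (simp add: y_def)
  next
    case (Inr z)
    then show ?thesis using that \<rho>(4) by (simp add: C_def y_def dist_commute)
  qed
  have "\<exists>z. z \<in> Z (L c) \<and> dist z (f (y c)) < l/2" if "c \<in> I" for c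
    using Znet[OF LN[OF that]] by blast
  then obtain t where t: "\<And>c. c \<in> I \<Longrightarrow> t c \<in> Z (L c) \<and> dist (t c) (f (y c)) < l/2" by metis
  have tf: "dist (t c) (f x) < l" if "c \<in> I" "x \<in> C c" for c x
    using t[OF that(1)] \<eta>(2)[OF y[OF that]] dist_triangle2[of "t c" "f x" "f (y c)"] by linarith
  have "\<exists>g. continuous_on UNIV g \<and> (\<forall>c\<in>I. \<forall>x\<in>C c. g x = t c) \<and> (\<forall>x. dist (g x) (f x) < \<delta>)"
  proof (rule constant_on_cells[OF l(2) l(1) \<delta> f])
    show "finite I" unfolding I_def using ZZ by simp
    show "compact (C c)" if "c \<in> I" for c
    proof -
      have "compact (cball z \<rho>)" for z :: 'm using compact_Int_closed[OF comp closed_cball] by simp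
      then show ?thesis using that Kc by (auto simp: I_def C_def)
    qed
    show "C b \<inter> C c = {}" if "b \<in> I" "c \<in> I" "b \<noteq> c" for b c
    proof -
      have KK: "K i \<inter> K j = {}" if "i < N" "j < N" "i \<noteq> j" for i j
        using Bdisj[OF that] unfolding K_def B_def by blast
      have VK: "cball z \<rho> \<inter> K i = {}" if "z \<in> ZZ" for i z
        using KV[OF that] by blast
      show ?thesis
        by (cases b; cases c) (use that in \<open>simp_all add: I_def C_def image_iff KK VV KV VK\<close>)
    qed
  qed (rule tf)
  then obtain g where g: "continuous_on UNIV g" "\<And>c x. c \<in> I \<Longrightarrow> x \<in> C c \<Longrightarrow> g x = t c" "\<And>x. dist (g x) (f x) < \<delta>"
    by blast
  have int: "z \<in> interior (cball z \<rho>)" for z :: 'm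
    using interior_maximal[OF ball_subset_cball open_ball, of z \<rho>] \<rho>(1) by (meson centre_in_ball subsetD)
  have "trapping m e g"
  proof (rule trappingI[where B = B and K = K and Z = Z and V = "\<lambda>z. cball z \<rho>" and W = O2 and N = N])
    show "compact (K i) \<and> K i \<subseteq> B i \<and> compact (B i) \<and> measure m (B i) < e" if "i < N" for i
      using Kc[OF that] Bc[OF that] mB[OF that] by (auto simp: K_def B_def)
    show "measure m O2 < e" using O2(2) e by simp
    show "compact (cball z \<rho>) \<and> (\<forall>x\<in>cball z \<rho>. \<forall>y\<in>cball z \<rho>. dist x y \<le> e)" for z :: 'm
    proof (intro conjI ballI)
      show "compact (cball z \<rho>)" using compact_Int_closed[OF comp closed_cball] by simp
      fix x y assume "x \<in> cball z \<rho>" "y \<in> cball z \<rho>"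
      then show "dist x y \<le> e" using dist_triangle3[of x y z] \<rho>(5) by simp
    qed
    show "cball z \<rho> \<inter> cball w \<rho> = {}" if "i < N" "j < N" "i \<noteq> j" "z \<in> Z i" "w \<in> Z j" for i j z w
      by (rule VV) (use that Zdisj[of i j] in \<open>auto simp: ZZ_def\<close>)
    show "\<exists>z\<in>Z i. g ` K i \<subseteq> O2 \<inter> interior (cball z \<rho>)" if "i < N" for i
    proof
      have c: "Inl i \<in> I" using that by (simp add: I_def)
      show tz: "t (Inl i) \<in> Z i" using t[OF c] by (simp add: L_def)
      then have "t (Inl i) \<in> ZZ" using that by (auto simp: ZZ_def)
      then have "t (Inl i) \<in> O2" unfolding O2_def by (rule UN_I) (use \<rho>(1) in simp)
      then show "g ` K i \<subseteq> O2 \<inter> interior (cball (t (Inl i)) \<rho>)"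
        using g(2)[OF c] int by (auto simp: C_def)
    qed
    show "\<exists>w\<in>Z i. g ` cball z \<rho> \<subseteq> interior (cball w \<rho>)" if "i < N" "z \<in> Z i" for i z
    proof
      have c: "Inr z \<in> I" using that by (auto simp: I_def ZZ_def)
      show "t (Inr z) \<in> Z i" using t[OF c] lab[OF that] by (simp add: L_def)
      show "g ` cball z \<rho> \<subseteq> interior (cball (t (Inr z)) \<rho>)"
        using g(2)[OF c] int by (auto simp: C_def)
    qed
  qed (use Zfin Kbig O2 in auto)
  then show ?thesis using g by blast
qed

end

section \<open>Density for homeomorphisms\<close>

lemma powr_powr_inverse: "0 \<le> x \<Longrightarrow> s > 0 \<Longrightarrow> (x powr s) powr (1/s) = (x::real)"
  by (cases "x = 0") (auto simp: powr_powr)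

text \<open>By homogeneity q is constant along rays, where H raises the normalized radius to the
  power 1 + q: an increasing bijection that fixes the sphere. At the center, where q need not extend
  continuously, continuity comes from \<open>norm (H v) \<le> norm v\<close>.\<close>

lemma radial_homeomorphism:
  fixes q :: "'e::euclidean_space \<Rightarrow> real"
  assumes r: "r > 0" and q: "continuous_on (- {0}) q" "\<And>v. q v \<ge> 0"
    and hom: "\<And>c v. c > 0 \<Longrightarrow> q (c *\<^sub>R v) = q v"
  defines "H \<equiv> \<lambda>v. (norm v / r) powr q v *\<^sub>R (v :: 'e)"
  shows "continuous_on (cball 0 r) H" "bij_betw H (cball 0 r) (cball 0 r)" "\<And>v. v \<in> sphere 0 r \<Longrightarrow> H v = v"
proof -
  have coef1: "(norm v / r) powr q v \<le> 1" if "norm v \<le> r" for v :: 'e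
    using powr_le1[of "q v" "norm v / r"] that r q(2)[of v] by (simp add: divide_le_eq)
  have le: "norm (H v) \<le> norm v" if "norm v \<le> r" for v
    using mult_right_mono[OF coef1[OF that], of "norm v"] by (simp add: H_def)
  show sph: "H v = v" if "v \<in> sphere 0 r" for v
    using that r by (simp add: H_def)
  have cont0: "continuous_on (- {0}) H"
    unfolding H_def using r by (intro continuous_intros q(1)) auto
  show "continuous_on (cball 0 r) H"
    unfolding continuous_on_eq_continuous_within
  proof
    fix x :: 'e assume "x \<in> cball 0 r"
    show "continuous (at x within cball 0 r) H"
    proof (cases "x = 0")
      case False
      then have "isCont H x" using cont0 continuous_on_eq_continuous_at[of "- {0::'e}" H] by auto
      then show ?thesis by (rule continuous_at_imp_continuous_at_within)
    next
      case True
      have "(H \<longlongrightarrow> 0) (at 0 within cball 0 r)"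
      proof (rule Lim_null_comparison)
        show "\<forall>\<^sub>F v in at 0 within cball 0 r. norm (H v) \<le> norm v"
          using le by (auto simp: eventually_at_filter)
        show "(norm \<longlongrightarrow> 0) (at (0::'e) within cball 0 r)"
          using tendsto_norm_zero[OF tendsto_ident_at[of "0::'e"]] by simp
      qed
      moreover have "H 0 = 0" by (simp add: H_def)
      ultimately show ?thesis using True by (simp add: continuous_within)
    qed
  qed
  have pos: "(norm v / r) powr q v > 0" if "v \<noteq> 0" for v :: 'e
    using that r by (simp add: powr_gt_zero)
  have normH: "norm (H v) = r * (norm v / r) powr (1 + q v)" if "v \<noteq> 0" for v
    using that r by (simp add: H_def powr_add field_simps)
  have H0: "H v = 0 \<longleftrightarrow> v = 0" for v using r by (auto simp: H_def)
  have inj: "v = w" if eq: "H v = H w" for v w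
  proof (cases "v = 0 \<or> w = 0")
    case True
    then show ?thesis using eq H0 by metis
  next
    case False
    then have nz: "v \<noteq> 0" "w \<noteq> 0" by auto
    define cv where "cv = (norm v / r) powr q v"
    define cw where "cw = (norm w / r) powr q w"
    have c: "cv > 0" "cw > 0" using pos nz by (auto simp: cv_def cw_def)
    have eq': "cv *\<^sub>R v = cw *\<^sub>R w" using eq by (simp add: H_def cv_def cw_def)
    have "q v = q (cv *\<^sub>R v)" using hom[OF c(1)] by simp
    also have "\<dots> = q w" unfolding eq' using hom[OF c(2)] by simp
    finally have qq: "q v = q w" .
    have s: "1 + q w > 0" using q(2)[of w] by simp
    have ee: "(norm v / r) powr (1 + q w) = (norm w / r) powr (1 + q w)"
      using normH[OF nz(1)] normH[OF nz(2)] eq r qq by simp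
    have "norm v / r = ((norm v / r) powr (1 + q w)) powr (1 / (1 + q w))"
      by (rule powr_powr_inverse[symmetric]) (use r s in simp_all)
    also have "\<dots> = norm w / r"
      unfolding ee by (rule powr_powr_inverse) (use r s in simp_all)
    finally have "norm v = norm w" using r by simp
    then have "cv = cw" using qq by (simp add: cv_def cw_def)
    then show ?thesis using eq' c by simp
  qed
  show "bij_betw H (cball 0 r) (cball 0 r)"
  proof (rule bij_betwI')
    show "H v = H w \<longleftrightarrow> v = w" for v w using inj by blast
    show "H v \<in> cball 0 r" if "v \<in> cball 0 r" for v using le[of v] that by simp
    fix w :: 'e assume w: "w \<in> cball 0 r"
    show "\<exists>v\<in>cball 0 r. w = H v"
    proof (cases "w = 0")
      case True
      then show ?thesis using r by (intro bexI[of _ 0]) (auto simp: H_def)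
    next
      case False
      define n where "n = norm w / r"
      define s where "s = 1 + q w"
      have n: "0 < n" "n \<le> 1" using False w r by (auto simp: n_def)
      have s: "s > 0" using q(2)[of w] by (simp add: s_def)
      \<comment> \<open>On the ray of w the inverse raises the normalized radius to the power
        1/s.\<close>
      define v where "v = n powr (1/s - 1) *\<^sub>R w"
      have "norm v / r = n powr (1/s - 1) * n" using r by (simp add: v_def n_def)
      also have "\<dots> = n powr (1/s - 1 + 1)" using n(1) by (subst powr_add) simp
      finally have nv: "norm v / r = n powr (1/s)" by simp
      have qv: "q v = s - 1" unfolding v_def using hom n(1) by (simp add: s_def)
      have "H v = ((n powr (1/s)) powr (s - 1) * n powr (1/s - 1)) *\<^sub>R w"
        by (simp add: H_def nv qv) (simp add: v_def)
      also have "(n powr (1/s)) powr (s - 1) * n powr (1/s - 1) = n powr (1/s * (s - 1) + (1/s - 1))"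
        by (simp only: powr_powr powr_add)
      also have "1/s * (s - 1) + (1/s - 1) = 0" using s by (simp add: field_simps)
      finally have "H v = w" using n(1) by simp
      moreover have "n powr (1/s) \<le> 1" using powr_le1[of "1/s" n] n s by simp
      then have "norm v / r \<le> 1" using nv by simp
      then have "norm v \<le> r" using r by (simp add: divide_le_eq)
      ultimately show ?thesis by (intro bexI[of _ v]) auto
    qed
  qed
qed

text \<open>The exponent vanishes on the cones of aperture \<open>\<kappa>\<close> around the directions in \<open>D\<close>
  and equals \<open>L\<close> off the cones of aperture \<open>2 * \<kappa>\<close>.\<close>

definition cone_exponent :: "'e::euclidean_space set \<Rightarrow> real \<Rightarrow> real \<Rightarrow> 'e \<Rightarrow> real" where
  "cone_exponent D \<kappa> L v = L * (\<Prod>w\<in>D. min 1 (max 0 (norm (v - norm v *\<^sub>R w) / (\<kappa> * norm v) - 1)))"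

lemma cone_exponent:
  fixes D :: "'e::euclidean_space set"
  assumes D: "finite D" and \<kappa>: "\<kappa> > 0" and L: "L \<ge> 0"
  shows "continuous_on (- {0}) (cone_exponent D \<kappa> L)" "cone_exponent D \<kappa> L v \<ge> 0"
    "c > 0 \<Longrightarrow> cone_exponent D \<kappa> L (c *\<^sub>R v) = cone_exponent D \<kappa> L v"
    "w \<in> D \<Longrightarrow> norm (v - norm v *\<^sub>R w) < \<kappa> * norm v \<Longrightarrow> cone_exponent D \<kappa> L v = 0"
    "v \<noteq> 0 \<Longrightarrow> (\<And>w. w \<in> D \<Longrightarrow> 2 * \<kappa> * norm v \<le> norm (v - norm v *\<^sub>R w)) \<Longrightarrow> cone_exponent D \<kappa> L v = L"
proof -
  show "continuous_on (- {0}) (cone_exponent D \<kappa> L)"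
    unfolding cone_exponent_def using \<kappa> by (intro continuous_intros) auto
  show "cone_exponent D \<kappa> L v \<ge> 0"
    unfolding cone_exponent_def by (intro mult_nonneg_nonneg L prod_nonneg) auto
  show "cone_exponent D \<kappa> L (c *\<^sub>R v) = cone_exponent D \<kappa> L v" if "c > 0"
  proof -
    have "norm (c *\<^sub>R v - norm (c *\<^sub>R v) *\<^sub>R w) / (\<kappa> * norm (c *\<^sub>R v)) = norm (v - norm v *\<^sub>R w) / (\<kappa> * norm v)" for w
    proof -
      have "c *\<^sub>R v - norm (c *\<^sub>R v) *\<^sub>R w = c *\<^sub>R (v - norm v *\<^sub>R w)"
        using that by (simp add: scaleR_diff_right)
      then show ?thesis using that by simp
    qed
    then show ?thesis by (simp only: cone_exponent_def)
  qed
  show "cone_exponent D \<kappa> L v = 0" if w: "w \<in> D" "norm (v - norm v *\<^sub>R w) < \<kappa> * norm v"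
  proof -
    have "0 < \<kappa> * norm v" using w(2) norm_ge_zero order_le_less_trans by blast
    then have "norm (v - norm v *\<^sub>R w) / (\<kappa> * norm v) < 1" using w(2) by (simp add: divide_less_eq)
    then have "(\<Prod>w\<in>D. min 1 (max 0 (norm (v - norm v *\<^sub>R w) / (\<kappa> * norm v) - 1))) = 0"
      using D w(1) by (intro prod_zero bexI[of _ w]) simp_all
    then show ?thesis by (simp add: cone_exponent_def)
  qed
  show "cone_exponent D \<kappa> L v = L" if v: "v \<noteq> 0" "\<And>w. w \<in> D \<Longrightarrow> 2 * \<kappa> * norm v \<le> norm (v - norm v *\<^sub>R w)"
  proof -
    have "min 1 (max 0 (norm (v - norm v *\<^sub>R w) / (\<kappa> * norm v) - 1)) = 1" if "w \<in> D" for w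
    proof -
      have "2 \<le> norm (v - norm v *\<^sub>R w) / (\<kappa> * norm v)"
        using v(2)[OF that] v(1) \<kappa> by (simp add: le_divide_eq mult.assoc)
      then show ?thesis by simp
    qed
    then show ?thesis by (simp add: cone_exponent_def)
  qed
qed

section \<open>Moving finitely many points\<close>

context charted
begin

text \<open>In dimension at least two a ball stays connected when finitely many points are removed,
  and inside a connected open set any point can be moved to any other by a homeomorphism supported
  there.\<close>

lemma move_point:
  assumes dim: "DIM('e) \<ge> 2" and v: "valid d" and xy: "x \<in> chart_ball d" "y \<in> chart_ball d"
    and F: "finite F" "x \<notin> F" "y \<notin> F"
  shows "\<exists>k. homeo k \<and> k x = y \<and> (\<forall>z\<in>F. k z = z) \<and> (\<forall>z. z \<notin> chart_cball d \<longrightarrow> k z = z)"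
proof -
  obtain U \<phi> a r where d: "d = ((U, \<phi>), a, r)" by (metis prod.exhaust)
  have vv: "(U, \<phi>) \<in> \<A>" "0 < r" "cball a r \<subseteq> \<phi> ` U" using v by (auto simp: d valid_def)
  have inj: "x = y" if "x \<in> U" "y \<in> U" "\<phi> x = \<phi> y" for x y
    using inj_onD[OF inj_chart[OF vv(1)]] that by blast
  have xyU: "x \<in> U" "\<phi> x \<in> ball a r" "y \<in> U" "\<phi> y \<in> ball a r" using xy by (auto simp: d chart_ball_def)
  define S where "S = ball a r - \<phi> ` (F \<inter> U)"
  have fin: "finite (\<phi> ` (F \<inter> U))" using F(1) by simp
  have opS: "open S" unfolding S_def using fin by (intro open_Diff finite_imp_closed open_ball)
  have conS: "connected S"
    unfolding S_def using fin by (intro connected_open_diff_countable[OF dim] countable_finite) auto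
  have S: "\<phi> x \<in> S" "\<phi> y \<in> S"
    unfolding S_def using xyU F(2,3) inj by blast+
  have aff: "affine hull S = UNIV" using affine_hull_open[OF opS] S by blast
  then have opeS: "openin (top_of_set (affine hull S)) S" and sub: "cball a r \<subseteq> affine hull S"
    using opS by simp_all
  have "S \<subseteq> cball a r" unfolding S_def using ball_subset_cball by blast
  then obtain H H' where H: "homeomorphism (cball a r) (cball a r) H H'" "H (\<phi> x) = \<phi> y"
    "{z. \<not> (H z = z \<and> H' z = z)} \<subseteq> S"
    by (rule homeomorphism_moving_point[OF opeS _ sub conS S]) (rule that, assumption+)
  have Hid: "H z = z" if "z \<notin> S" for z using H(3) that by blast
  have "continuous_on (cball a r) H" using H(1) by (simp add: homeomorphism_def)
  moreover have "bij_betw H (cball a r) (cball a r)" 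
    by (rule bij_betwI[where g = H']) (use H(1) in \<open>auto simp: homeomorphism_def\<close>)
  moreover have "H z = z" if "z \<in> sphere a r" for z using that by (intro Hid) (auto simp: S_def)
  ultimately obtain h where h: "homeo h" "\<And>x. x \<notin> chart_cball d \<Longrightarrow> h x = x"
    "\<And>x. x \<in> chart_cball d \<Longrightarrow> h x \<in> U \<and> \<phi> (h x) = H (\<phi> x)"
    using chart_lift[OF v[unfolded d]] unfolding d by metis
  have cbU: "z \<in> U" if "z \<in> chart_cball d" for z using that by (simp add: d chart_cball_def)
  have "h x = y" using h(3)[of x] xy(1) valid_facts(3)[OF v] H(2) inj xyU by auto
  moreover have "h z = z" if "z \<in> F" for z
  proof (cases "z \<in> chart_cball d")
    case True
    then have "\<phi> z \<notin> S" using that cbU by (auto simp: S_def)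
    then show ?thesis using h(3)[OF True] Hid inj cbU[OF True] by auto
  qed (use h(2) in blast)
  ultimately show ?thesis using h by blast
qed

text \<open>The inductive homeomorphism additionally fixes \<open>p i\<close>, and the new one fixes
  the targets already reached; sources distinct from the other targets make this possible. The
  supports may overlap, so the errors add up.\<close>

lemma move_points:
  fixes p t :: "'i \<Rightarrow> 'm" and e l :: real
  assumes dim: "DIM('e) \<ge> 2"
    and e: "\<And>x. \<exists>d. valid d \<and> ball x l \<subseteq> chart_ball d \<and> (\<forall>y\<in>chart_cball d. \<forall>z\<in>chart_cball d. dist y z < e)"
    and e0: "e > 0" and "finite I" "finite F" "inj_on p I" "inj_on t I"
    "\<And>i. i \<in> I \<Longrightarrow> p i \<notin> F \<and> t i \<notin> F \<and> dist (p i) (t i) < l"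
    "\<And>i j. i \<in> I \<Longrightarrow> j \<in> I \<Longrightarrow> i \<noteq> j \<Longrightarrow> t i \<noteq> p j"
  shows "\<exists>k. homeo k \<and> (\<forall>i\<in>I. k (p i) = t i) \<and> (\<forall>x\<in>F. k x = x) \<and> (\<forall>x. dist (k x) x \<le> card I * e)"
  using assms(4-)
proof (induction I arbitrary: F rule: finite_induct)
  case empty
  show ?case using homeo_id by (intro exI[of _ "\<lambda>x. x"]) auto
next
  case (insert i I)
  have pI: "p j \<noteq> p i" "t j \<noteq> t i" if "j \<in> I" for j
    using insert.prems(2,3) insert.hyps(2) that by (auto simp: inj_on_def)
  have "\<exists>k. homeo k \<and> (\<forall>j\<in>I. k (p j) = t j) \<and> (\<forall>x\<in>insert (p i) F. k x = x) \<and> (\<forall>x. dist (k x) x \<le> card I * e)"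
  proof (rule insert.IH)
    show "finite (insert (p i) F)" using insert.prems(1) by simp
    show "inj_on p I" "inj_on t I" using insert.prems(2,3) by auto
    show "p j \<notin> insert (p i) F \<and> t j \<notin> insert (p i) F \<and> dist (p j) (t j) < l" if "j \<in> I" for j
      using insert.prems(4)[of j] insert.prems(5)[of j i] pI[OF that] that insert.hyps(2) by auto
    show "t j \<noteq> p j'" if "j \<in> I" "j' \<in> I" "j \<noteq> j'" for j j' using insert.prems(5)[of j j'] that by simp
  qed
  then obtain k where k: "homeo k" "\<And>j. j \<in> I \<Longrightarrow> k (p j) = t j" "\<And>x. x \<in> insert (p i) F \<Longrightarrow> k x = x"
    "\<And>x. dist (k x) x \<le> card I * e" by blast
  obtain d where d: "valid d" "ball (p i) l \<subseteq> chart_ball d"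
    "\<And>y z. y \<in> chart_cball d \<Longrightarrow> z \<in> chart_cball d \<Longrightarrow> dist y z < e" using e[of "p i"] by blast
  have pt: "p i \<notin> F" "t i \<notin> F" "dist (p i) (t i) < l" using insert.prems(4)[of i] by auto
  have "l > 0" using pt(3) zero_le_dist[of "p i" "t i"] by linarith
  then have "p i \<in> ball (p i) l" "t i \<in> ball (p i) l" using pt(3) by simp_all
  then have b: "p i \<in> chart_ball d" "t i \<in> chart_ball d" using d(2) by blast+
  have "finite (F \<union> t ` I)" using insert.prems(1) insert.hyps(1) by simp
  moreover have "t j \<noteq> p i" if "j \<in> I" for j
    using insert.prems(5)[of j i] insert.hyps(2) that by auto
  then have "p i \<notin> F \<union> t ` I" "t i \<notin> F \<union> t ` I"
    using pt(1,2) pI(2) by (metis Un_iff imageE)+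
  ultimately obtain k0 where k0: "homeo k0" "k0 (p i) = t i" "\<And>z. z \<in> F \<union> t ` I \<Longrightarrow> k0 z = z"
    "\<And>z. z \<notin> chart_cball d \<Longrightarrow> k0 z = z"
    using move_point[OF dim d(1) b] by metis
  have small: "dist (k0 z) z \<le> e" for z
  proof (cases "z \<in> chart_cball d")
    case True
    then show ?thesis using d(3)[OF homeo_maps_support[OF k0(1,4) True] True] by simp
  qed (use k0(4) e0 in simp)
  show ?case
  proof (intro exI[of _ "\<lambda>x. k0 (k x)"] conjI ballI allI)
    show "homeo (\<lambda>x. k0 (k x))" using k0(1) k(1) by (rule homeo_comp)
    show "k0 (k (p j)) = t j" if "j \<in> insert i I" for j
      using that k(2)[of j] k(3)[of "p i"] k0(2) k0(3)[of "t j"] by auto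
    show "k0 (k x) = x" if "x \<in> F" for x using that k(3)[of x] k0(3)[of x] by simp
    fix x
    have "dist (k0 (k x)) x \<le> dist (k0 (k x)) (k x) + dist (k x) x" by (rule dist_triangle)
    also have "\<dots> \<le> e + card I * e" using small k(4) by (intro add_mono)
    also have "\<dots> = card (insert i I) * e" using insert.hyps by (simp add: algebra_simps)
    finally show "dist (k0 (k x)) x \<le> card (insert i I) * e" .
  qed
qed

end

section \<open>Contracting a chart ball off thin cones\<close>

context charted_measure
begin

text \<open>The core is the ball minus cones around the rays from the center through the points of \<open>P\<close>;
  in dimension at least two these cones have small measure.\<close>

lemma cone_core:
  fixes a :: 'e
  assumes dim: "DIM('e) \<ge> 2" and v: "valid ((U, \<phi>), a, r)" and D: "finite D" and e: "e > 0"
  defines "E \<equiv> \<lambda>s \<kappa>. {v. norm v \<le> s \<and> (\<forall>w\<in>D. 2 * \<kappa> * norm v \<le> norm (v - norm v *\<^sub>R w))}"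
  shows "\<exists>s \<kappa>. 0 < s \<and> s < r \<and> \<kappa> > 0 \<and> compact {x \<in> U. \<phi> x - a \<in> E s \<kappa>} \<and>
    measure m (chart_cball ((U, \<phi>), a, r) - {x \<in> U. \<phi> x - a \<in> E s \<kappa>}) < e"
proof -
  have vv: "(U, \<phi>) \<in> \<A>" "0 < r" "cball a r \<subseteq> \<phi> ` U" using v by (auto simp: valid_def)
  let ?B = "chart_cball ((U, \<phi>), a, r)"
  have B: "compact ?B" using valid_facts(2)[OF v] .
  \<comment> \<open>Radii increase to r and apertures decrease to 0, so the sets left out by the
    cores decrease, with intersection contained in the sphere and the lines through the
    center.\<close>
  define s where "s n = r * (1 - 1 / real (n + 2))" for n :: nat
  define \<kappa> where "\<kappa> n = 1 / real (n + 1)" for n :: nat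
  define K where "K n = {x \<in> U. \<phi> x - a \<in> E (s n) (\<kappa> n)}" for n
  have s: "0 < s n" "s n < r" for n
  proof -
    have "0 < 1 - 1 / real (n + 2)" "1 - 1 / real (n + 2) < 1" by auto
    then show "0 < s n" "s n < r"
      unfolding s_def using mult_strict_left_mono[of _ 1 r] vv(2) by (auto intro: mult_pos_pos)
  qed
  have \<kappa>: "\<kappa> n > 0" for n by (simp add: \<kappa>_def)
  have Ecl: "closed (E s \<kappa>)" for s \<kappa>
  proof -
    have "E s \<kappa> = {v. norm v \<le> s} \<inter> (\<Inter>w\<in>D. {v. 2 * \<kappa> * norm v \<le> norm (v - norm v *\<^sub>R w)})"
      by (auto simp: E_def)
    also have "closed \<dots>" by (intro closed_Int closed_INT ballI closed_Collect_le continuous_intros)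
    finally show ?thesis .
  qed
  have Kc: "compact (K n)" for n
  proof -
    have sub: "(+) a ` E (s n) (\<kappa> n) \<subseteq> cball a r"
      using s(2)[of n] by (auto simp: E_def dist_norm)
    moreover have "closed ((+) a ` E (s n) (\<kappa> n))" by (rule closed_translation[OF Ecl])
    ultimately have "compact ((+) a ` E (s n) (\<kappa> n))"
      using bounded_subset[OF bounded_cball] compact_eq_bounded_closed by blast
    from compact_chart_preimage[OF vv(1) this] have "compact {x \<in> U. \<phi> x \<in> (+) a ` E (s n) (\<kappa> n)}"
      using sub vv(3) by blast
    moreover have "y \<in> (+) a ` E (s n) (\<kappa> n) \<longleftrightarrow> y - a \<in> E (s n) (\<kappa> n)" for y
      by (auto simp: image_iff intro: bexI[of _ "y - a"])
    ultimately show ?thesis by (simp add: K_def)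
  qed
  define A where "A n = ?B - K n" for n
  have A_sets: "A n \<in> sets m" for n
    unfolding A_def using sets_mI(3)[OF B] sets_mI(3)[OF Kc] by (rule sets.Diff)
  have "decseq A"
  proof (rule decseq_SucI)
    fix n
    have "s n \<le> s (Suc n)" unfolding s_def using vv(2) by (intro mult_left_mono diff_left_mono divide_left_mono) auto
    moreover have "\<kappa> (Suc n) \<le> \<kappa> n" unfolding \<kappa>_def by (intro divide_left_mono) auto
    then have "2 * \<kappa> (Suc n) * norm v \<le> 2 * \<kappa> n * norm v" for v :: 'e by (intro mult_right_mono) auto
    ultimately have "E (s n) (\<kappa> n) \<subseteq> E (s (Suc n)) (\<kappa> (Suc n))"
      unfolding E_def by (blast intro: order_trans)
    then show "A (Suc n) \<subseteq> A n" unfolding A_def K_def by blast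
  qed
  \<comment> \<open>Whole lines replace the rays: subspaces of dimension at most one are negligible
    when \<open>DIM('e) \<ge> 2\<close>.\<close>
  define X where "X = (sphere a r \<union> (\<Union>w\<in>D. (+) a ` span {w})) \<inter> cball a r"
  have "closed ((+) a ` span {w})" for w by (intro closed_translation closed_span)
  then have "closed X" unfolding X_def using D by (intro closed_Int closed_Un closed_UN) auto
  moreover have "negligible X"
  proof -
    have "negligible ((+) a ` span {w})" for w :: 'e
    proof (intro negligible_translation negligible_lowdim)
      have "dim (span {w}) \<le> card {w}" by (simp only: dim_span) (rule dim_le_card', simp)
      then show "dim (span {w}) < DIM('e)" using dim by simp
    qed
    then have "negligible (sphere a r \<union> (\<Union>w\<in>D. (+) a ` span {w}))"
      using D by (intro negligible_Un negligible_sphere negligible_Union) auto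
    then show ?thesis unfolding X_def by (rule negligible_subset) simp
  qed
  moreover have "X \<subseteq> \<phi> ` U" using vv(3) by (auto simp: X_def)
  ultimately have null: "{x \<in> U. \<phi> x \<in> X} \<in> null_sets m"
    by (intro null_setsI_chart[OF vv(1)]) auto
  have "(\<Inter>n. A n) \<subseteq> {x \<in> U. \<phi> x \<in> X}"
  proof
    fix x assume x: "x \<in> (\<Inter>n. A n)"
    then have xB: "x \<in> U" "\<phi> x \<in> cball a r" by (auto simp: A_def chart_cball_def)
    define y where "y = \<phi> x - a"
    have yr: "norm y \<le> r" using xB(2) by (simp add: y_def dist_norm norm_minus_commute)
    show "x \<in> {x \<in> U. \<phi> x \<in> X}"
    proof (rule ccontr)
      assume "x \<notin> {x \<in> U. \<phi> x \<in> X}"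
      then have nX: "\<phi> x \<notin> sphere a r" "\<And>w. w \<in> D \<Longrightarrow> \<phi> x \<notin> (+) a ` span {w}" using xB by (auto simp: X_def)
      have "norm y < r" using nX(1) yr by (auto simp: y_def dist_norm norm_minus_commute)
      moreover have "s \<longlonglongrightarrow> r * (1 - 0)"
        unfolding s_def by (intro tendsto_intros LIMSEQ_ignore_initial_segment[OF lim_1_over_n])
      ultimately have ev1: "eventually (\<lambda>n. norm y < s n) sequentially" using order_tendstoD(1) by force
      have "eventually (\<lambda>n. 2 * \<kappa> n * norm y < norm (y - norm y *\<^sub>R w)) sequentially" if "w \<in> D" for w
      proof -
        have "\<phi> x = a + norm y *\<^sub>R w" if "y = norm y *\<^sub>R w" using that by (simp add: y_def)
        then have "y \<noteq> norm y *\<^sub>R w" using nX(2)[OF \<open>w \<in> D\<close>] span_mul[OF span_base, of w "{w}"] by blast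
        then have "0 < norm (y - norm y *\<^sub>R w)" by simp
        moreover have "(\<lambda>n. 2 * \<kappa> n * norm y) \<longlonglongrightarrow> 2 * 0 * norm y"
          unfolding \<kappa>_def by (intro tendsto_intros LIMSEQ_ignore_initial_segment[OF lim_1_over_n])
        ultimately show ?thesis using order_tendstoD(2) by force
      qed
      then have "eventually (\<lambda>n. \<forall>w\<in>D. 2 * \<kappa> n * norm y < norm (y - norm y *\<^sub>R w)) sequentially"
        using D by (simp add: eventually_ball_finite_distrib)
      with ev1 have "eventually (\<lambda>n. y \<in> E (s n) (\<kappa> n)) sequentially"
        by eventually_elim (auto simp: E_def less_imp_le)
      then obtain n where "y \<in> E (s n) (\<kappa> n)" by (auto simp: eventually_sequentially)
      then have "x \<in> K n" using xB by (simp add: K_def y_def)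
      then show False using x by (auto simp: A_def)
    qed
  qed
  moreover have "(\<Inter>n. A n) \<in> sets m" using A_sets by auto
  ultimately have "measure m (\<Inter>n. A n) = 0"
    using null_sets_subset[OF null] measure_eq_0_null_sets by blast
  moreover have "(\<lambda>n. measure m (A n)) \<longlonglongrightarrow> measure m (\<Inter>n. A n)"
    by (rule finite_Lim_measure_decseq[OF _ \<open>decseq A\<close>]) (use A_sets in auto)
  ultimately have "eventually (\<lambda>n. measure m (A n) < e) sequentially"
    using order_tendstoD(2)[OF _ e] by metis
  then obtain n where "measure m (A n) < e" by (auto simp: eventually_sequentially)
  then show ?thesis using s[of n] \<kappa>[of n] Kc[of n] unfolding A_def K_def
    by (intro exI[of _ "s n"] exI[of _ "\<kappa> n"]) simp
qed

text \<open>The order of quantifiers is essential: \<open>K\<close> and \<open>G\<close> are fixed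
  before V, because V will be a preimage under a map whose construction depends on them. The case
  \<open>P = {}\<close> yields the traps at the orbit points.\<close>

proposition shrink_chart_ball:
  assumes dim: "DIM('e) \<ge> 2" and v: "valid d" and P: "finite P" "chart_center d \<notin> P" and e: "e > 0"
  obtains K G where "compact K" "K \<subseteq> chart_cball d" "open G" "P \<subseteq> G" "G \<inter> K = {}"
    "measure m (chart_cball d - K) < e" "P = {} \<Longrightarrow> chart_center d \<in> interior K"
    "\<And>V. open V \<Longrightarrow> chart_center d \<in> V \<Longrightarrow>
       \<exists>h. homeo h \<and> (\<forall>x. x \<notin> chart_cball d \<longrightarrow> h x = x) \<and> (\<forall>x\<in>G. h x = x) \<and> h ` K \<subseteq> V"
proof -
  obtain U \<phi> a r where d: "d = ((U, \<phi>), a, r)" by (metis prod.exhaust)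
  have vv: "(U, \<phi>) \<in> \<A>" "0 < r" "cball a r \<subseteq> \<phi> ` U" using v by (auto simp: d valid_def)
  have inj: "x = y" if "x \<in> U" "y \<in> U" "\<phi> x = \<phi> y" for x y
    using inj_onD[OF inj_chart[OF vv(1)]] that by blast
  have cb: "x \<in> chart_cball d \<longleftrightarrow> x \<in> U \<and> \<phi> x \<in> cball a r" for x by (simp add: d chart_cball_def)
  have "a \<in> \<phi> ` U" using vv(2,3) by auto
  then have cen: "chart_center d \<in> U" "\<phi> (chart_center d) = a"
    by (auto simp: d chart_center_def inv_into_into f_inv_into_f)
  define D where "D = (\<lambda>p. sgn (\<phi> p - a)) ` (P \<inter> chart_cball d)"
  have D: "finite D" unfolding D_def using P(1) by simp
  define E where "E = (\<lambda>s \<kappa>. {v. norm v \<le> s \<and> (\<forall>w\<in>D. 2 * \<kappa> * norm v \<le> norm (v - norm v *\<^sub>R w))})"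
  obtain s \<kappa> where s: "0 < s" "s < r" and \<kappa>: "\<kappa> > 0" and K: "compact {x \<in> U. \<phi> x - a \<in> E s \<kappa>}"
    "measure m (chart_cball d - {x \<in> U. \<phi> x - a \<in> E s \<kappa>}) < e"
    using cone_core[OF dim v[unfolded d] D e] unfolding d E_def by blast
  define K where "K = {x \<in> U. \<phi> x - a \<in> E s \<kappa>}"
  define cone where "cone = (\<Union>w\<in>D. {v. norm (v - norm v *\<^sub>R w) < \<kappa> * norm v})"
  \<comment> \<open>The complement of the ball is included because h is the identity there; in this
    way points of P outside the ball are covered as well.\<close>
  define G where "G = {x \<in> U. \<phi> x \<in> {y. y - a \<in> cone}} \<union> - chart_cball d"
  have KB: "K \<subseteq> chart_cball d"
    using s by (auto simp: K_def E_def cb dist_norm norm_minus_commute)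
  have opc: "open {y. y - a \<in> cone}"
  proof -
    have "{y. y - a \<in> cone} = (\<Union>w\<in>D. {y. norm ((y - a) - norm (y - a) *\<^sub>R w) < \<kappa> * norm (y - a)})"
      by (auto simp: cone_def)
    also have "open \<dots>" by (intro open_UN ballI open_Collect_less continuous_intros)
    finally show ?thesis .
  qed
  have "open G" unfolding G_def
    by (intro open_Un open_Compl open_chart_preimage[OF vv(1) opc] compact_imp_closed valid_facts(2)[OF v])
  moreover have "P \<subseteq> G"
  proof
    fix p assume p: "p \<in> P"
    show "p \<in> G"
    proof (cases "p \<in> chart_cball d")
      case True
      have "\<phi> p \<noteq> a" using inj[of p "chart_center d"] cen True cb P(2) p by auto
      then have "\<phi> p - a \<in> cone"
        using \<kappa> True p unfolding cone_def D_def by (intro UN_I[of "sgn (\<phi> p - a)"]) (auto simp: sgn_div_norm)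
      then show ?thesis using True cb by (simp add: G_def)
    qed (simp add: G_def)
  qed
  moreover have "G \<inter> K = {}"
  proof (rule equals0I)
    fix x assume x: "x \<in> G \<inter> K"
    then have "\<phi> x - a \<in> cone" using KB by (auto simp: G_def)
    then obtain w where w: "w \<in> D" "norm (\<phi> x - a - norm (\<phi> x - a) *\<^sub>R w) < \<kappa> * norm (\<phi> x - a)"
      by (auto simp: cone_def)
    moreover have "2 * \<kappa> * norm (\<phi> x - a) \<le> norm (\<phi> x - a - norm (\<phi> x - a) *\<^sub>R w)"
      using x w(1) by (auto simp: K_def E_def)
    moreover have "0 \<le> \<kappa> * norm (\<phi> x - a)" using \<kappa> by simp
    ultimately show False by linarith
  qed
  moreover have "chart_center d \<in> interior K" if "P = {}"
  proof -
    have D0: "D = {}" using that by (simp add: D_def)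
    have "open {x \<in> U. \<phi> x \<in> ball a s}" by (rule open_chart_preimage[OF vv(1) open_ball])
    moreover have "{x \<in> U. \<phi> x \<in> ball a s} \<subseteq> K" by (auto simp: K_def E_def D0 dist_norm norm_minus_commute)
    moreover have "chart_center d \<in> {x \<in> U. \<phi> x \<in> ball a s}" using cen s(1) by simp
    ultimately show ?thesis by (meson interiorI)
  qed
  moreover have "\<exists>h. homeo h \<and> (\<forall>x. x \<notin> chart_cball d \<longrightarrow> h x = x) \<and> (\<forall>x\<in>G. h x = x) \<and> h ` K \<subseteq> V"
    if V: "open V" "chart_center d \<in> V" for V
  proof -
    obtain r1 where r1: "r1 > 0" "{y \<in> U. \<phi> y \<in> cball a r1} \<subseteq> V"
      using small_chart_cball[OF vv(1) cen(1) V] cen(2) by auto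
    \<comment> \<open>Off the cones the exponent is L, so a point at distance at most s from the
      center comes within (s / r)^L * r < r1 of it.\<close>
    obtain L where L: "(s / r) ^ L < r1 / r"
      using real_arch_pow_inv[of "r1 / r" "s / r"] r1(1) s vv(2) by auto
    define q where "q = cone_exponent D \<kappa> (real L)"
    have q: "continuous_on (- {0}) q" "\<And>v. q v \<ge> 0" "\<And>c v. c > 0 \<Longrightarrow> q (c *\<^sub>R v) = q v"
      unfolding q_def using cone_exponent[OF D \<kappa>, of "real L"] by auto
    define H where "H = (\<lambda>v. (norm v / r) powr q v *\<^sub>R (v :: 'e))"
    have H: "continuous_on (cball 0 r) H" "bij_betw H (cball 0 r) (cball 0 r)" "\<And>v. v \<in> sphere 0 r \<Longrightarrow> H v = v"
      unfolding H_def using radial_homeomorphism[OF vv(2) q] by blast+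
    define J where "J y = a + H (y - a)" for y
    have "continuous_on (cball a r) J"
      unfolding J_def by (intro continuous_intros continuous_on_compose2[OF H(1)]) (auto simp: dist_norm norm_minus_commute)
    moreover have "bij_betw J (cball a r) (cball a r)"
    proof -
      have "bij_betw (\<lambda>y. y - a) (cball a r) (cball 0 r)"
        by (rule bij_betwI[where g = "\<lambda>y. y + a"]) (auto simp: dist_norm norm_minus_commute)
      moreover have "bij_betw (\<lambda>y. a + y) (cball 0 r) (cball a r)"
        by (rule bij_betwI[where g = "\<lambda>y. y - a"]) (auto simp: dist_norm norm_minus_commute)
      ultimately have "bij_betw ((\<lambda>y. a + y) \<circ> (H \<circ> (\<lambda>y. y - a))) (cball a r) (cball a r)"
        using H(2) by (intro bij_betw_trans)
      then show ?thesis by (simp add: J_def[abs_def] o_def)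
    qed
    moreover have "J y = y" if "y \<in> sphere a r" for y
      using H(3)[of "y - a"] that by (simp add: J_def dist_norm norm_minus_commute)
    ultimately obtain h where h: "homeo h" "\<And>x. x \<notin> chart_cball d \<Longrightarrow> h x = x"
      "\<And>x. x \<in> chart_cball d \<Longrightarrow> h x \<in> U \<and> \<phi> (h x) = J (\<phi> x)"
      using chart_lift[OF v[unfolded d]] unfolding d by metis
    have "h x = x" if "x \<in> G" for x
    proof (cases "x \<in> chart_cball d")
      case True
      then have "\<phi> x - a \<in> cone" using that by (simp add: G_def)
      then obtain w where w: "w \<in> D" "norm (\<phi> x - a - norm (\<phi> x - a) *\<^sub>R w) < \<kappa> * norm (\<phi> x - a)"
        by (auto simp: cone_def)
      then have "q (\<phi> x - a) = 0" unfolding q_def using cone_exponent(4)[OF D \<kappa> _ w] by simp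
      moreover have "\<phi> x - a \<noteq> 0" using w(2) by auto
      ultimately have "J (\<phi> x) = \<phi> x" using vv(2) by (simp add: J_def H_def)
      then show ?thesis using h(3)[OF True] inj True cb by auto
    qed (use h(2) in blast)
    moreover have "h x \<in> V" if x: "x \<in> K" for x
    proof -
      have xB: "x \<in> chart_cball d" using KB x by blast
      define y where "y = \<phi> x - a"
      have y: "norm y \<le> s" "\<And>w. w \<in> D \<Longrightarrow> 2 * \<kappa> * norm y \<le> norm (y - norm y *\<^sub>R w)"
        using x by (auto simp: K_def E_def y_def)
      have "norm (H y) \<le> r1"
      proof (cases "y = 0")
        case False
        then have "q y = real L" unfolding q_def using cone_exponent(5)[OF D \<kappa> _ False y(2)] by simp
        then have "norm (H y) = (norm y / r) ^ L * norm y"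
          using False vv(2) by (simp add: H_def powr_realpow)
        also have "\<dots> \<le> (s / r) ^ L * r"
          using y(1) s vv(2) by (intro mult_mono power_mono divide_right_mono) auto
        also have "\<dots> \<le> r1" using L vv(2) by (simp add: less_divide_eq less_imp_le)
        finally show ?thesis .
      qed (use r1 in \<open>simp add: H_def\<close>)
      then have "\<phi> (h x) \<in> cball a r1" using h(3)[OF xB] by (simp add: J_def y_def dist_norm)
      then show ?thesis using r1(2) h(3)[OF xB] by blast
    qed
    ultimately show ?thesis using h by blast
  qed
  ultimately show thesis using that[of K G] K KB unfolding K_def[symmetric] by blast
qed

end

section \<open>Generic orbits and near returns\<close>

context charted
begin

text \<open>Iterates of f are injective, so the conditions for all pairs of times exclude only
  countably many positions of each new point.\<close>

lemma generic_orbits: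
  fixes q :: "nat \<Rightarrow> 'm"
  assumes f: "homeo f" and l: "l > 0" and X: "finite X"
  shows "\<exists>z. \<forall>i<N. dist (z i) (q i) < l \<and> (\<forall>x\<in>X. \<forall>j k. (f ^^ j) (z i) \<noteq> (f ^^ k) x) \<and>
    (\<forall>i'<i. \<forall>j k. (f ^^ j) (z i) \<noteq> (f ^^ k) (z i'))"
proof (induction N)
  case (Suc N)
  then obtain z where z: "\<forall>i<N. dist (z i) (q i) < l \<and> (\<forall>x\<in>X. \<forall>j k. (f ^^ j) (z i) \<noteq> (f ^^ k) x) \<and>
    (\<forall>i'<i. \<forall>j k. (f ^^ j) (z i) \<noteq> (f ^^ k) (z i'))" by blast
  define Y where "Y = X \<union> z ` {..<N}"
  have "inj (f ^^ j)" for j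
    using f by (intro inj_fn) (simp add: homeo_def bij_is_inj)
  then have "countable ((f ^^ j) -` {(f ^^ k) x})" for j k x
    by (intro countable_finite finite_vimageI) auto
  moreover have "countable Y" unfolding Y_def using X by (simp add: countable_finite)
  ultimately have "countable (\<Union>x\<in>Y. \<Union>j. \<Union>k. (f ^^ j) -` {(f ^^ k) x})"
    by (intro countable_UN) auto
  then obtain w where w: "w \<in> ball (q N) l" "w \<notin> (\<Union>x\<in>Y. \<Union>j. \<Union>k. (f ^^ j) -` {(f ^^ k) x})"
    using generic_point[of "ball (q N) l"] l by (metis centre_in_ball empty_iff open_ball)
  have wY: "(f ^^ j) w \<noteq> (f ^^ k) x" if "x \<in> Y" for x j k
    using w(2) that by blast
  show ?case
  proof (intro exI[of _ "z(N := w)"] allI impI)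
    fix i assume "i < Suc N"
    then consider "i = N" | "i < N" by linarith
    then show "dist ((z(N := w)) i) (q i) < l \<and> (\<forall>x\<in>X. \<forall>j k. (f ^^ j) ((z(N := w)) i) \<noteq> (f ^^ k) x) \<and>
        (\<forall>i'<i. \<forall>j k. (f ^^ j) ((z(N := w)) i) \<noteq> (f ^^ k) ((z(N := w)) i'))"
    proof cases
      case 1
      have "dist w (q N) < l" using w(1) by (simp add: dist_commute)
      then show ?thesis using wY 1 by (simp add: Y_def)
    next
      case 2
      then show ?thesis using z by simp
    qed
  qed
qed auto

lemma near_return:
  fixes s :: "nat \<Rightarrow> 'm"
  assumes "l > 0"
  shows "\<exists>n. \<exists>m<n. dist (s m) (s n) < l"
proof -
  obtain x r where r: "strict_mono r" "(s \<circ> r) \<longlonglongrightarrow> x"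
    using seq_compactE[OF compact_imp_seq_compact[OF comp], of s] by blast
  have "Cauchy (s \<circ> r)" using r(2) by (rule LIMSEQ_imp_Cauchy)
  then obtain M where "\<And>i j. i \<ge> M \<Longrightarrow> j \<ge> M \<Longrightarrow> dist ((s \<circ> r) i) ((s \<circ> r) j) < l"
    using metric_CauchyD[OF _ assms] by blast
  from this[of M "Suc M"] have "dist (s (r M)) (s (r (Suc M))) < l" by simp
  moreover have "r M < r (Suc M)" using r(1) by (simp add: strict_mono_Suc_iff)
  ultimately show ?thesis by blast
qed

text \<open>For the first n that is l-close to an earlier time, a coincidence before n would itself
  be an earlier near return; injectivity of f shifts this to \<open>{1..n}\<close>. An exact return
  to z at time n is still possible.\<close>

lemma first_near_return:
  fixes z :: 'm
  assumes f: "homeo f" and l: "l > 0"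
  obtains m n where "m < n" "dist ((f ^^ m) z) ((f ^^ n) z) < l"
    "inj_on (\<lambda>j. (f ^^ j) z) {..<n}" "inj_on (\<lambda>j. (f ^^ j) z) {1..n}"
proof -
  define s where "s j = (f ^^ j) z" for j
  define n where "n = (LEAST n. \<exists>m<n. dist (s m) (s n) < l)"
  obtain m where m: "m < n" "dist (s m) (s n) < l"
    using LeastI_ex[OF near_return[OF l, of s]] unfolding n_def by blast
  have far: "s i \<noteq> s j" if "i < j" "j < n" for i j
    using not_less_Least[of j "\<lambda>n. \<exists>m<n. dist (s m) (s n) < l"] that l unfolding n_def by force
  have inj: "inj_on s {..<n}"
    by (rule linorder_inj_onI) (use far in auto)
  have "inj_on s {1..n}"
  proof (rule inj_onI)
    fix i j assume ij: "i \<in> {1..n}" "j \<in> {1..n}" "s i = s j"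
    then obtain i' j' where i': "i = Suc i'" "j = Suc j'" "i' < n" "j' < n"
      by (metis Suc_le_lessD Suc_pred atLeastAtMost_iff less_eq_Suc_le One_nat_def)
    then have "f (s i') = f (s j')" using ij(3) by (simp add: s_def)
    then have "s i' = s j'" using homeo_inj[OF f] by blast
    then show "i = j" using inj i' by (auto simp: inj_on_def)
  qed
  then show thesis using that[of m n] m inj unfolding s_def by blast
qed

end

section \<open>Trapping perturbations of homeomorphisms\<close>

context charted_measure
begin

proposition trapping_dense_homeo:
  assumes dim: "DIM('e) \<ge> 2" and f: "homeo f" and \<delta>: "\<delta> > 0" and e: "e > 0"
  shows "\<exists>g. homeo g \<and> (\<forall>x. dist (g x) (f x) < \<delta>) \<and> trapping m e g"
proof -
  have fc: "continuous_on UNIV f" using f by (simp add: homeo_def)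
  have "uniformly_continuous_on UNIV f" using compact_uniformly_continuous[OF fc comp] .
  \<comment> \<open>\<open>H1\<close> and \<open>H2\<close> displace by less than
    \<open>\<eta>/2\<close> each, which changes f by less than \<open>\<delta>/3\<close>; passing
    from f to \<open>Fm\<close> costs less than another \<open>\<delta>/3\<close>.\<close>
  then obtain \<eta> where \<eta>: "\<eta> > 0" "\<And>x y. dist x y < \<eta> \<Longrightarrow> dist (f x) (f y) < \<delta>/3"
    using \<delta> unfolding uniformly_continuous_on_def
    by (metis UNIV_I dist_commute zero_less_divide_iff zero_less_numeral)
  have pos: "\<eta>/2 > 0" "e/2 > 0" using \<eta>(1) e by simp_all
  obtain N :: nat and d where v: "\<And>i. i < N \<Longrightarrow> valid (d i)"
    and diam: "\<And>i x y. i < N \<Longrightarrow> x \<in> chart_cball (d i) \<Longrightarrow> y \<in> chart_cball (d i) \<Longrightarrow> dist x y < \<eta>/2"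
    and mB: "\<And>i. i < N \<Longrightarrow> measure m (chart_cball (d i)) < e"
    and Bdisj: "\<And>i j. i < N \<Longrightarrow> j < N \<Longrightarrow> i \<noteq> j \<Longrightarrow> chart_cball (d i) \<inter> chart_cball (d j) = {}"
    and Bbig: "measure m (\<Union>i<N. chart_cball (d i)) > 1 - e/2"
    by (rule small_sets_vitali[OF pos(1) e pos(2)]) blast
  define B where "B i = chart_cball (d i)" for i
  define c where "c i = chart_center (d i)" for i
  have Bc: "compact (B i)" if "i < N" for i using valid_facts(2) v that by (simp add: B_def)
  have cB: "c i \<in> B i" if "i < N" for i using valid_facts(3,4)[OF v[OF that]] by (auto simp: B_def c_def)
  have c_inj: "c i \<noteq> c j" if "i < N" "j < N" "i \<noteq> j" for i j
    using Bdisj[OF that] cB[OF that(1)] cB[OF that(2)] by (auto simp: B_def)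
  \<comment> \<open>Two rounds of N moves of cost \<open>\<epsilon>\<close> must stay below
    \<open>\<delta>/3\<close>. The number N comes from the Vitali family alone; l and the orbit
    lengths are chosen afterwards.\<close>
  define \<epsilon> where "\<epsilon> = \<delta> / (6 * (real N + 1))"
  have \<epsilon>: "\<epsilon> > 0" "2 * (real N * \<epsilon>) < \<delta>/3"
    using \<delta> by (auto simp: \<epsilon>_def field_simps)
  obtain l where l: "l > 0"
    "\<And>x. \<exists>d. valid d \<and> ball x l \<subseteq> chart_ball d \<and> (\<forall>y\<in>chart_cball d. \<forall>z\<in>chart_cball d. dist y z < \<epsilon>)"
    using lebesgue_number[OF \<epsilon>(1)] by metis
  have "finite (c ` {..<N})" by simp
  from generic_orbits[OF f l(1) this, of N "\<lambda>i. f (c i)"] obtain z where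
    z: "\<forall>i<N. dist (z i) (f (c i)) < l \<and> (\<forall>x\<in>c ` {..<N}. \<forall>j k. (f ^^ j) (z i) \<noteq> (f ^^ k) x) \<and>
    (\<forall>i'<i. \<forall>j k. (f ^^ j) (z i) \<noteq> (f ^^ k) (z i'))" by blast
  define s where "s i j = (f ^^ j) (z i)" for i j
  have s0: "s i 0 = z i" and sS: "s i (Suc j) = f (s i j)" for i j by (auto simp: s_def)
  have sc: "s i j \<noteq> c i'" "s i j \<noteq> f (c i')" if "i < N" "i' < N" for i i' j
  proof -
    have "\<And>k. s i j \<noteq> (f ^^ k) (c i')" using z that unfolding s_def by blast
    from this[of 0] this[of 1] show "s i j \<noteq> c i'" "s i j \<noteq> f (c i')" by simp_all
  qed
  have ss: "s i j \<noteq> s i' j'" if "i < N" "i' < N" "i \<noteq> i'" for i i' j j'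
    using z that unfolding s_def by (metis linorder_neqE_nat)
  \<comment> \<open>Half of l is spent on the return, the other half on the distance from
    \<open>s i (mm i)\<close> to the point \<open>y i\<close> where the orbit is closed.\<close>
  have "\<exists>m n. m < n \<and> dist (s i m) (s i n) < l/2 \<and> inj_on (s i) {..<n} \<and> inj_on (s i) {1..n}" for i
  proof -
    have "l/2 > 0" using l(1) by simp
    from first_near_return[OF f this, of "z i"] show ?thesis unfolding s_def by metis
  qed
  then obtain mm nn where mn: "\<And>i. mm i < nn i" "\<And>i. dist (s i (mm i)) (s i (nn i)) < l/2"
    "\<And>i. inj_on (s i) {..<nn i}" "\<And>i. inj_on (s i) {1..nn i}" by metis
  \<comment> \<open>Time \<open>nn i\<close> is excluded: the image of the last orbit point will be
    redirected into the trap at \<open>s i (mm i)\<close>.\<close>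
  define Pi where "Pi i = s i ` {..<nn i}" for i
  define P where "P = (\<Union>i<N. Pi i)"
  have finPi: "finite (Pi i)" for i by (simp add: Pi_def)
  have finP: "finite P" by (simp add: P_def finPi)
  have PiD: "Pi i \<inter> Pi j = {}" if "i < N" "j < N" "i \<noteq> j" for i j
    using ss[OF that] by (auto simp: Pi_def)
  have cP: "c i \<notin> P" if "i < N" for i
    using sc(1)[OF _ that] by (force simp: P_def Pi_def)
  have sP: "s i j \<in> P" if "i < N" "j < nn i" for i j
    using that by (auto simp: P_def Pi_def)
  define e1 where "e1 = e / (2 * (real N + 1))"
  have e1: "e1 > 0" "real N * e1 < e/2" using e by (auto simp: e1_def field_simps)
  have "\<exists>K G. compact K \<and> K \<subseteq> B i \<and> open G \<and> P \<subseteq> G \<and> G \<inter> K = {} \<and> measure m (B i - K) < e1 \<and>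
      (\<forall>V. open V \<longrightarrow> c i \<in> V \<longrightarrow> (\<exists>h. homeo h \<and> (\<forall>x. x \<notin> B i \<longrightarrow> h x = x) \<and> (\<forall>x\<in>G. h x = x) \<and> h ` K \<subseteq> V))"
    if "i < N" for i
    by (rule shrink_chart_ball[OF dim v[OF that] finP cP[OF that, unfolded c_def] e1(1)])
      (unfold B_def c_def, blast)
  then obtain K G where KG: "\<And>i. i < N \<Longrightarrow> compact (K i) \<and> K i \<subseteq> B i \<and> open (G i) \<and> P \<subseteq> G i \<and> G i \<inter> K i = {} \<and>
      measure m (B i - K i) < e1"
    and shrink1: "\<And>i V. i < N \<Longrightarrow> open V \<Longrightarrow> c i \<in> V \<Longrightarrow>
      \<exists>h. homeo h \<and> (\<forall>x. x \<notin> B i \<longrightarrow> h x = x) \<and> (\<forall>x\<in>G i. h x = x) \<and> h ` K i \<subseteq> V"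
    by metis
  define GG where "GG = (\<Inter>i<N. G i)"
  have GG: "open GG" "P \<subseteq> GG" unfolding GG_def using KG by auto
  obtain s1 where s1: "s1 > 0" "\<forall>x\<in>P. \<forall>y\<in>P. x \<noteq> y \<longrightarrow> s1 \<le> dist x y" using finite_separated[OF finP] by blast
  obtain r1 where r1: "r1 > 0" "\<And>p. p \<in> P \<Longrightarrow> ball p r1 \<subseteq> GG"
    using Heine_Borel_lemma[OF finite_imp_compact[OF finP], of "{GG}"] GG by auto
  \<comment> \<open>r1 keeps the traps inside \<open>GG\<close>, where \<open>H1\<close> is the
    identity; s1 makes them disjoint; l is for closing the orbits, \<open>\<eta>\<close> for the
    displacement by \<open>H2\<close>, and e for the diameters.\<close>
  define \<rho> where "\<rho> = min (min r1 (s1/2)) (min (l/2) (min (\<eta>/4) (e/2)))"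
  have \<rho>: "\<rho> > 0" "\<rho> \<le> r1" "2 * \<rho> \<le> s1" "\<rho> \<le> l/2" "2 * \<rho> \<le> \<eta>/2" "2 * \<rho> \<le> e"
    using r1(1) s1(1) l(1) \<eta>(1) e unfolding \<rho>_def by auto
  have "\<exists>B2 V. compact V \<and> V \<subseteq> B2 \<and> B2 \<subseteq> ball p \<rho> \<and> p \<in> interior V \<and>
      (\<forall>W. open W \<longrightarrow> p \<in> W \<longrightarrow> (\<exists>h. homeo h \<and> (\<forall>x. x \<notin> B2 \<longrightarrow> h x = x) \<and> h ` V \<subseteq> W))" for p :: 'm
  proof -
    obtain d' where d': "valid d'" "chart_center d' = p" "chart_cball d' \<subseteq> ball p \<rho>"
      using small_valid[of "ball p \<rho>" p] \<rho>(1) by (metis centre_in_ball open_ball)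
    have "chart_center d' \<notin> {}" by simp
    show ?thesis
    proof (rule shrink_chart_ball[OF dim d'(1) finite.emptyI \<open>chart_center d' \<notin> {}\<close> e])
      fix V G assume V: "compact V" "V \<subseteq> chart_cball d'" "{} = {} \<Longrightarrow> chart_center d' \<in> interior V"
        "\<And>W. open W \<Longrightarrow> chart_center d' \<in> W \<Longrightarrow>
         \<exists>h. homeo h \<and> (\<forall>x. x \<notin> chart_cball d' \<longrightarrow> h x = x) \<and> (\<forall>x\<in>G. h x = x) \<and> h ` V \<subseteq> W"
      have "p \<in> interior V" using V(3) d'(2) by simp
      moreover have "\<exists>h. homeo h \<and> (\<forall>x. x \<notin> chart_cball d' \<longrightarrow> h x = x) \<and> h ` V \<subseteq> W" if "open W" "p \<in> W" for W
        using V(4)[OF that(1)] that(2) d'(2) by metis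
      ultimately show ?thesis using V(1,2) d'(3) by (intro exI[of _ "chart_cball d'"] exI[of _ V]) simp
    qed
  qed
  then obtain B2 V :: "'m \<Rightarrow> 'm set" where BV: "\<And>p. compact (V p) \<and> V p \<subseteq> B2 p \<and> B2 p \<subseteq> ball p \<rho> \<and> p \<in> interior (V p)"
    and shrink2: "\<And>p W. open W \<Longrightarrow> p \<in> W \<Longrightarrow> \<exists>h. homeo h \<and> (\<forall>x. x \<notin> B2 p \<longrightarrow> h x = x) \<and> h ` V p \<subseteq> W"
    by metis
  have B2D: "B2 p \<inter> B2 p' = {}" if "p \<in> P" "p' \<in> P" "p \<noteq> p'" for p p'
  proof (rule equals0I)
    fix x assume "x \<in> B2 p \<inter> B2 p'"
    then have "x \<in> ball p \<rho>" "x \<in> ball p' \<rho>" using BV by blast+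
    then have "dist p p' < 2 * \<rho>" using dist_triangle2[of p p' x] by simp
    moreover have "s1 \<le> dist p p'" using s1(2) that by blast
    ultimately show False using \<rho>(3) by linarith
  qed
  have B2G: "B2 p \<subseteq> GG" if "p \<in> P" for p
    using BV[of p] r1(2)[OF that] \<rho>(2) by (meson subset_ball subset_trans)
  \<comment> \<open>The orbit cannot be closed at \<open>s i (mm i)\<close> itself: if
    \<open>mm i\<close> is positive, this point is already the image of the preceding orbit point. A
    generic nearby point inside the same trap is free.\<close>
  define bad where "bad = P \<union> f ` c ` {..<N} \<union> (\<Union>i<N. s i ` {..nn i})"
  have "\<exists>y. y \<in> interior (V (s i (mm i))) \<and> y \<notin> bad" for i
  proof (rule generic_point[of "interior (V (s i (mm i)))" bad])
    show "interior (V (s i (mm i))) \<noteq> {}" using BV by blast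
    show "countable bad" unfolding bad_def using finP by (intro countable_finite) simp
  qed auto
  then obtain y where y: "\<And>i. y i \<in> interior (V (s i (mm i)))" "\<And>i. y i \<notin> bad" by metis
  have yB2: "y i \<in> B2 (s i (mm i))" for i
    using y(1)[of i] interior_subset BV by blast
  have y_inj: "y i \<noteq> y j" if "i < N" "j < N" "i \<noteq> j" for i j
    using B2D[of "s i (mm i)" "s j (mm j)"] ss[OF that] sP[OF that(1) mn(1)] sP[OF that(2) mn(1)] yB2[of i] yB2[of j]
    by auto
  have y_s: "y i \<noteq> s i' j" if "i' < N" "j \<le> nn i'" for i i' j
    using y(2)[of i] that by (auto simp: bad_def)
  have y_c: "y i \<noteq> f (c i')" if "i' < N" for i i'
    using y(2)[of i] that by (auto simp: bad_def)
  \<comment> \<open>The values of f along the orbits that must survive both rounds of moves. Time 0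
    is left out, because \<open>z i\<close> is to become the image of the center
    \<open>c i\<close>.\<close>
  define F0 where "F0 = (\<Union>i<N. s i ` {1..<nn i})"
  have finF0: "finite F0" by (simp add: F0_def)
  have F0_neI: "x \<notin> F0" if "\<And>i j. i < N \<Longrightarrow> j \<in> {1..<nn i} \<Longrightarrow> x \<noteq> s i j" for x
    using that unfolding F0_def by blast
  have y_F0: "y i \<notin> F0" for i
    by (rule F0_neI) (use y_s in auto)
  \<comment> \<open>The orbits are closed first, in a separate round: if a return is exact,
    \<open>s i (nn i) = z i\<close> has to be vacated before \<open>z i\<close> can serve as the
    target of \<open>f (c i)\<close>.\<close>
  have "\<exists>k. homeo k \<and> (\<forall>i\<in>{..<N}. k (s i (nn i)) = y i) \<and> (\<forall>x\<in>F0 \<union> f ` c ` {..<N}. k x = x) \<and>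
      (\<forall>x. dist (k x) x \<le> card {..<N} * \<epsilon>)"
  proof (rule move_points[OF dim l(2) \<epsilon>(1)])
    show "finite (F0 \<union> f ` c ` {..<N})" using finF0 by simp
    show "inj_on (\<lambda>i. s i (nn i)) {..<N}" using ss by (auto simp: inj_on_def)
    show "inj_on y {..<N}" using y_inj by (auto simp: inj_on_def)
    show "y i \<noteq> s j (nn j)" if "j \<in> {..<N}" for i j using y_s that by simp
    show "s i (nn i) \<notin> F0 \<union> f ` c ` {..<N} \<and> y i \<notin> F0 \<union> f ` c ` {..<N} \<and> dist (s i (nn i)) (y i) < l"
      if "i \<in> {..<N}" for i
    proof (intro conjI)
      have i: "i < N" using that by simp
      have ne: "s i (nn i) \<noteq> s i' j" if "i' < N" "j \<in> {1..<nn i'}" for i' j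
      proof (cases "i' = i")
        case True
        have "nn i \<in> {1..nn i}" using mn(1)[of i] by simp
        then show ?thesis using inj_onD[OF mn(4)[of i], of "nn i" j] that True by auto
      qed (use ss[OF i that(1)] in auto)
      have "s i (nn i) \<noteq> f (c i')" if "i' \<in> {..<N}" for i' using sc(2)[OF i] that by simp
      then show "s i (nn i) \<notin> F0 \<union> f ` c ` {..<N}" using F0_neI[OF ne] by blast
      have "y i \<noteq> f (c i')" if "i' \<in> {..<N}" for i' using y_c that by simp
      then show "y i \<notin> F0 \<union> f ` c ` {..<N}" using y_F0[of i] by blast
      have "y i \<in> ball (s i (mm i)) \<rho>" using yB2[of i] BV by blast
      then show "dist (s i (nn i)) (y i) < l"
        using mn(2)[of i] \<rho>(4) dist_triangle3[of "s i (nn i)" "y i" "s i (mm i)"] by simp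
    qed
  qed simp
  then obtain k1 where k1: "homeo k1" "\<And>i. i < N \<Longrightarrow> k1 (s i (nn i)) = y i" "\<And>x. x \<in> F0 \<union> f ` c ` {..<N} \<Longrightarrow> k1 x = x"
    "\<And>x. dist (k1 x) x \<le> N * \<epsilon>" by auto
  have "\<exists>k. homeo k \<and> (\<forall>i\<in>{..<N}. k (f (c i)) = z i) \<and> (\<forall>x\<in>F0 \<union> y ` {..<N}. k x = x) \<and>
      (\<forall>x. dist (k x) x \<le> card {..<N} * \<epsilon>)"
  proof (rule move_points[OF dim l(2) \<epsilon>(1)])
    show "finite (F0 \<union> y ` {..<N})" using finF0 by simp
    show "inj_on (\<lambda>i. f (c i)) {..<N}" using c_inj homeo_inj[OF f] by (auto simp: inj_on_def)
    show "inj_on z {..<N}" using ss[of _ _ 0 0] by (auto simp: inj_on_def s0)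
    show "z i \<noteq> f (c j)" if "i \<in> {..<N}" "j \<in> {..<N}" for i j using sc(2)[of i j 0] that by (simp add: s0)
    show "f (c i) \<notin> F0 \<union> y ` {..<N} \<and> z i \<notin> F0 \<union> y ` {..<N} \<and> dist (f (c i)) (z i) < l"
      if "i \<in> {..<N}" for i
    proof (intro conjI)
      have i: "i < N" using that by simp
      have "f (c i) \<notin> F0" by (rule F0_neI) (use sc(2)[OF _ i] in metis)
      moreover have "f (c i) \<noteq> y i'" for i' using y_c[OF i, of i'] by simp
      ultimately show "f (c i) \<notin> F0 \<union> y ` {..<N}" by blast
      have ne: "z i \<noteq> s i' j" if "i' < N" "j \<in> {1..<nn i'}" for i' j
      proof (cases "i' = i")
        case True
        then show ?thesis using inj_onD[OF mn(3)[of i], of 0 j] that by (auto simp: s0)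
      qed (use ss[OF i that(1), of 0] in \<open>auto simp: s0\<close>)
      have "z i \<noteq> y i'" for i' using y_s[OF i, of 0 i'] by (metis s0 zero_le)
      then show "z i \<notin> F0 \<union> y ` {..<N}" using F0_neI[OF ne] by blast
      show "dist (f (c i)) (z i) < l" using z i by (simp add: dist_commute)
    qed
  qed simp
  then obtain k2 where k2: "homeo k2" "\<And>i. i < N \<Longrightarrow> k2 (f (c i)) = z i" "\<And>x. x \<in> F0 \<union> y ` {..<N} \<Longrightarrow> k2 x = x"
    "\<And>x. dist (k2 x) x \<le> N * \<epsilon>" by auto
  define Fm where "Fm x = k2 (k1 (f x))" for x
  have Fm: "homeo Fm" unfolding Fm_def using homeo_comp[OF k2(1) homeo_comp[OF k1(1) f]] .
  then have Fmc: "continuous_on UNIV Fm" by (simp add: homeo_def)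
  have Fm_near: "dist (Fm x) (f x) < \<delta>/3" for x
  proof -
    have "dist (Fm x) (f x) \<le> N * \<epsilon> + N * \<epsilon>"
      using dist_triangle[of "Fm x" "f x" "k1 (f x)"] k2(4)[of "k1 (f x)"] k1(4)[of "f x"]
      unfolding Fm_def by linarith
    then show ?thesis using \<epsilon>(2) by linarith
  qed
  have Fm_c: "Fm (c i) = z i" if "i < N" for i
    using k1(3)[of "f (c i)"] k2(2)[OF that] that by (simp add: Fm_def)
  have Fm_P: "\<exists>p'\<in>Pi i. Fm p \<in> interior (V p')" if iN: "i < N" and pi: "p \<in> Pi i" for i p
  proof -
    obtain j where j: "j < nn i" "p = s i j" using pi by (auto simp: Pi_def)
    show ?thesis
    proof (cases "Suc j < nn i")
      case True
      then have "s i (Suc j) \<in> s i ` {1..<nn i}" by (intro imageI) simp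
      then have "s i (Suc j) \<in> F0" using iN unfolding F0_def by blast
      moreover have "f p = s i (Suc j)" using sS[of i j] j(2) by simp
      ultimately have "Fm p = s i (Suc j)" using k1(3) k2(3) by (simp add: Fm_def)
      then show ?thesis using True BV by (intro bexI[of _ "s i (Suc j)"]) (auto simp: Pi_def)
    next
      case False
      then have "Suc j = nn i" using j(1) by simp
      then have "f p = s i (nn i)" using sS[of i j] j(2) by simp
      then have "Fm p = y i" using k1(2)[OF iN] k2(3)[of "y i"] iN by (simp add: Fm_def)
      then show ?thesis using y(1)[of i] mn(1)[of i] by (intro bexI[of _ "s i (mm i)"]) (auto simp: Pi_def)
    qed
  qed
  have "\<exists>p'. Fm p \<in> interior (V p') \<and> (\<forall>i<N. p \<in> Pi i \<longrightarrow> p' \<in> Pi i)" if "p \<in> P" for p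
  proof -
    obtain i where i: "i < N" "p \<in> Pi i" using \<open>p \<in> P\<close> by (auto simp: P_def)
    obtain p' where "p' \<in> Pi i" "Fm p \<in> interior (V p')" using Fm_P[OF i] by blast
    then show ?thesis using PiD[OF i(1)] i(2) by blast
  qed
  then obtain nx where nx: "\<And>p. p \<in> P \<Longrightarrow> Fm p \<in> interior (V (nx p)) \<and> (\<forall>i<N. p \<in> Pi i \<longrightarrow> nx p \<in> Pi i)" by metis
  obtain r2 where r2: "r2 > 0" "measure m (\<Union>x\<in>z ` {..<N}. ball x r2) < e"
    using small_measure_balls[of "z ` {..<N}" e] e by auto
  define W where "W = (\<Union>x\<in>z ` {..<N}. ball x r2)"
  have W: "open W" "measure m W < e" using r2 by (auto simp: W_def)
  have zW: "z i \<in> W" if "i < N" for i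
    unfolding W_def by (rule UN_I[of "z i"]) (use that r2(1) in auto)
  have "\<exists>h. homeo h \<and> (\<forall>x. x \<notin> B i \<longrightarrow> h x = x) \<and> (\<forall>x\<in>G i. h x = x) \<and>
      h ` K i \<subseteq> Fm -` (W \<inter> interior (V (z i)))" if i: "i < N" for i
  proof (rule shrink1[OF i])
    show "open (Fm -` (W \<inter> interior (V (z i))))" using W(1) Fmc by (intro open_vimage) auto
    show "c i \<in> Fm -` (W \<inter> interior (V (z i)))" using Fm_c[OF i] zW[OF i] BV by simp
  qed
  then obtain h1 where h1: "\<And>i. i < N \<Longrightarrow> homeo (h1 i)" "\<And>i x. i < N \<Longrightarrow> x \<notin> B i \<Longrightarrow> h1 i x = x"
    "\<And>i x. i < N \<Longrightarrow> x \<in> G i \<Longrightarrow> h1 i x = x"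
    "\<And>i. i < N \<Longrightarrow> h1 i ` K i \<subseteq> Fm -` (W \<inter> interior (V (z i)))" by metis
  have "\<exists>h. homeo h \<and> (\<forall>x. x \<notin> B2 p \<longrightarrow> h x = x) \<and> h ` V p \<subseteq> Fm -` interior (V (nx p))" if p: "p \<in> P" for p
  proof (rule shrink2)
    show "open (Fm -` interior (V (nx p)))" using Fmc by (intro open_vimage) auto
    show "p \<in> Fm -` interior (V (nx p))" using nx[OF p] by simp
  qed
  then obtain h2 where h2: "\<And>p. p \<in> P \<Longrightarrow> homeo (h2 p)" "\<And>p x. p \<in> P \<Longrightarrow> x \<notin> B2 p \<Longrightarrow> h2 p x = x"
    "\<And>p. p \<in> P \<Longrightarrow> h2 p ` V p \<subseteq> Fm -` interior (V (nx p))" by metis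
  have "\<exists>k. homeo k \<and> (\<forall>i\<in>{..<N}. \<forall>x\<in>B i. k x = h1 i x) \<and> (\<forall>x. x \<notin> (\<Union>i\<in>{..<N}. B i) \<longrightarrow> k x = x)"
    by (rule homeo_combine) (use Bdisj h1 in \<open>auto simp: B_def\<close>)
  then obtain H1 where H1: "homeo H1" "\<And>i x. i < N \<Longrightarrow> x \<in> B i \<Longrightarrow> H1 x = h1 i x"
    "\<And>x. x \<notin> (\<Union>i\<in>{..<N}. B i) \<Longrightarrow> H1 x = x" by blast
  have "\<exists>k. homeo k \<and> (\<forall>p\<in>P. \<forall>x\<in>B2 p. k x = h2 p x) \<and> (\<forall>x. x \<notin> (\<Union>p\<in>P. B2 p) \<longrightarrow> k x = x)"
    by (rule homeo_combine[OF finP]) (use B2D h2 in blast)+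
  then obtain H2 where H2: "homeo H2" "\<And>p x. p \<in> P \<Longrightarrow> x \<in> B2 p \<Longrightarrow> H2 x = h2 p x"
    "\<And>x. x \<notin> (\<Union>p\<in>P. B2 p) \<Longrightarrow> H2 x = x" by blast
  have H1_near: "dist (H1 x) x < \<eta>/2" for x
  proof (cases "x \<in> (\<Union>i\<in>{..<N}. B i)")
    case True
    then obtain i where i: "i < N" "x \<in> B i" by blast
    then have "h1 i x \<in> B i" using homeo_maps_support[OF h1(1)[OF i(1)], of "B i" x] h1(2) by blast
    then show ?thesis using H1(2)[OF i] diam[OF i(1)] i(2) by (simp add: B_def)
  qed (use H1(3) \<eta>(1) in simp)
  have H2_near: "dist (H2 x) x < \<eta>/2" for x
  proof (cases "x \<in> (\<Union>p\<in>P. B2 p)")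
    case True
    then obtain p where p: "p \<in> P" "x \<in> B2 p" by blast
    then have "h2 p x \<in> B2 p" using homeo_maps_support[OF h2(1)[OF p(1)], of "B2 p" x] h2(2) by blast
    then have "h2 p x \<in> ball p \<rho>" "x \<in> ball p \<rho>" using p(2) BV by blast+
    then show ?thesis using H2(2)[OF p] \<rho>(5) dist_triangle3[of "h2 p x" x p] by simp
  qed (use H2(3) \<eta>(1) in simp)
  have H1_GG: "H1 x = x" if "x \<in> GG" for x
  proof (cases "x \<in> (\<Union>i\<in>{..<N}. B i)")
    case True
    then obtain i where i: "i < N" "x \<in> B i" by blast
    then have "x \<in> G i" using that by (auto simp: GG_def)
    then show ?thesis using H1(2)[OF i] h1(3)[OF i(1)] by simp
  qed (rule H1(3))
  \<comment> \<open>The two contractions do not interfere: \<open>H2\<close> is supported in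
    \<open>GG\<close>, hence is the identity on each \<open>K i\<close>; and it preserves each
    \<open>B2 p\<close>, which lies in \<open>GG\<close>, where \<open>H1\<close> is the
    identity.\<close>
  define g where "g x = Fm (H1 (H2 x))" for x
  have g: "homeo g" unfolding g_def using homeo_comp[OF Fm homeo_comp[OF H1(1) H2(1)]] .
  have g_near: "dist (g x) (f x) < \<delta>" for x
  proof -
    have "dist (H1 (H2 x)) x < \<eta>"
      using dist_triangle[of "H1 (H2 x)" x "H2 x"] H1_near[of "H2 x"] H2_near[of x] by linarith
    then have "dist (f (H1 (H2 x))) (f x) < \<delta>/3" by (rule \<eta>(2))
    then show ?thesis
      using dist_triangle[of "g x" "f x" "f (H1 (H2 x))"] Fm_near[of "H1 (H2 x)"] \<delta>
      unfolding g_def by linarith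
  qed
  have gK: "g ` K i \<subseteq> W \<inter> interior (V (z i))" if i: "i < N" for i
  proof
    fix w assume "w \<in> g ` K i"
    then obtain x where x: "x \<in> K i" "w = g x" by blast
    have "x \<notin> GG" using x(1) KG[OF i] i by (auto simp: GG_def)
    then have "H2 x = x" using H2(3) B2G by blast
    moreover have "H1 x = h1 i x" using H1(2)[OF i] x(1) KG[OF i] by blast
    ultimately show "w \<in> W \<inter> interior (V (z i))" using h1(4)[OF i] x by (auto simp: g_def)
  qed
  have gV: "g ` V p \<subseteq> interior (V (nx p))" if p: "p \<in> P" for p
  proof
    fix w assume "w \<in> g ` V p"
    then obtain x where x: "x \<in> V p" "w = g x" by blast
    have xB: "x \<in> B2 p" using x(1) BV by blast
    then have "h2 p x \<in> B2 p" using homeo_maps_support[OF h2(1)[OF p], of "B2 p" x] h2(2)[OF p] by blast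
    then have "H1 (H2 x) = h2 p x" using H1_GG B2G[OF p] H2(2)[OF p xB] by auto
    then show "w \<in> interior (V (nx p))" using h2(3)[OF p] x by (auto simp: g_def)
  qed
  have "trapping m e g"
  proof (rule trappingI[where B = B and K = K and Z = Pi and V = V and W = W and N = N])
    show "compact (K i) \<and> K i \<subseteq> B i \<and> compact (B i) \<and> measure m (B i) < e" if "i < N" for i
      using KG[OF that] Bc[OF that] mB[OF that] by (simp add: B_def)
    show "measure m (\<Union>i<N. K i) > 1 - e"
    proof -
      have D_sets: "B i - K i \<in> sets m" if "i < N" for i
        using sets_mI(3)[OF Bc[OF that]] sets_mI(3)[of "K i"] KG[OF that] by (intro sets.Diff) auto
      have U_sets: "(\<Union>i<N. K i) \<in> sets m" by (intro sets.finite_UN) (use KG sets_mI(3) in auto)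
      have DU_sets: "(\<Union>i<N. B i - K i) \<in> sets m" by (intro sets.finite_UN) (use D_sets in auto)
      have "measure m (\<Union>i<N. B i) \<le> measure m ((\<Union>i<N. K i) \<union> (\<Union>i<N. B i - K i))"
        by (rule finite_measure_mono) (use U_sets DU_sets in auto)
      also have "\<dots> \<le> measure m (\<Union>i<N. K i) + measure m (\<Union>i<N. B i - K i)"
        using U_sets DU_sets by (rule measure_Un_le)
      also have "measure m (\<Union>i<N. B i - K i) \<le> (\<Sum>i<N. measure m (B i - K i))"
        by (rule measure_UNION_le) (use D_sets in auto)
      also have "\<dots> \<le> (\<Sum>i<N. e1)" using KG by (intro sum_mono) (auto intro: less_imp_le)
      finally show ?thesis using Bbig e1(2) by (simp add: B_def)
    qed
    show "compact (V p) \<and> (\<forall>x\<in>V p. \<forall>y\<in>V p. dist x y \<le> e)" for p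
    proof (intro conjI ballI)
      show "compact (V p)" using BV by blast
      fix x y assume "x \<in> V p" "y \<in> V p"
      then have "x \<in> ball p \<rho>" "y \<in> ball p \<rho>" using BV by blast+
      then show "dist x y \<le> e" using \<rho>(6) dist_triangle3[of x y p] by simp
    qed
    show "V p \<inter> V p' = {}" if "i < N" "j < N" "i \<noteq> j" "p \<in> Pi i" "p' \<in> Pi j" for i j p p'
    proof -
      have "p \<in> P" "p' \<in> P" "p \<noteq> p'" using that PiD[OF that(1-3)] by (auto simp: P_def)
      from B2D[OF this] show ?thesis using BV by blast
    qed
    show "\<exists>p\<in>Pi i. g ` K i \<subseteq> W \<inter> interior (V p)" if "i < N" for i
    proof -
      have "z i \<in> Pi i" using mn(1)[of i] s0[of i] by (auto simp: Pi_def intro!: image_eqI[of _ _ 0])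
      then show ?thesis using gK[OF that] by blast
    qed
    show "\<exists>p'\<in>Pi i. g ` V p \<subseteq> interior (V p')" if "i < N" "p \<in> Pi i" for i p
    proof -
      have "p \<in> P" using that by (auto simp: P_def)
      then show ?thesis using gV nx that by blast
    qed
  qed (use finPi W in auto)
  then show ?thesis using g g_near by blast
qed

end

section \<open>Residual sets of weird maps\<close>

lemma residual_inI:
  fixes U :: "nat \<Rightarrow> 'a::metric_space set"
  assumes op: "\<And>n. open (U n)"
    and dense: "\<And>n f e. f \<in> H \<Longrightarrow> e > 0 \<Longrightarrow> \<exists>g\<in>H \<inter> U n. dist g f < e"
  shows "residual_in (top_of_set H) (H \<inter> (\<Inter>n. U n))"
  unfolding residual_in_def
proof (intro conjI exI[of _ "range (\<lambda>n. H \<inter> U n)"] ballI)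
  fix S assume "S \<in> range (\<lambda>n. H \<inter> U n)"
  then obtain n where S: "S = H \<inter> U n" by blast
  show "openin (top_of_set H) S" unfolding S by (intro openin_open_Int op)
  have "H \<subseteq> closure (H \<inter> U n)"
    using dense[of _ _ n] unfolding subset_iff closure_approachable by blast
  then show "top_of_set H closure_of S = topspace (top_of_set H)"
    unfolding S by (auto simp: closure_of_subtopology)
qed auto

context charted_measure
begin

lemma apply_Bcontfun:
  assumes "continuous_on UNIV g"
  shows "apply_bcontfun (Bcontfun g) = (g :: 'm \<Rightarrow> 'm)"
proof (rule Bcontfun_inverse)
  show "g \<in> bcontfun"
    using assms bounded_subset[OF compact_imp_bounded[OF comp] subset_UNIV] by (auto simp: bcontfun_def)
qed

text \<open>A strict pointwise bound becomes a weak one for the supremum; halving restores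
  strictness.\<close>

lemma dist_Bcontfun_less:
  fixes f :: "'m \<Rightarrow>\<^sub>C 'm"
  assumes g: "continuous_on UNIV g" and "\<And>x. dist (g x) (apply_bcontfun f x) < e / 2" and e: "e > 0"
  shows "dist (Bcontfun g) f < e"
proof -
  have "dist (Bcontfun g) f \<le> e / 2"
    by (rule dist_bound) (use assms(2) in \<open>simp add: apply_Bcontfun[OF g] less_imp_le\<close>)
  then show ?thesis using e by simp
qed

lemma weird_if_all_trapping:
  assumes "f \<in> H \<inter> (\<Inter>n. {f. trapping m ((1/2)^n) (apply_bcontfun f)})"
  shows "weird m (apply_bcontfun f)"
  by (rule weird_if_trapping[OF comp prob sets_m continuous_on_apply_bcontfun]) (use assms in auto)

lemma residual_weird:
  fixes H :: "('m \<Rightarrow>\<^sub>C 'm) set"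
  assumes "\<And>f \<delta> e. f \<in> H \<Longrightarrow> \<delta> > 0 \<Longrightarrow> e > 0 \<Longrightarrow> \<exists>g. continuous_on UNIV g \<and> Bcontfun g \<in> H \<and>
     (\<forall>x. dist (g x) (apply_bcontfun f x) < \<delta>) \<and> trapping m e g"
  shows "\<exists>R. residual_in (top_of_set H) R \<and> (\<forall>f\<in>R. weird m (apply_bcontfun f))"
proof (intro exI conjI ballI)
  show "residual_in (top_of_set H) (H \<inter> (\<Inter>n. {f. trapping m ((1/2)^n) (apply_bcontfun f)}))"
  proof (rule residual_inI)
    fix n :: nat and f :: "'m \<Rightarrow>\<^sub>C 'm" and e :: real
    assume f: "f \<in> H" and e: "e > 0"
    then obtain g where g: "continuous_on UNIV g" "Bcontfun g \<in> H"
      "\<forall>x. dist (g x) (apply_bcontfun f x) < e / 2" "trapping m ((1/2)^n) g"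
      using assms[OF f, of "e/2" "(1/2)^n"] by auto
    then show "\<exists>g\<in>H \<inter> {f. trapping m ((1/2)^n) (apply_bcontfun f)}. dist g f < e"
      using dist_Bcontfun_less[OF g(1) _ e] by (intro bexI[of _ "Bcontfun g"]) (auto simp: apply_Bcontfun)
  qed (rule open_trapping)
qed (rule weird_if_all_trapping)

lemma residual_weird_C0:
  "\<exists>R. residual_in (C0_space :: ('m \<Rightarrow>\<^sub>C 'm) topology) R \<and> (\<forall>f\<in>R. weird m (apply_bcontfun f))"
  using residual_weird[of UNIV] trapping_dense_C0[OF continuous_on_apply_bcontfun]
  by (simp add: C0_space_def)

lemma residual_weird_Homeo:
  assumes dim: "DIM('e) \<ge> 2"
  shows "\<exists>R. residual_in (Homeo_space :: ('m \<Rightarrow>\<^sub>C 'm) topology) R \<and> (\<forall>f\<in>R. weird m (apply_bcontfun f))"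
  unfolding Homeo_space_def
proof (rule residual_weird)
  fix f :: "'m \<Rightarrow>\<^sub>C 'm" and \<delta> e :: real
  assume "f \<in> {f. \<exists>g. homeomorphism UNIV UNIV (apply_bcontfun f) g}" and pos: "\<delta> > 0" "e > 0"
  then obtain f' where f': "homeomorphism UNIV UNIV (apply_bcontfun f) f'" by auto
  have "homeo (apply_bcontfun f)"
    using f' by (auto simp: homeo_def homeomorphism_def intro!: bij_betwI[where g = f'])
  from trapping_dense_homeo[OF dim this pos] obtain g where g: "homeo g"
    "\<forall>x. dist (g x) (apply_bcontfun f x) < \<delta>" "trapping m e g" by blast
  have gc: "continuous_on UNIV g" using g(1) by (simp add: homeo_def)
  have "Bcontfun g \<in> {f. \<exists>g. homeomorphism UNIV UNIV (apply_bcontfun f) g}"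
    using homeo_imp_homeomorphism[OF comp g(1)] by (simp add: apply_Bcontfun[OF gc])
  then show "\<exists>g. continuous_on UNIV g \<and> Bcontfun g \<in> {f. \<exists>g. homeomorphism UNIV UNIV (apply_bcontfun f) g} \<and>
      (\<forall>x. dist (g x) (apply_bcontfun f x) < \<delta>) \<and> trapping m e g" using g gc by blast
qed

end

text \<open>In a chart the measure has a density, and the integral of any function over a null set
  is zero.\<close>

lemma charted_measure_if_volume_probability:
  fixes \<A> :: "('m::metric_space set \<times> ('m \<Rightarrow> 'e::euclidean_space)) set"
  assumes "compact (UNIV :: 'm set)" "smooth_atlas \<A>" "volume_probability \<A> m"
  shows "charted_measure \<A> m"
proof (intro charted_measure.intro charted.intro charted_measure_axioms.intro)
  show "compact (UNIV :: 'm set)" by fact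
  show "\<And>c. c \<in> \<A> \<Longrightarrow> chart c" using assms(2) by (simp add: smooth_atlas_def)
  show "\<exists>(U, \<phi>)\<in>\<A>. x \<in> U" for x :: 'm
  proof -
    have "x \<in> (\<Union>(U, \<phi>)\<in>\<A>. U)" using assms(2) by (simp add: smooth_atlas_def)
    then show ?thesis by blast
  qed
  show "prob_space m" "sets m = sets borel" using assms(3) by (simp_all add: volume_probability_def)
  fix U :: "'m set" and \<phi> :: "'m \<Rightarrow> 'e" and N
  assume U: "(U, \<phi>) \<in> \<A>" and N: "N \<in> null_sets lborel" "N \<subseteq> \<phi> ` U"
  then obtain \<rho> :: "'e \<Rightarrow> real" where
    "\<forall>B\<in>sets borel. B \<subseteq> \<phi> ` U \<longrightarrow> emeasure m {x \<in> U. \<phi> x \<in> B} = (\<integral>\<^sup>+ y \<in> B. ennreal (\<rho> y) \<partial>lborel)"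
    using assms(3) unfolding volume_probability_def by blast
  moreover have "N \<in> sets borel" using N(1) by auto
  ultimately have "emeasure m {x \<in> U. \<phi> x \<in> N} = (\<integral>\<^sup>+ y \<in> N. ennreal (\<rho> y) \<partial>lborel)"
    using N(2) by blast
  also have "\<dots> = 0" by (rule nn_integral_null_set[OF N(1)])
  finally show "emeasure m {x \<in> U. \<phi> x \<in> N} = 0" .
qed

theorem theorem3p6:
  fixes \<A> :: "('m::metric_space set \<times> ('m \<Rightarrow> 'e::euclidean_space)) set"
    and m :: "'m measure"
  assumes "compact (UNIV :: 'm set)"
    and "connected (UNIV :: 'm set)"
    and "smooth_atlas \<A>"
    and "volume_probability \<A> m"
  shows "(\<exists>\<R>. residual_in (C0_space :: ('m \<Rightarrow>\<^sub>C 'm) topology) \<R> \<and>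
               (\<forall>f\<in>\<R>. weird m (apply_bcontfun f))) \<and>
         (DIM('e) \<ge> 2 \<longrightarrow>
           (\<exists>\<R>. residual_in (Homeo_space :: ('m \<Rightarrow>\<^sub>C 'm) topology) \<R> \<and>
                (\<forall>f\<in>\<R>. weird m (apply_bcontfun f))))"
proof -
  have "charted_measure \<A> m"
    using assms(1,3,4) by (rule charted_measure_if_volume_probability)
  then show ?thesis
    using charted_measure.residual_weird_C0 charted_measure.residual_weird_Homeo by blast
qed

end
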